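(* Let $L=L_K(E)$ be the Leavitt path algebra of an arbitrary graph $E$ over an arbitrary field $K$, let $m,r_1,\dots,r_m$ be positive integers, and let $P_1,\dots,P_m$ be distinct prime ideals of $L$. Then $$P_1^{r_1}\cdots P_m^{r_m}=P_1^{r_1}\cap\cdots\cap P_m^{r_m}.$$
   Context: A graph $E=(E^0,E^1,r,s)$ is a directed graph: a nonempty set $E^0$ of vertices, a set $E^1$ of edges, and range and source maps $r,s:E^1\to E^0$ (no finiteness or countability assumptions). A vertex $v$ is regular if $s^{-1}(v)$ is finite and nonempty. For a field $K$, the Leavitt path algebra $L_K(E)$ is the (associative, not necessarily unital) $K$-algebra generated by $\{v\mid v\in E^0\}\cup\{e,e^*\mid e\in E^1\}$ subject to: $vw=\delta_{v,w}v$ for $v,w\in E^0$; $s(e)e=er(e)=e$ and $r(e)e^*=e^*s(e)=e^*$ for $e\in E^1$; $e^*f=\delta_{e,f}r(e)$ for $e,f\in E^1$; and $v=\sum_{e\in s^{-1}(v)}ee^*$ for every regular $v\in E^0$. "Ideal" means two-sided ideal, and the product $IJ$ of ideals is the set of finite sums of products $ab$ with $a\in I$, $b\in J$. A prime ideal is a proper ideal $P$ such that $IJ\subseteq P$ implies $I\subseteq P$ or $J\subseteq P$ for all ideals $I,J$. *)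

theory Defs
  imports
    "HOL-Algebra.Ideal_Product"
    "HOL-Algebra.QuotRing"
    "HOL-Algebra.Module"
    "HOL-Library.Poly_Mapping"
    "Graph_Theory.Digraph"
begin

section \<open>Leavitt path algebras\<close>

text \<open>
  A graph \<open>(E\<^sup>0, E\<^sup>1, r, s)\<close> is a \<^typ>\<open>('v, 'e) pre_digraph\<close> satisfying \<^const>\<open>wf_digraph\<close>
  with \<open>E\<^sup>0 = verts E \<noteq> {}\<close>, \<open>E\<^sup>1 = arcs E\<close>, \<open>s = tail E\<close> and \<open>r = head E\<close>. Loops, parallel edges and
  infinite (also uncountable) vertex and edge sets are allowed.
\<close>

definition lpa_graph :: "('v, 'e) pre_digraph \<Rightarrow> bool" where
  "lpa_graph E \<longleftrightarrow> wf_digraph E \<and> verts E \<noteq> {}"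

definition regular_vertex :: "('v, 'e) pre_digraph \<Rightarrow> 'v \<Rightarrow> bool" where
  "regular_vertex E v \<longleftrightarrow> v \<in> verts E \<and> finite (out_arcs E v) \<and> out_arcs E v \<noteq> {}"

subsection \<open>The free algebra\<close>

datatype ('v, 'e) generator = Vertex 'v | Edge 'e | Ghost 'e

text \<open>
  Words form the free monoid under concatenation, written additively so that the finitely
  supported functions from words to \<open>'k\<close>, with their convolution product, are the free unital
  associative \<open>'k\<close>-algebra.
\<close>

datatype 'x free_word = Word (letters: "'x list")

instantiation free_word :: (type) monoid_add
begin

definition zero_free_word :: "'a free_word" where
  "0 = Word []"

definition plus_free_word :: "'a free_word \<Rightarrow> 'a free_word \<Rightarrow> 'a free_word" where
  "u + w = Word (letters u @ letters w)"

instance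
  by standard (simp_all add: zero_free_word_def plus_free_word_def)

end

type_synonym ('v, 'e, 'k) free_alg = "('v, 'e) generator free_word \<Rightarrow>\<^sub>0 'k"

type_synonym ('v, 'e, 'k) lpa_elem = "('v, 'e, 'k) free_alg set"

definition gen :: "('v, 'e) generator \<Rightarrow> ('v, 'e, 'k::field) free_alg" where
  "gen x = Poly_Mapping.single (Word [x]) 1"

definition scale :: "'k::field \<Rightarrow> ('v, 'e, 'k) free_alg \<Rightarrow> ('v, 'e, 'k) free_alg" where
  "scale c a = Poly_Mapping.single 0 c * a"

definition generators :: "('v, 'e) pre_digraph \<Rightarrow> ('v, 'e) generator set" where
  "generators E = Vertex ` verts E \<union> Edge ` arcs E \<union> Ghost ` arcs E"

text \<open>
  The free non-unital algebra on the generators of \<open>E\<close>: only nonempty words occur. It is stored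
  in a \<^typ>\<open>('k, 'a) module\<close> record; the field \<open>one\<close> of that record carries no meaning here, since
  neither this algebra nor a Leavitt path algebra (unless \<open>E\<^sup>0\<close> is finite) has an identity.
\<close>

definition free_algebra ::
  "('v, 'e) pre_digraph \<Rightarrow> ('k::field, ('v, 'e, 'k) free_alg) module" where
  "free_algebra E =
    \<lparr> carrier = {a. \<forall>w \<in> Poly_Mapping.keys a. letters w \<noteq> [] \<and> set (letters w) \<subseteq> generators E},
      mult = (*), one = undefined, zero = 0, add = (+), smult = scale \<rparr>"

subsection \<open>The defining relations\<close>

inductive_set lpa_relations :: "('v, 'e) pre_digraph \<Rightarrow> ('v, 'e, 'k::field) free_alg set"
  for E :: "('v, 'e) pre_digraph" where
  vertices: "\<lbrakk>v \<in> verts E; w \<in> verts E\<rbrakk> \<Longrightarrow>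
    gen (Vertex v) * gen (Vertex w) - (if v = w then gen (Vertex v) else 0) \<in> lpa_relations E"
| source_edge: "e \<in> arcs E \<Longrightarrow>
    gen (Vertex (tail E e)) * gen (Edge e) - gen (Edge e) \<in> lpa_relations E"
| edge_range: "e \<in> arcs E \<Longrightarrow>
    gen (Edge e) * gen (Vertex (head E e)) - gen (Edge e) \<in> lpa_relations E"
| range_ghost: "e \<in> arcs E \<Longrightarrow>
    gen (Vertex (head E e)) * gen (Ghost e) - gen (Ghost e) \<in> lpa_relations E"
| ghost_source: "e \<in> arcs E \<Longrightarrow>
    gen (Ghost e) * gen (Vertex (tail E e)) - gen (Ghost e) \<in> lpa_relations E"
| CK1: "\<lbrakk>e \<in> arcs E; f \<in> arcs E\<rbrakk> \<Longrightarrow>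
    gen (Ghost e) * gen (Edge f) - (if e = f then gen (Vertex (head E e)) else 0)
      \<in> lpa_relations E"
| CK2: "regular_vertex E v \<Longrightarrow>
    gen (Vertex v) - (\<Sum>e\<in>out_arcs E v. gen (Edge e) * gen (Ghost e)) \<in> lpa_relations E"

text \<open>
  The ideal of the free algebra generated by the relations. Closure under scalars is not
  automatic here, because the free algebra has no local units.
\<close>

inductive_set relation_ideal :: "('v, 'e) pre_digraph \<Rightarrow> ('v, 'e, 'k::field) free_alg set"
  for E :: "('v, 'e) pre_digraph" where
  rel: "x \<in> lpa_relations E \<Longrightarrow> x \<in> relation_ideal E"
| zero: "0 \<in> relation_ideal E"
| add: "\<lbrakk>x \<in> relation_ideal E; y \<in> relation_ideal E\<rbrakk> \<Longrightarrow> x + y \<in> relation_ideal E"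
| scale: "x \<in> relation_ideal E \<Longrightarrow> scale c x \<in> relation_ideal E"
| left: "\<lbrakk>a \<in> carrier (free_algebra E); x \<in> relation_ideal E\<rbrakk> \<Longrightarrow> a * x \<in> relation_ideal E"
| right: "\<lbrakk>x \<in> relation_ideal E; a \<in> carrier (free_algebra E)\<rbrakk> \<Longrightarrow> x * a \<in> relation_ideal E"

text \<open>
  The quotient algebra. The operations are those of \<^const>\<open>FactRing\<close>, extended by scalar
  multiplication; again \<open>one\<close> carries no meaning.
\<close>

definition leavitt_path_algebra ::
  "('v, 'e) pre_digraph \<Rightarrow> ('k::field, ('v, 'e, 'k) lpa_elem) module" where
  "leavitt_path_algebra E =
    \<lparr> carrier = a_rcosets\<^bsub>free_algebra E\<^esub> (relation_ideal E),
      mult = rcoset_mult (free_algebra E) (relation_ideal E),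
      one = undefined,
      zero = relation_ideal E,
      add = set_add (free_algebra E),
      smult = (\<lambda>c A. \<Union>a\<in>A. relation_ideal E +>\<^bsub>free_algebra E\<^esub> (c \<odot>\<^bsub>free_algebra E\<^esub> a)) \<rparr>"

section \<open>Ideals of rings without identity\<close>

text \<open>
  The locale \<^locale>\<open>ideal\<close> and the prime ideals of the library presuppose a ring with identity
  (and, for primes, commutativity), hence the following variants. The product of ideals is the
  library's \<^const>\<open>ideal_prod\<close>, which needs no such assumption.
\<close>

definition two_sided_ideal :: "'a set \<Rightarrow> ('a, 'm) ring_scheme \<Rightarrow> bool" where
  "two_sided_ideal I R \<longleftrightarrow> additive_subgroup I R \<and>
    (\<forall>a \<in> I. \<forall>x \<in> carrier R. x \<otimes>\<^bsub>R\<^esub> a \<in> I \<and> a \<otimes>\<^bsub>R\<^esub> x \<in> I)"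

definition prime_ideal :: "'a set \<Rightarrow> ('a, 'm) ring_scheme \<Rightarrow> bool" where
  "prime_ideal P R \<longleftrightarrow> two_sided_ideal P R \<and> P \<noteq> carrier R \<and>
    (\<forall>I J. two_sided_ideal I R \<longrightarrow> two_sided_ideal J R \<longrightarrow>
      ideal_prod R I J \<subseteq> P \<longrightarrow> I \<subseteq> P \<or> J \<subseteq> P)"

text \<open>Only positive powers and products of nonempty lists are used; the remaining values are conventions.\<close>

fun ideal_power :: "('a, 'm) ring_scheme \<Rightarrow> 'a set \<Rightarrow> nat \<Rightarrow> 'a set" where
  "ideal_power R I 0 = carrier R"
| "ideal_power R I (Suc 0) = I"
| "ideal_power R I (Suc (Suc n)) = ideal_prod R (ideal_power R I (Suc n)) I"

fun ideal_list_prod :: "('a, 'm) ring_scheme \<Rightarrow> 'a set list \<Rightarrow> 'a set" where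
  "ideal_list_prod R [] = carrier R"
| "ideal_list_prod R [I] = I"
| "ideal_list_prod R (I # J # Is) = ideal_prod R I (ideal_list_prod R (J # Is))"

end

theory Submission
  imports Defs
    "HOL-Computational_Algebra.Polynomial"
    "HOL-Library.Set_Algebras"
    "HOL-Library.Sublist"
    "Graph_Theory.Arc_Walk"
begin

text \<open>
  Call ideals \<open>A\<close>, \<open>B\<close> separated if \<open>AB = BA\<close> and some ideal \<open>N\<close> with local units satisfies
  \<open>A \<inter> B \<subseteq> N \<subseteq> A + B\<close>. Then \<open>A \<inter> B = N(A \<inter> B) \<subseteq> AB + BA = AB\<close>, and separation is inherited by
  products because \<open>(A + B)(A + C) \<subseteq> A + BC\<close>. Hence it suffices to separate any two distinct primes.

  Let \<open>T\<close> be the set of idempotents \<open>v - (ee\<^sup>* + \<dots> + ff\<^sup>*)\<close> with \<open>e, \<dots>, f\<close> distinct edges leaving \<open>v\<close>.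
  Ideals generated by subsets of \<open>T\<close> have local units, since the idempotents \<open>\<alpha>t\<alpha>\<^sup>*\<close> commute. If a
  prime \<open>P\<close> is not generated by \<open>P \<inter> T\<close>, a shortest combination \<open>k\<^sub>0v + k\<^sub>1c\<^sub>1 + \<dots> \<in> P\<close> of closed paths
  with \<open>v \<notin> P\<close> exhibits a vertex \<open>v\<close> on a cycle that has no exit modulo \<open>G = (P \<inter> T)\<close>. Then
  \<open>P \<subseteq> (v) + G\<close>, the vertex \<open>v\<close> lies in \<open>(t)\<close> for every \<open>t \<in> T - P\<close>, the corner \<open>vLv\<close> is commutative
  modulo \<open>G\<close>, and its image modulo \<open>P\<close> is a field, so that \<open>v \<in> J + P\<close> for every ideal \<open>J\<close> not
  contained in \<open>P\<close>. For distinct primes \<open>P\<close>, \<open>Q\<close> these facts leave four cases: one of them is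
  generated by idempotents; one is contained in \<open>(T \<inter> Q)\<close> or \<open>(T \<inter> P)\<close>; \<open>N = (T \<inter> P) + (T \<inter> Q)\<close>
  contains both; or \<open>P \<inter> T = Q \<inter> T\<close> and \<open>N = (v) + G = P + Q\<close>.
\<close>

section \<open>Ideals of rings without identity\<close>

text \<open>The ideals generated by subsets of \<open>T\<close> are the graded ones; local units
  make them easy, since N X = N \<inter> X. The obstacle is a prime that is not graded: it need not
  have local units, and its powers can strictly decrease. Modulo its graded part G it lies in the
  ideal of a vertex v on a cycle c, and the corner at v is commutative and spanned by the powers of
  c and of its inverse; P cuts out a nonzero prime there, and nonzero primes of K[x] are maximal. If
  one prime lies in the graded part of another, their sum is the larger prime, which may lack local
  units. Hence separation asks for an intermediate N instead of local units in A + B. The cycle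
  comes from conjugation: for a path t, multiplying a combination of closed paths p by the ghost of
  t on the left and by t on the right keeps only the p with p t = t r, and replaces p by r. The
  trivial path always survives, with its coefficient. So a combination with the fewest terms loses
  none of them, and every t ending outside P must run along d d d ... for each nontrivial closed
  path d in it.\<close>

inductive_set iprod :: "'a::ring set \<Rightarrow> 'a set \<Rightarrow> 'a set" (infixl "\<bullet>" 70)
  for I J where
  prod: "\<lbrakk>i \<in> I; j \<in> J\<rbrakk> \<Longrightarrow> i * j \<in> I \<bullet> J"
| add: "\<lbrakk>x \<in> I \<bullet> J; y \<in> I \<bullet> J\<rbrakk> \<Longrightarrow> x + y \<in> I \<bullet> J"

fun ipower :: "'a::ring set \<Rightarrow> nat \<Rightarrow> 'a set" where
  "ipower I 0 = UNIV"
| "ipower I (Suc 0) = I"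
| "ipower I (Suc (Suc n)) = ipower I (Suc n) \<bullet> I"

fun iprod_list :: "'a::ring set list \<Rightarrow> 'a set" where
  "iprod_list [] = UNIV"
| "iprod_list [I] = I"
| "iprod_list (I # J # Is) = I \<bullet> iprod_list (J # Is)"

lemma iprod_leastI:
  assumes "\<And>i j. i \<in> I \<Longrightarrow> j \<in> J \<Longrightarrow> i * j \<in> K"
    and "\<And>x y. x \<in> K \<Longrightarrow> y \<in> K \<Longrightarrow> x + y \<in> K"
  shows "I \<bullet> J \<subseteq> K"
proof
  fix x assume "x \<in> I \<bullet> J" then show "x \<in> K" by induct (use assms in auto)
qed

lemma iprod_mono: "I \<subseteq> I' \<Longrightarrow> J \<subseteq> J' \<Longrightarrow> I \<bullet> J \<subseteq> I' \<bullet> J'"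
  by (rule iprod_leastI) (auto intro: iprod.intros)

text \<open>The algebra is a subset of a ring type, so that sums and products are those of the type
  class and its simplification rules apply. The ambient type may have a unit outside
  \<open>L\<close>, which later makes empty products of edges meaningful.\<close>

locale nonunital_subring =
  fixes L :: "'a::ring set"
  assumes zero_L: "0 \<in> L"
    and add_L: "\<lbrakk>x \<in> L; y \<in> L\<rbrakk> \<Longrightarrow> x + y \<in> L"
    and uminus_L: "x \<in> L \<Longrightarrow> - x \<in> L"
    and mult_L: "\<lbrakk>x \<in> L; y \<in> L\<rbrakk> \<Longrightarrow> x * y \<in> L"
begin

definition idl :: "'a set \<Rightarrow> bool" where
  "idl I \<longleftrightarrow> I \<subseteq> L \<and> 0 \<in> I \<and> (\<forall>x\<in>I. \<forall>y\<in>I. x + y \<in> I) \<and> (\<forall>x\<in>I. - x \<in> I) \<and>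
    (\<forall>a\<in>L. \<forall>x\<in>I. a * x \<in> I \<and> x * a \<in> I)"

lemma idlI:
  assumes "I \<subseteq> L" "0 \<in> I" "\<And>x y. \<lbrakk>x \<in> I; y \<in> I\<rbrakk> \<Longrightarrow> x + y \<in> I" "\<And>x. x \<in> I \<Longrightarrow> - x \<in> I"
    "\<And>a x. \<lbrakk>a \<in> L; x \<in> I\<rbrakk> \<Longrightarrow> a * x \<in> I" "\<And>a x. \<lbrakk>a \<in> L; x \<in> I\<rbrakk> \<Longrightarrow> x * a \<in> I"
  shows "idl I"
  using assms by (simp add: idl_def)

lemma idl_L: "idl I \<Longrightarrow> x \<in> I \<Longrightarrow> x \<in> L"
  and idl_zero: "idl I \<Longrightarrow> 0 \<in> I"
  and idl_add: "\<lbrakk>idl I; x \<in> I; y \<in> I\<rbrakk> \<Longrightarrow> x + y \<in> I"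
  and idl_uminus: "\<lbrakk>idl I; x \<in> I\<rbrakk> \<Longrightarrow> - x \<in> I"
  and idl_left: "\<lbrakk>idl I; a \<in> L; x \<in> I\<rbrakk> \<Longrightarrow> a * x \<in> I"
  and idl_right: "\<lbrakk>idl I; a \<in> L; x \<in> I\<rbrakk> \<Longrightarrow> x * a \<in> I"
  unfolding idl_def by blast+

lemma idl_diff: "\<lbrakk>idl I; x \<in> I; y \<in> I\<rbrakk> \<Longrightarrow> x - y \<in> I"
  using idl_add[of I x "- y"] idl_uminus[of I y] by simp

lemma diff_L: "\<lbrakk>x \<in> L; y \<in> L\<rbrakk> \<Longrightarrow> x - y \<in> L"
  using add_L[of x "- y"] uminus_L[of y] by simp

lemma sum_L: "(\<And>i. i \<in> A \<Longrightarrow> f i \<in> L) \<Longrightarrow> sum f A \<in> L"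
  by (induct A rule: infinite_finite_induct) (auto intro: zero_L add_L)

lemma idl_sum: "idl I \<Longrightarrow> (\<And>i. i \<in> A \<Longrightarrow> f i \<in> I) \<Longrightarrow> sum f A \<in> I"
  by (induct A rule: infinite_finite_induct) (auto intro: idl_zero idl_add)

lemma idl_whole: "idl L"
  by (rule idlI) (auto intro: zero_L add_L uminus_L mult_L)

text \<open>\<open>iprod\<close> is closed only under products and binary sums. Zero arises as 0
  times 0 and a negative by negating left factors, so for ideals this is the usual set of finite
  sums.\<close>

lemma idl_iprod:
  assumes I: "idl I" and J: "idl J"
  shows "idl (I \<bullet> J)"
proof (rule idlI)
  show "I \<bullet> J \<subseteq> L"
    using assms by (intro iprod_leastI) (auto intro: mult_L add_L idl_L)
  show "0 \<in> I \<bullet> J"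
    using iprod.prod[OF idl_zero[OF I] idl_zero[OF J]] by simp
  show "- x \<in> I \<bullet> J" if "x \<in> I \<bullet> J" for x
    using that
  proof induct
    case (prod i j)
    then show ?case using iprod.prod[of "- i" I j J] idl_uminus[OF I] by simp
  next
    case (add x y)
    then show ?case using iprod.add[of "- x" I J "- y"] by (simp add: add.commute)
  qed
  show "a * x \<in> I \<bullet> J" if "a \<in> L" "x \<in> I \<bullet> J" for a x
    using that(2,1)
    by induct (auto simp: distrib_left mult.assoc[symmetric] intro: iprod.intros idl_left[OF I])
  show "x * a \<in> I \<bullet> J" if "a \<in> L" "x \<in> I \<bullet> J" for a x
    using that(2,1)
    by induct (auto simp: distrib_right mult.assoc intro: iprod.intros idl_right[OF J])
qed (rule iprod.add)

lemma iprod_subset_left: "idl I \<Longrightarrow> idl J \<Longrightarrow> I \<bullet> J \<subseteq> I"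
  by (rule iprod_leastI) (auto intro: idl_right idl_add idl_L)

lemma iprod_subset_right: "idl I \<Longrightarrow> idl J \<Longrightarrow> I \<bullet> J \<subseteq> J"
  by (rule iprod_leastI) (auto intro: idl_left idl_add idl_L)

lemma iprod_assoc: "(I \<bullet> J) \<bullet> K = I \<bullet> (J \<bullet> K)"
proof
  have "x * k \<in> I \<bullet> (J \<bullet> K)" if "x \<in> I \<bullet> J" "k \<in> K" for x k
    using that by induct (auto simp: distrib_right mult.assoc intro: iprod.intros)
  then show "(I \<bullet> J) \<bullet> K \<subseteq> I \<bullet> (J \<bullet> K)" by (intro iprod_leastI iprod.add)
  have "i * x \<in> (I \<bullet> J) \<bullet> K" if "x \<in> J \<bullet> K" "i \<in> I" for x i
    using that by induct (auto simp: distrib_left mult.assoc[symmetric] intro: iprod.intros)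
  then show "I \<bullet> (J \<bullet> K) \<subseteq> (I \<bullet> J) \<bullet> K" by (intro iprod_leastI iprod.add)
qed

lemma idl_plus:
  assumes "idl I" "idl J"
  shows "idl (I + J)"
proof (rule idlI)
  show "I + J \<subseteq> L" using assms by (auto elim!: set_plus_elim intro: add_L idl_L)
  show "0 \<in> I + J" using set_plus_intro[OF idl_zero[OF assms(1)] idl_zero[OF assms(2)]] by simp
  show "x + y \<in> I + J" if xy: "x \<in> I + J" "y \<in> I + J" for x y
  proof -
    obtain a b c d where "a \<in> I" "b \<in> J" "c \<in> I" "d \<in> J" "x = a + b" "y = c + d"
      using xy by (auto elim!: set_plus_elim)
    moreover from this have "x + y = (a + c) + (b + d)" by (simp add: algebra_simps)
    ultimately show ?thesis using assms by (metis set_plus_intro idl_add)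
  qed
  show "- x \<in> I + J" if "x \<in> I + J" for x
  proof -
    obtain a b where "a \<in> I" "b \<in> J" "x = a + b" using \<open>x \<in> I + J\<close> by (auto elim!: set_plus_elim)
    moreover from this have "- x = - a + - b" by (simp add: algebra_simps)
    ultimately show ?thesis using assms by (metis set_plus_intro idl_uminus)
  qed
  show "a * x \<in> I + J" if "a \<in> L" "x \<in> I + J" for a x
    using that(2) by (auto elim!: set_plus_elim simp: distrib_left
        intro!: set_plus_intro idl_left[OF assms(1) that(1)] idl_left[OF assms(2) that(1)])
  show "x * a \<in> I + J" if "a \<in> L" "x \<in> I + J" for a x
    using that(2) by (auto elim!: set_plus_elim simp: distrib_right
        intro!: set_plus_intro idl_right[OF assms(1) that(1)] idl_right[OF assms(2) that(1)])
qed

lemma subset_plus_left: "idl J \<Longrightarrow> I \<subseteq> I + J"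
  and subset_plus_right: "idl I \<Longrightarrow> J \<subseteq> I + J"
  using set_plus_intro[of _ I 0 J] set_plus_intro[of 0 I _ J] idl_zero by fastforce+

lemma plus_leastI: "\<lbrakk>idl K; I \<subseteq> K; J \<subseteq> K\<rbrakk> \<Longrightarrow> I + J \<subseteq> K"
  by (auto elim!: set_plus_elim intro: idl_add)

lemma idl_Int: "idl I \<Longrightarrow> idl J \<Longrightarrow> idl (I \<inter> J)"
  by (rule idlI) (auto intro: idl_L idl_zero idl_add idl_uminus idl_left idl_right)

definition prime_idl :: "'a set \<Rightarrow> bool" where
  "prime_idl P \<longleftrightarrow> idl P \<and> P \<noteq> L \<and>
    (\<forall>I J. idl I \<longrightarrow> idl J \<longrightarrow> I \<bullet> J \<subseteq> P \<longrightarrow> I \<subseteq> P \<or> J \<subseteq> P)"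

lemma prime_idl_idl: "prime_idl P \<Longrightarrow> idl P"
  by (simp add: prime_idl_def)

section \<open>Ideals with local units\<close>

definition s_unital :: "'a set \<Rightarrow> bool" where
  "s_unital N \<longleftrightarrow> idl N \<and> (\<forall>x\<in>N. (\<exists>u\<in>N. u * x = x) \<and> (\<exists>u\<in>N. x * u = x))"

lemma s_unital_idl: "s_unital N \<Longrightarrow> idl N"
  by (simp add: s_unital_def)

lemma s_unital_left_unit: "s_unital N \<Longrightarrow> x \<in> N \<Longrightarrow> \<exists>u\<in>N. u * x = x"
  and s_unital_right_unit: "s_unital N \<Longrightarrow> x \<in> N \<Longrightarrow> \<exists>u\<in>N. x * u = x"
  by (auto simp: s_unital_def)

text \<open>A left unit u of x in N writes x as the product u x with u in N; right units serve the
  mirror image below. Taking X = N shows that N is idempotent.\<close>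

lemma s_unital_iprod_left:
  assumes "s_unital N" "idl X"
  shows "N \<bullet> X = N \<inter> X"
proof
  show "N \<bullet> X \<subseteq> N \<inter> X"
    by (intro Int_greatest iprod_subset_left iprod_subset_right s_unital_idl assms)
  show "N \<inter> X \<subseteq> N \<bullet> X"
  proof
    fix x assume "x \<in> N \<inter> X"
    with assms(1) obtain u where "u \<in> N" "u * x = x" by (auto dest: s_unital_left_unit)
    with \<open>x \<in> N \<inter> X\<close> show "x \<in> N \<bullet> X" using iprod.prod[of u N x X] by simp
  qed
qed

lemma s_unital_iprod_right:
  assumes "s_unital N" "idl X"
  shows "X \<bullet> N = N \<inter> X"
proof
  show "X \<bullet> N \<subseteq> N \<inter> X"
    by (intro Int_greatest iprod_subset_left iprod_subset_right s_unital_idl assms)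
  show "N \<inter> X \<subseteq> X \<bullet> N"
  proof
    fix x assume "x \<in> N \<inter> X"
    with assms(1) obtain u where "u \<in> N" "x * u = x" by (auto dest: s_unital_right_unit)
    with \<open>x \<in> N \<inter> X\<close> show "x \<in> X \<bullet> N" using iprod.prod[of x X u N] by simp
  qed
qed

text \<open>If u in M and v in N fix x on the same side, then u v fixes x on that side and lies in
  both ideals.\<close>

lemma s_unital_Int:
  assumes M: "s_unital M" and N: "s_unital N"
  shows "s_unital (M \<inter> N)"
proof -
  have "\<exists>u\<in>M \<inter> N. u * x = x" "\<exists>u\<in>M \<inter> N. x * u = x" if x: "x \<in> M \<inter> N" for x
  proof -
    obtain u v where "u \<in> M" "v \<in> N" "u * x = x" "v * x = x"
      using x s_unital_left_unit[OF M] s_unital_left_unit[OF N] by blast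
    then have "u * v \<in> M \<inter> N" "u * v * x = x"
      using M N by (auto simp: mult.assoc dest!: s_unital_idl intro: idl_left idl_right idl_L)
    then show "\<exists>u\<in>M \<inter> N. u * x = x" by blast
    obtain u v where "u \<in> M" "v \<in> N" "x * u = x" "x * v = x"
      using x s_unital_right_unit[OF M] s_unital_right_unit[OF N] by blast
    then have "u * v \<in> M \<inter> N" "x * (u * v) = x"
      using M N by (auto simp: mult.assoc[symmetric] dest!: s_unital_idl intro: idl_left idl_right idl_L)
    then show "\<exists>u\<in>M \<inter> N. x * u = x" by blast
  qed
  then show ?thesis using M N by (simp add: s_unital_def idl_Int)
qed

text \<open>Local units enter as N = N N; after that (X + Z)(Y + Z) is expanded, and every term
  outside X Y falls into Z.\<close>

lemma s_unital_plus_iprod: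
  assumes N: "s_unital N" and "idl X" "idl Y" "idl Z" "N \<subseteq> X + Z" "N \<subseteq> Y + Z"
  shows "N \<subseteq> X \<bullet> Y + Z"
proof -
  have idl: "idl (X \<bullet> Y + Z)" using assms by (simp add: idl_plus idl_iprod)
  have "N = N \<bullet> N" using s_unital_iprod_left[OF N s_unital_idl[OF N]] by simp
  also have "\<dots> \<subseteq> (X + Z) \<bullet> (Y + Z)" using assms by (intro iprod_mono)
  also have "\<dots> \<subseteq> X \<bullet> Y + Z"
  proof (rule iprod_leastI)
    fix i j assume "i \<in> X + Z" "j \<in> Y + Z"
    then obtain x z y z' where *: "x \<in> X" "z \<in> Z" "y \<in> Y" "z' \<in> Z" "i = x + z" "j = y + z'"
      by (auto elim!: set_plus_elim)
    then have "i * j = x * y + (x * z' + z * j)" by (simp add: algebra_simps)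
    moreover have "j \<in> L" using idl_L[OF idl_plus[OF \<open>idl Y\<close> \<open>idl Z\<close>] \<open>j \<in> Y + Z\<close>] .
    moreover have "x * z' + z * j \<in> Z"
      using * \<open>j \<in> L\<close> \<open>idl X\<close> \<open>idl Z\<close> by (meson idl_add idl_left idl_right idl_L)
    ultimately show "i * j \<in> X \<bullet> Y + Z"
      using * by (auto intro!: set_plus_intro iprod.prod)
  qed (use idl in \<open>rule idl_add\<close>)
  finally show ?thesis .
qed

text \<open>The join u + d - u d of two commuting idempotents is a unit for both. Adding one d at a
  time gives a unit for a finite commuting set.\<close>

lemma commuting_idempotents_unit:
  assumes I: "idl I" and "finite D" "D \<subseteq> I"
    and idem: "\<And>d. d \<in> D \<Longrightarrow> d * d = d"
    and comm: "\<And>d d'. d \<in> D \<Longrightarrow> d' \<in> D \<Longrightarrow> d * d' = d' * d"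
  obtains u where "u \<in> I" "\<And>d. d \<in> D \<Longrightarrow> u * d = d" "\<And>d. d \<in> D \<Longrightarrow> d * u = d"
proof -
  \<comment> \<open>The last conjunct carries the induction: u commutes with whatever commutes with
    all of D, in particular with the next idempotent.\<close>
  have "\<exists>u\<in>I. (\<forall>d\<in>D. u * d = d \<and> d * u = d) \<and> (\<forall>z. (\<forall>d\<in>D. z * d = d * z) \<longrightarrow> z * u = u * z)"
    using assms(2-)
  proof (induct D rule: finite_induct)
    case empty
    then show ?case using idl_zero[OF I] by (intro bexI[of _ 0]) auto
  next
    case (insert d D)
    then obtain u where u: "u \<in> I" "\<And>d'. d' \<in> D \<Longrightarrow> u * d' = d' \<and> d' * u = d'"
      "\<And>z. \<forall>d'\<in>D. z * d' = d' * z \<Longrightarrow> z * u = u * z" by auto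
    let ?u = "u + d - u * d"
    have dd: "d * d = d" and du: "d * u = u * d" and comm: "\<And>d'. d' \<in> D \<Longrightarrow> d' * d = d * d'"
      using insert.prems(2)[of d] insert.prems(3) u(3)[of d] by auto
    have "?u \<in> I"
      using insert.prems(1) u(1) I by (simp add: idl_add idl_diff idl_left idl_L[OF I])
    moreover have "?u * d = d" by (simp add: left_diff_distrib distrib_right mult.assoc dd)
    moreover have "d * (u * d) = u * d" using du dd by (metis mult.assoc)
    then have "d * ?u = d" by (simp add: right_diff_distrib distrib_left du dd)
    moreover have "?u * d' = d' \<and> d' * ?u = d'" if d': "d' \<in> D" for d'
    proof -
      have "u * (d' * d) = d' * d" "d' * (u * d) = d' * d"
        using u(2)[OF d'] by (simp_all add: mult.assoc[symmetric])
      then show ?thesis using u(2)[OF d'] comm[OF d'] by (simp add: algebra_simps)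
    qed
    moreover have "z * ?u = ?u * z" if z: "\<forall>d'\<in>insert d D. z * d' = d' * z" for z
    proof -
      have "z * u = u * z" "z * d = d * z" using z u(3)[of z] by auto
      then have "z * (u * d) = u * d * z" by (simp add: mult.assoc) (metis mult.assoc)
      then show ?thesis using \<open>z * u = u * z\<close> \<open>z * d = d * z\<close> by (simp add: algebra_simps)
    qed
    ultimately show ?case by (intro bexI[of _ ?u]) auto
  qed
  then show ?thesis using that by blast
qed

section \<open>Separated pairs of ideals\<close>

definition separated :: "'a set \<Rightarrow> 'a set \<Rightarrow> bool" where
  "separated A B \<longleftrightarrow> idl A \<and> idl B \<and> A \<bullet> B = B \<bullet> A \<and>
    (\<exists>N. s_unital N \<and> A \<inter> B \<subseteq> N \<and> N \<subseteq> A + B)"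

lemma separated_sym: "separated A B \<Longrightarrow> separated B A"
  unfolding separated_def by (metis Int_commute add.commute)

lemma separated_iprod_eq_Int:
  assumes "separated A B"
  shows "A \<bullet> B = A \<inter> B"
proof
  from assms obtain N where *: "idl A" "idl B" "A \<bullet> B = B \<bullet> A" "s_unital N" "A \<inter> B \<subseteq> N" "N \<subseteq> A + B"
    unfolding separated_def by blast
  then show "A \<bullet> B \<subseteq> A \<inter> B" using iprod_subset_left iprod_subset_right by auto
  show "A \<inter> B \<subseteq> A \<bullet> B"
  proof
    fix x assume x: "x \<in> A \<inter> B"
    with * obtain u where "u \<in> N" "u * x = x" by (meson s_unital_left_unit subsetD)
    with * obtain a b where ab: "a \<in> A" "b \<in> B" "u = a + b" by (blast elim!: set_plus_elim)
    then have "x = a * x + b * x" using \<open>u * x = x\<close> by (simp add: distrib_right)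
    moreover have "a * x \<in> A \<bullet> B" "b * x \<in> A \<bullet> B"
      using ab x * iprod.prod[of b B x A] by (auto intro: iprod.prod)
    ultimately show "x \<in> A \<bullet> B" using iprod.add by metis
  qed
qed

text \<open>The intersection of the two given ideals separates A from B C: since B C lies in B and
  in C, it contains A \<inter> B C; that it lies in A + B C is \<open>s_unital_plus_iprod\<close>
  with Z = A.\<close>

lemma separated_iprod:
  assumes "separated A B" "separated A C"
  shows "separated A (B \<bullet> C)"
proof -
  obtain M where M: "idl A" "idl B" "A \<bullet> B = B \<bullet> A" "s_unital M" "A \<inter> B \<subseteq> M" "M \<subseteq> A + B"
    using assms unfolding separated_def by blast
  obtain N where N: "idl C" "A \<bullet> C = C \<bullet> A" "s_unital N" "A \<inter> C \<subseteq> N" "N \<subseteq> A + C"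
    using assms unfolding separated_def by blast
  have "A \<bullet> (B \<bullet> C) = (B \<bullet> C) \<bullet> A"
    using M(3) N(2) by (metis iprod_assoc)
  moreover have "s_unital (M \<inter> N)" using M N by (simp add: s_unital_Int)
  moreover have "A \<inter> (B \<bullet> C) \<subseteq> M \<inter> N"
    using M N iprod_subset_left[of B C] iprod_subset_right[of B C] by auto
  moreover have "M \<inter> N \<subseteq> A + B \<bullet> C"
    using s_unital_plus_iprod[OF \<open>s_unital (M \<inter> N)\<close> M(2) N(1) M(1)] M(6) N(5)
    by (auto simp: add.commute)
  ultimately show ?thesis
    unfolding separated_def using idl_iprod[OF M(2) N(1)] \<open>idl A\<close> by blast
qed

lemma separated_iprod_list:
  "Bs \<noteq> [] \<Longrightarrow> (\<And>B. B \<in> set Bs \<Longrightarrow> separated A B) \<Longrightarrow> separated A (iprod_list Bs)"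
proof (induct Bs rule: iprod_list.induct)
  case (3 I J Is)
  then have "separated A (iprod_list (J # Is))" by simp
  with 3 show ?case by (simp add: separated_iprod)
qed simp_all

lemma iprod_list_eq_Inter:
  "Bs \<noteq> [] \<Longrightarrow> sorted_wrt separated Bs \<Longrightarrow> iprod_list Bs = \<Inter> (set Bs)"
proof (induct Bs rule: iprod_list.induct)
  case (3 I J Is)
  then have "separated I (iprod_list (J # Is))" by (intro separated_iprod_list) auto
  then have "iprod_list (I # J # Is) = I \<inter> iprod_list (J # Is)"
    by (simp add: separated_iprod_eq_Int)
  also have "iprod_list (J # Is) = \<Inter> (set (J # Is))" using 3 by simp
  finally show ?case by simp
qed simp_all

lemma separated_ipower: "separated A B \<Longrightarrow> 0 < r \<Longrightarrow> separated A (ipower B r)"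
proof (induct B r rule: ipower.induct)
  case (3 I n)
  then have "separated A (ipower I (Suc n))" by simp
  with 3 show ?case by (simp add: separated_iprod)
qed simp_all

lemma separated_powers:
  assumes "separated A B" "0 < r" "0 < s"
  shows "separated (ipower A r) (ipower B s)"
  by (intro separated_ipower[OF separated_sym[OF separated_ipower[OF separated_sym]]] assms)

end

section \<open>Leavitt families in a ring\<close>

lemma (in wf_digraph) awalk_unique_end: "awalk u p v \<Longrightarrow> awalk u p w \<Longrightarrow> v = w"
  by (metis awalkE awlast_if_cas)

lemma (in wf_digraph) awalk_appendE:
  assumes "awalk u (p @ q) w"
  obtains v where "awalk u p v" "awalk v q w"
  using assms by (auto simp: awalk_append_iff)

lemma (in wf_digraph) awalk_unique_start: "awalk u p v \<Longrightarrow> awalk u' p v' \<Longrightarrow> p \<noteq> [] \<Longrightarrow> u = u'"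
  by (cases p) (auto simp: awalk_Cons_iff)

text \<open>Scalars act as multiplication by central elements \<open>sc c\<close> of an ambient
  unital ring, so that scalar laws become ring arithmetic. The algebra itself is the span
  \<open>L\<close> of monomials defined below.\<close>

locale leavitt_family = wf_digraph E
  for E :: "('v, 'e) pre_digraph" +
  fixes sc :: "'k::field \<Rightarrow> 'a::ring_1"
    and V :: "'v \<Rightarrow> 'a"
    and Ed Gh :: "'e \<Rightarrow> 'a"
  assumes sc_add: "sc (c + d) = sc c + sc d"
    and sc_mult: "sc (c * d) = sc c * sc d"
    and sc_one: "sc 1 = 1"
    and sc_central: "x * sc c = sc c * x"
    and V_mult: "\<lbrakk>v \<in> verts E; w \<in> verts E\<rbrakk> \<Longrightarrow> V v * V w = (if v = w then V v else 0)"
    and V_Ed: "e \<in> arcs E \<Longrightarrow> V (tail E e) * Ed e = Ed e"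
    and Ed_V: "e \<in> arcs E \<Longrightarrow> Ed e * V (head E e) = Ed e"
    and V_Gh: "e \<in> arcs E \<Longrightarrow> V (head E e) * Gh e = Gh e"
    and Gh_V: "e \<in> arcs E \<Longrightarrow> Gh e * V (tail E e) = Gh e"
    and Gh_Ed: "\<lbrakk>e \<in> arcs E; f \<in> arcs E\<rbrakk> \<Longrightarrow> Gh e * Ed f = (if e = f then V (head E e) else 0)"
begin

lemma sc_zero: "sc 0 = 0"
  using sc_add[of 0 0] by simp

lemma sc_uminus: "sc (- c) = - sc c"
  using sc_add[of c "- c"] by (simp add: sc_zero add_eq_0_iff)

lemma sc_left_commute: "x * (sc c * y) = sc c * (x * y)"
  by (metis mult.assoc sc_central)

section \<open>Linear spans over the field\<close>

inductive_set span :: "'a set \<Rightarrow> 'a set" for S where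
  span_zero: "0 \<in> span S"
| span_step: "\<lbrakk>s \<in> S; x \<in> span S\<rbrakk> \<Longrightarrow> sc c * s + x \<in> span S"

lemma span_base: "s \<in> S \<Longrightarrow> s \<in> span S"
  using span_step[of s S 0 1] by (simp add: span_zero sc_one)

lemma span_add: "x \<in> span S \<Longrightarrow> y \<in> span S \<Longrightarrow> x + y \<in> span S"
  by (induct rule: span.induct) (auto simp: add.assoc intro: span_step)

lemma span_scale: "x \<in> span S \<Longrightarrow> sc c * x \<in> span S"
proof (induct rule: span.induct)
  case (span_step s x d)
  then show ?case using span.span_step[of s S "sc c * x" "c * d"]
    by (simp add: distrib_left sc_mult mult.assoc)
qed (simp add: span_zero)

lemma span_uminus: "x \<in> span S \<Longrightarrow> - x \<in> span S"
  using span_scale[of x S "- 1"] by (simp add: sc_uminus sc_one)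

lemma span_mult_left:
  assumes "x \<in> span S" "\<And>s. s \<in> S \<Longrightarrow> a * s \<in> span S'"
  shows "a * x \<in> span S'"
  using assms(1)
  by induct (auto simp: distrib_left sc_left_commute intro: span_zero span_add span_scale assms(2))

lemma span_mult_right:
  assumes "x \<in> span S" "\<And>s. s \<in> S \<Longrightarrow> s * a \<in> span S'"
  shows "x * a \<in> span S'"
  using assms(1)
  by induct (auto simp: distrib_right mult.assoc intro: span_zero span_add span_scale assms(2))

lemma span_leastI:
  assumes "S \<subseteq> span S'" shows "span S \<subseteq> span S'"
proof
  fix x assume "x \<in> span S" then show "x \<in> span S'"
    by induct (use assms in \<open>auto intro: span_zero span_add span_scale\<close>)
qed

text \<open>A path is its list of edges, and the empty list is a walk at every vertex. So
  \<open>pe []\<close> is the ambient 1, and a path becomes an element of the algebra by attaching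
  its end vertex, as in \<open>pe p * V w\<close>.\<close>

definition pe :: "'e list \<Rightarrow> 'a" where
  "pe p = prod_list (map Ed p)"

definition ge :: "'e list \<Rightarrow> 'a" where
  "ge p = prod_list (map Gh (rev p))"

lemma pe_simps [simp]: "pe [] = 1" "pe (e # p) = Ed e * pe p" "pe (p @ q) = pe p * pe q"
  by (simp_all add: pe_def)

lemma ge_simps [simp]: "ge [] = 1" "ge (e # p) = ge p * Gh e" "ge (p @ q) = ge q * ge p"
  by (simp_all add: ge_def)

lemma V_pe: "awalk u p w \<Longrightarrow> V u * pe p = pe p * V w"
proof (induct p arbitrary: u)
  case (Cons e p)
  then have "V (head E e) * pe p = pe p * V w" by (simp add: awalk_Cons_iff)
  moreover have "V u * Ed e = Ed e" "Ed e * V (head E e) = Ed e"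
    using Cons.prems by (auto simp: awalk_Cons_iff V_Ed Ed_V)
  ultimately show ?case by (metis mult.assoc pe_simps(2))
qed (simp add: awalk_Nil_iff)

lemma ge_V: "awalk u p w \<Longrightarrow> ge p * V u = V w * ge p"
proof (induct p arbitrary: u)
  case (Cons e p)
  then have "ge p * V (head E e) = V w * ge p" by (simp add: awalk_Cons_iff)
  moreover have "Gh e * V u = Gh e" "V (head E e) * Gh e = Gh e"
    using Cons.prems by (auto simp: awalk_Cons_iff Gh_V V_Gh)
  ultimately show ?case by (metis mult.assoc ge_simps(2))
qed (simp add: awalk_Nil_iff)

lemma V_V: "v \<in> verts E \<Longrightarrow> V v * V v = V v"
  by (simp add: V_mult)

lemma V_pe_V: "awalk u p w \<Longrightarrow> V u * (pe p * V w) = pe p * V w"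
  by (metis V_pe V_V awalk_last_in_verts mult.assoc)

lemma V_ge_V: "awalk u p w \<Longrightarrow> V w * ge p * V u = V w * ge p"
  by (metis ge_V V_V awalk_last_in_verts mult.assoc)

lemma pe_V_nonempty: "awalk u p w \<Longrightarrow> p \<noteq> [] \<Longrightarrow> V u * pe p = pe p" "awalk u p w \<Longrightarrow> p \<noteq> [] \<Longrightarrow> pe p * V w = pe p"
proof -
  assume *: "awalk u p w" "p \<noteq> []"
  then obtain e q where "p = e # q" "e \<in> arcs E" "u = tail E e" by (cases p) (auto simp: awalk_Cons_iff)
  then show "V u * pe p = pe p" using V_Ed[of e] by (simp add: mult.assoc[symmetric])
  then show "pe p * V w = pe p" using V_pe[OF *(1)] by simp
qed

lemma ge_pe: "awalk u p w \<Longrightarrow> ge p * pe p * V w = V w"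
proof (induct p arbitrary: u)
  case (Cons e p)
  then have *: "awalk (head E e) p w" "e \<in> arcs E" by (auto simp: awalk_Cons_iff)
  have "ge (e # p) * pe (e # p) * V w = ge p * (Gh e * Ed e) * pe p * V w" by (simp add: mult.assoc)
  also have "\<dots> = ge p * (V (head E e) * (pe p * V w))" using * by (simp add: Gh_Ed mult.assoc)
  also have "\<dots> = ge p * pe p * V w" using V_pe_V[OF *(1)] by (simp add: mult.assoc)
  finally show ?case using Cons * by simp
qed (simp add: awalk_Nil_iff)

lemma ge_pe_append:
  assumes "awalk u p w" "awalk w q x"
  shows "ge p * pe (p @ q) * V x = pe q * V x"
proof -
  have "ge p * pe (p @ q) * V x = ge p * pe p * (V w * (pe q * V x))"
    using V_pe_V[OF assms(2)] by (simp add: mult.assoc)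
  also have "\<dots> = (ge p * pe p * V w) * (pe q * V x)" by (simp add: mult.assoc)
  also have "\<dots> = pe q * V x" using ge_pe[OF assms(1)] V_pe_V[OF assms(2)] by simp
  finally show ?thesis .
qed

lemma ge_append_pe: "awalk u p w \<Longrightarrow> awalk w q x \<Longrightarrow> V x * ge (p @ q) * pe p = V x * ge q"
proof -
  assume *: "awalk u p w" "awalk w q x"
  have "V x * ge (p @ q) * pe p = (V x * ge q) * (ge p * pe p)" by (simp add: mult.assoc)
  also have "V x * ge q = V x * ge q * V w" using V_ge_V[OF *(2)] by simp
  also have "V x * ge q * V w * (ge p * pe p) = V x * ge q * (V w * ge p * pe p)" by (simp add: mult.assoc)
  also have "V w * ge p * pe p = ge p * pe p * V w"
    using ge_V[OF *(1)] V_pe[OF *(1)] by (metis mult.assoc)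
  also have "\<dots> = V w" using ge_pe[OF *(1)] .
  finally show ?thesis using V_ge_V[OF *(2)] by simp
qed

text \<open>At the first edge where the paths part, \<open>Gh e * Ed f\<close> is 0; such an edge
  exists because neither path is a prefix of the other.\<close>

lemma ge_pe_parallel:
  "\<not> prefix p q \<Longrightarrow> \<not> prefix q p \<Longrightarrow> awalk u p w \<Longrightarrow> awalk u' q x \<Longrightarrow> ge p * pe q = 0"
proof (induct p arbitrary: q u u')
  case (Cons e p)
  then obtain f r where q: "q = f # r" by (cases q) auto
  show ?case
  proof (cases "e = f")
    case True
    with Cons.prems q have *: "\<not> prefix p r" "\<not> prefix r p" "awalk (head E e) p w" "awalk (head E e) r x" "e \<in> arcs E"
      by (auto simp: awalk_Cons_iff)
    \<comment> \<open>An empty r would be a prefix of p. A nonempty path absorbs the vertex produced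
      by \<open>Gh e * Ed e\<close>.\<close>
    then have "r \<noteq> []" by auto
    have "ge (e # p) * pe q = ge p * (Gh e * Ed e) * pe r" using True q by (simp add: mult.assoc)
    also have "\<dots> = ge p * pe r"
      using * \<open>r \<noteq> []\<close> by (simp add: Gh_Ed mult.assoc pe_V_nonempty)
    finally show ?thesis using Cons.hyps * by simp
  next
    case False
    have "ge (e # p) * pe q = ge p * (Gh e * Ed f) * pe r" using q by (simp add: mult.assoc)
    then show ?thesis using False Cons.prems q by (simp add: awalk_Cons_iff Gh_Ed)
  qed
qed simp

section \<open>The algebra as the span of path monomials\<close>

definition Mon :: "'a set" where
  "Mon = {pe p * V w * ge q | p q w. (\<exists>u. awalk u p w) \<and> (\<exists>u. awalk u q w)}"

definition L :: "'a set" where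
  "L = span Mon"

lemma MonI: "awalk u p w \<Longrightarrow> awalk u' q w \<Longrightarrow> pe p * V w * ge q \<in> Mon"
  unfolding Mon_def by blast

lemma MonE:
  assumes "m \<in> Mon"
  obtains p q u u' w where "awalk u p w" "awalk u' q w" "m = pe p * V w * ge q"
  using assms unfolding Mon_def by blast

lemma V_L: "v \<in> verts E \<Longrightarrow> V v \<in> L"
  using MonI[of v "[]" v v "[]"] by (auto simp: L_def awalk_Nil_iff intro: span_base)

lemma Ed_mult_Mon: assumes "e \<in> arcs E" "m \<in> Mon" shows "Ed e * m \<in> L"
proof -
  obtain p q u u' w where m: "awalk u p w" "awalk u' q w" "m = pe p * V w * ge q"
    using assms by (auto elim: MonE)
  have "Ed e * m = Ed e * V (head E e) * (V u * (pe p * V w)) * ge q"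
    using m V_pe_V[OF m(1)] assms by (simp add: Ed_V mult.assoc)
  also have "\<dots> = Ed e * (V (head E e) * V u) * (pe p * V w) * ge q" by (simp add: mult.assoc)
  finally have *: "Ed e * m = Ed e * (V (head E e) * V u) * (pe p * V w) * ge q" .
  show ?thesis
  proof (cases "head E e = u")
    case True
    then have "Ed e * m = pe (e # p) * V w * ge q"
      using * m assms awalk_hd_in_verts[OF m(1)] by (simp add: V_mult Ed_V[of e] mult.assoc[symmetric])
    moreover have "awalk (tail E e) (e # p) w" using m assms True by (simp add: awalk_Cons_iff)
    ultimately show ?thesis using m MonI unfolding L_def by (metis span_base)
  next
    case False
    then have "Ed e * m = 0" using * m assms awalk_hd_in_verts[OF m(1)] by (simp add: V_mult)
    then show ?thesis by (simp add: L_def span_zero)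
  qed
qed

text \<open>If p is nonempty, the ghost edge either cancels its first edge or kills the monomial. If
  p is empty and the vertices match, the ghost edge is absorbed into the ghost part, which becomes
  that of \<open>q @ [e]\<close>.\<close>

lemma Gh_mult_Mon: assumes "e \<in> arcs E" "m \<in> Mon" shows "Gh e * m \<in> L"
proof -
  obtain p q u u' w where m: "awalk u p w" "awalk u' q w" "m = pe p * V w * ge q"
    using assms by (auto elim: MonE)
  show ?thesis
  proof (cases p)
    case Nil
    have "Gh e * m = Gh e * (V (tail E e) * V w) * ge q"
      using m Nil assms by (simp add: Gh_V mult.assoc[symmetric])
    show ?thesis
    proof (cases "tail E e = w")
      case True
      then have *: "awalk u' (q @ [e]) (head E e)"
        using m(2) assms arc_implies_awalk[of e] by (auto intro: awalk_appendI)
      have "Gh e * m = pe [] * V (head E e) * ge (q @ [e])"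
        using True[symmetric] m Nil assms by (simp add: mult.assoc[symmetric] Gh_V V_Gh)
      then show ?thesis
        using MonI[OF _ *, of "head E e" "[]"] assms unfolding L_def by (metis span_base awalk_Nil_iff head_in_verts)
    next
      case False
      then have "Gh e * m = 0"
        using \<open>Gh e * m = Gh e * (V (tail E e) * V w) * ge q\<close> assms awalk_last_in_verts[OF m(1)]
        by (simp add: V_mult)
      then show ?thesis by (simp add: L_def span_zero)
    qed
  next
    case (Cons f p')
    then have p': "f \<in> arcs E" "awalk (head E f) p' w" using m by (auto simp: awalk_Cons_iff)
    have "Gh e * m = (Gh e * Ed f) * (pe p' * V w * ge q)" using m Cons by (simp add: mult.assoc)
    also have "\<dots> = (if e = f then pe p' * V w * ge q else 0)"
      using V_pe_V[OF p'(2)] assms p' by (simp add: Gh_Ed mult.assoc[symmetric])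
    finally show ?thesis using MonI[OF p'(2) m(2)] by (auto simp: L_def intro: span_base span_zero)
  qed
qed

lemma V_mult_Mon: assumes "v \<in> verts E" "m \<in> Mon" shows "V v * m \<in> L"
proof -
  obtain p q u u' w where m: "awalk u p w" "awalk u' q w" "m = pe p * V w * ge q"
    using assms by (auto elim: MonE)
  have "V v * m = (V v * V u) * (pe p * V w) * ge q"
    using m(3) V_pe_V[OF m(1)] by (simp add: mult.assoc)
  also have "\<dots> = (if v = u then m else 0)"
    using assms awalk_hd_in_verts[OF m(1)] V_pe_V[OF m(1)] m(3) by (simp add: V_mult)
  finally show ?thesis using assms by (auto simp: L_def intro: span_base span_zero)
qed

lemma gen_mult_L:
  assumes "x \<in> L"
  shows "v \<in> verts E \<Longrightarrow> V v * x \<in> L" "e \<in> arcs E \<Longrightarrow> Ed e * x \<in> L" "e \<in> arcs E \<Longrightarrow> Gh e * x \<in> L"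
  using assms span_mult_left[of x Mon _ Mon] V_mult_Mon Ed_mult_Mon Gh_mult_Mon unfolding L_def by blast+

lemma pe_mult_L: "awalk u p w \<Longrightarrow> x \<in> L \<Longrightarrow> pe p * x \<in> L"
  by (induct p arbitrary: u) (auto simp: awalk_Cons_iff mult.assoc intro: gen_mult_L)

lemma ge_mult_L: "awalk u p w \<Longrightarrow> x \<in> L \<Longrightarrow> ge p * x \<in> L"
  by (induct p arbitrary: u x) (auto simp: awalk_Cons_iff mult.assoc intro: gen_mult_L)

text \<open>A monomial is a product of generators, and left multiplication by each generator maps
  the span of \<open>Mon\<close> to itself.\<close>

lemma mult_L: assumes "x \<in> L" "y \<in> L" shows "x * y \<in> L"
  using assms(1) unfolding L_def
proof (rule span_mult_right)
  fix m assume "m \<in> Mon"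
  then obtain p q u u' w where m: "awalk u p w" "awalk u' q w" "m = pe p * V w * ge q"
    by (auto elim: MonE)
  then have "pe p * (V w * (ge q * y)) \<in> L"
    using assms by (metis awalk_last_in_verts ge_mult_L gen_mult_L(1) pe_mult_L)
  then show "m * y \<in> span Mon" using m by (simp add: mult.assoc L_def)
qed

sublocale nonunital_subring L
  by unfold_locales (auto simp: L_def intro: span_zero span_add span_uminus mult_L[unfolded L_def])

lemma sc_L: "x \<in> L \<Longrightarrow> sc c * x \<in> L"
  by (simp add: L_def span_scale)

lemma Ed_L: "e \<in> arcs E \<Longrightarrow> Ed e \<in> L"
  using gen_mult_L(2)[OF V_L[of "head E e"], of e] by (simp add: Ed_V)

lemma Gh_L: "e \<in> arcs E \<Longrightarrow> Gh e \<in> L"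
  using gen_mult_L(3)[OF V_L[of "tail E e"], of e] by (simp add: Gh_V)

lemma pe_L: "awalk u p w \<Longrightarrow> pe p * V w \<in> L"
  by (metis V_L awalk_last_in_verts pe_mult_L)

lemma ge_L: "awalk u p w \<Longrightarrow> V w * ge p \<in> L"
  by (metis V_L awalk_hd_in_verts ge_V ge_mult_L)

lemma Mon_L: "Mon \<subseteq> L"
  by (auto simp: L_def intro: span_base)

section \<open>Finite sums of vertices as local units\<close>

definition vsum :: "'v set \<Rightarrow> 'a" where
  "vsum W = (\<Sum>v\<in>W. V v)"

lemma vsum_mult: "finite W \<Longrightarrow> W \<subseteq> verts E \<Longrightarrow> u \<in> W \<Longrightarrow> vsum W * V u = V u \<and> V u * vsum W = V u"
  unfolding vsum_def sum_distrib_left sum_distrib_right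
  using V_mult by (auto simp: sum.delta' sum.delta subset_iff cong: sum.cong)

lemma vsum_L: "W \<subseteq> verts E \<Longrightarrow> vsum W \<in> L"
  unfolding vsum_def by (auto intro!: sum_L V_L)

text \<open>The unit property is claimed for every larger finite set of vertices, so that the sets
  belonging to two summands can be united in the induction.\<close>

lemma vsum_local_unit:
  assumes "x \<in> L"
  shows "\<exists>W. finite W \<and> W \<subseteq> verts E \<and> (\<forall>W'. finite W' \<and> W \<subseteq> W' \<and> W' \<subseteq> verts E \<longrightarrow> vsum W' * x = x \<and> x * vsum W' = x)"
  using assms unfolding L_def
proof induct
  case span_zero
  then show ?case by (auto intro: exI[of _ "{}"])
next
  case (span_step m x c)
  then obtain p q u u' w where m: "awalk u p w" "awalk u' q w" "m = pe p * V w * ge q" by (auto elim: MonE)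
  obtain W where W: "finite W" "W \<subseteq> verts E"
    "\<And>W'. finite W' \<and> W \<subseteq> W' \<and> W' \<subseteq> verts E \<Longrightarrow> vsum W' * x = x \<and> x * vsum W' = x"
    using span_step by blast
  have 1: "V u * m = m" using m V_pe_V[OF m(1)] by (simp add: mult.assoc[symmetric])
  have 2: "m * V u' = m" using m V_ge_V[OF m(2)] by (simp add: mult.assoc)
  show ?case
  proof (intro exI[of _ "W \<union> {u, u'}"] conjI allI impI)
    fix W' assume W': "finite W' \<and> W \<union> {u, u'} \<subseteq> W' \<and> W' \<subseteq> verts E"
    then have "vsum W' * m = m" "m * vsum W' = m"
      using 1 2 vsum_mult[of W' u] vsum_mult[of W' u'] by (metis insert_subset le_sup_iff mult.assoc)+
    then show "vsum W' * (sc c * m + x) = sc c * m + x" "(sc c * m + x) * vsum W' = sc c * m + x"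
      using W(3)[of W'] W' by (simp_all add: distrib_left distrib_right sc_left_commute mult.assoc)
  qed (use W m in \<open>auto dest: awalk_hd_in_verts\<close>)
qed

lemma local_unit:
  assumes "x \<in> L"
  obtains W where "finite W" "W \<subseteq> verts E" "vsum W * x = x" "x * vsum W = x"
  using vsum_local_unit[OF assms] by blast

text \<open>An ideal is only required to absorb \<open>L\<close>, not scalars. A local unit turns
  scaling by c into multiplication by the element \<open>sc c * vsum W\<close> of
  \<open>L\<close>.\<close>

lemma idl_scale:
  assumes "idl I" "x \<in> I"
  shows "sc c * x \<in> I"
proof -
  obtain W where W: "W \<subseteq> verts E" "vsum W * x = x"
    using local_unit assms idl_L by metis
  then have "(sc c * vsum W) * x \<in> I" using assms by (intro idl_left sc_L vsum_L)
  then show ?thesis using W by (simp add: mult.assoc)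
qed

lemma idl_span: "idl I \<Longrightarrow> S \<subseteq> I \<Longrightarrow> span S \<subseteq> I"
proof
  fix x assume "idl I" "S \<subseteq> I" "x \<in> span S"
  from this(3) show "x \<in> I"
    by induct (use \<open>idl I\<close> \<open>S \<subseteq> I\<close> in \<open>auto intro: idl_zero idl_add idl_scale\<close>)
qed

end

section \<open>Ideals generated by idempotents\<close>

context leavitt_family begin

text \<open>The span of the two-sided products x s y is already the generated ideal: local units
  show that it contains s itself.\<close>

definition gid :: "'a set \<Rightarrow> 'a set" where
  "gid S = span {x * s * y | x s y. x \<in> L \<and> s \<in> S \<and> y \<in> L}"

lemma gid_idl:
  assumes "S \<subseteq> L"
  shows "idl (gid S)"
proof (rule idlI)
  show "gid S \<subseteq> L"
    unfolding gid_def using assms by (intro idl_span idl_whole) (auto intro!: mult_L)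
  show "a * z \<in> gid S" if "a \<in> L" "z \<in> gid S" for a z
    using that(2) unfolding gid_def
  proof (rule span_mult_left)
    fix s assume "s \<in> {x * s * y | x s y. x \<in> L \<and> s \<in> S \<and> y \<in> L}"
    then obtain x s' y where "x \<in> L" "s' \<in> S" "y \<in> L" "s = x * s' * y" by blast
    then have "a * s = (a * x) * s' * y" "a * x \<in> L" using that by (auto simp: mult.assoc mult_L)
    then show "a * s \<in> span {x * s * y | x s y. x \<in> L \<and> s \<in> S \<and> y \<in> L}"
      using \<open>s' \<in> S\<close> \<open>y \<in> L\<close> by (intro span_base) blast
  qed
  show "z * a \<in> gid S" if "a \<in> L" "z \<in> gid S" for a z
    using that(2) unfolding gid_def
  proof (rule span_mult_right)
    fix s assume "s \<in> {x * s * y | x s y. x \<in> L \<and> s \<in> S \<and> y \<in> L}"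
    then obtain x s' y where "x \<in> L" "s' \<in> S" "y \<in> L" "s = x * s' * y" by blast
    then have "s * a = x * s' * (y * a)" "y * a \<in> L" using that by (auto simp: mult.assoc mult_L)
    then show "s * a \<in> span {x * s * y | x s y. x \<in> L \<and> s \<in> S \<and> y \<in> L}"
      using \<open>s' \<in> S\<close> \<open>x \<in> L\<close> by (intro span_base) blast
  qed
qed (auto simp: gid_def intro: span_zero span_add span_uminus)

lemma gid_base: assumes "S \<subseteq> L" "s \<in> S" shows "s \<in> gid S"
proof -
  have "s \<in> L" using assms by blast
  then obtain W where W: "finite W" "W \<subseteq> verts E" "vsum W * s = s" "s * vsum W = s"
    by (rule local_unit)
  then have "vsum W * s * vsum W \<in> {x * s * y | x s y. x \<in> L \<and> s \<in> S \<and> y \<in> L}"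
    using \<open>s \<in> S\<close> vsum_L by blast
  then show ?thesis unfolding gid_def using W span_base by auto
qed

lemma gid_least:
  assumes "idl I" "S \<subseteq> I"
  shows "gid S \<subseteq> I"
proof -
  have "{x * s * y | x s y. x \<in> L \<and> s \<in> S \<and> y \<in> L} \<subseteq> I"
    using assms by (auto intro: idl_left[OF assms(1)] idl_right[OF assms(1)])
  then show ?thesis unfolding gid_def by (rule idl_span[OF assms(1)])
qed

lemma idl_span_mult_right:
  assumes "idl I" "x \<in> span S" "\<And>s. s \<in> S \<Longrightarrow> s * a \<in> I"
  shows "x * a \<in> I"
  using assms(2)
  by induct (use assms in \<open>auto simp: distrib_right mult.assoc intro: idl_zero idl_add idl_scale\<close>)

lemma idl_span_mult_left:
  assumes "idl I" "x \<in> span S" "\<And>s. s \<in> S \<Longrightarrow> a * s \<in> I"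
  shows "a * x \<in> I"
  using assms(2)
  by induct (use assms in \<open>auto simp: distrib_left sc_left_commute intro: idl_zero idl_add idl_scale\<close>)

text \<open>A product of x a y and x' b y' contains the factor a (y x') b with y x' in
  \<open>L\<close>, so the ideals generated by a and by b multiply into P.\<close>

lemma prime_idl_elem:
  assumes P: "prime_idl P" and ab: "a \<in> L" "b \<in> L" and aLb: "\<And>x. x \<in> L \<Longrightarrow> a * x * b \<in> P"
  shows "a \<in> P \<or> b \<in> P"
proof -
  have I: "idl P" using P by (rule prime_idl_idl)
  have "gid {a} \<bullet> gid {b} \<subseteq> P"
  proof (rule iprod_leastI)
    fix i j assume i: "i \<in> gid {a}" and j: "j \<in> gid {b}"
    show "i * j \<in> P"
      using i unfolding gid_def
    proof (rule idl_span_mult_right[OF I])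
      fix s assume "s \<in> {x * s * y | x s y. x \<in> L \<and> s \<in> {a} \<and> y \<in> L}"
      then obtain x y where s: "x \<in> L" "y \<in> L" "s = x * a * y" by blast
      show "s * j \<in> P"
        using j unfolding gid_def
      proof (rule idl_span_mult_left[OF I])
        fix t assume "t \<in> {x * s * y | x s y. x \<in> L \<and> s \<in> {b} \<and> y \<in> L}"
        then obtain x' y' where t: "x' \<in> L" "y' \<in> L" "t = x' * b * y'" by blast
        have "x * (a * (y * x') * b) * y' \<in> P"
          using s t by (intro idl_right[OF I] idl_left[OF I] aLb mult_L)
        then show "s * t \<in> P" using s t by (simp add: mult.assoc)
      qed
    qed
  qed (rule idl_add[OF I])
  then have "gid {a} \<subseteq> P \<or> gid {b} \<subseteq> P"
    using P ab by (auto simp: prime_idl_def gid_idl)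
  then show ?thesis using gid_base[of "{a}" a] gid_base[of "{b}" b] ab by blast
qed

section \<open>The idempotents that generate graded ideals\<close>

definition q :: "'v \<Rightarrow> 'e set \<Rightarrow> 'a" where
  "q w F = V w - (\<Sum>e\<in>F. Ed e * Gh e)"

text \<open>F empty gives the vertices. If w is a breaking vertex of a hereditary set H and F
  consists of the finitely many edges leaving w that do not end in H, then \<open>q w F\<close> is
  the usual generator attached to w. Vertices and such elements generate all graded ideals.\<close>

definition T :: "'a set" where
  "T = {q w F | w F. w \<in> verts E \<and> finite F \<and> F \<subseteq> out_arcs E w}"

lemma q_T: "w \<in> verts E \<Longrightarrow> finite F \<Longrightarrow> F \<subseteq> out_arcs E w \<Longrightarrow> q w F \<in> T"
  unfolding T_def by blast

lemma q_empty [simp]: "q w {} = V w"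
  by (simp add: q_def)

lemma V_T: "w \<in> verts E \<Longrightarrow> V w \<in> T"
  using q_T[of w "{}"] by simp

lemma T_L: "T \<subseteq> L"
  by (auto simp: T_def q_def intro!: diff_L V_L sum_L mult_L Ed_L Gh_L)

context
  fixes w F
  assumes w: "w \<in> verts E" and F: "finite F" "F \<subseteq> out_arcs E w"
begin

lemma Gh_q: assumes "e \<in> arcs E" shows "Gh e * q w F = (if tail E e = w \<and> e \<notin> F then Gh e else 0)"
proof -
  have "Gh e * V w = Gh e * (V (tail E e) * V w)" using assms by (simp add: Gh_V mult.assoc[symmetric])
  also have "\<dots> = (if tail E e = w then Gh e else 0)" using assms w Gh_V[OF assms] by (auto simp: V_mult)
  finally have 1: "Gh e * V w = (if tail E e = w then Gh e else 0)" .
  have "Gh e * (\<Sum>f\<in>F. Ed f * Gh f) = (\<Sum>f\<in>F. if e = f then Gh e else 0)"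
    unfolding sum_distrib_left
  proof (rule sum.cong)
    fix f assume "f \<in> F"
    then have "f \<in> arcs E" using F by auto
    then show "Gh e * (Ed f * Gh f) = (if e = f then Gh e else 0)"
      using assms by (simp add: mult.assoc[symmetric] Gh_Ed V_Gh)
  qed simp
  also have "\<dots> = (if e \<in> F then Gh e else 0)" using F by (simp add: sum.delta')
  finally show ?thesis unfolding q_def right_diff_distrib 1 using F by auto
qed

lemma q_Ed: assumes "e \<in> arcs E" shows "q w F * Ed e = (if tail E e = w \<and> e \<notin> F then Ed e else 0)"
proof -
  have "V w * Ed e = (V w * V (tail E e)) * Ed e" using assms by (simp add: V_Ed mult.assoc)
  also have "\<dots> = (if tail E e = w then Ed e else 0)" using assms w V_Ed[OF assms] by (auto simp: V_mult)
  finally have 1: "V w * Ed e = (if tail E e = w then Ed e else 0)" .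
  have "(\<Sum>f\<in>F. Ed f * Gh f) * Ed e = (\<Sum>f\<in>F. if e = f then Ed e else 0)"
    unfolding sum_distrib_right
  proof (rule sum.cong)
    fix f assume "f \<in> F"
    then have "f \<in> arcs E" using F by auto
    then show "Ed f * Gh f * Ed e = (if e = f then Ed e else 0)"
      using assms by (auto simp add: mult.assoc Gh_Ed Ed_V)
  qed simp
  also have "\<dots> = (if e \<in> F then Ed e else 0)" using F by (simp add: sum.delta')
  finally show ?thesis unfolding q_def left_diff_distrib 1 using F by auto
qed

lemma V_q: "V w * q w F = q w F"
proof -
  have "V w * (Ed f * Gh f) = Ed f * Gh f" if "f \<in> F" for f
  proof -
    have "f \<in> arcs E" "tail E f = w" using that F by auto
    then show ?thesis using V_Ed[of f] by (simp add: mult.assoc[symmetric])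
  qed
  then have "V w * (\<Sum>f\<in>F. Ed f * Gh f) = (\<Sum>f\<in>F. Ed f * Gh f)"
    by (simp add: sum_distrib_left)
  then show ?thesis using w by (simp add: q_def right_diff_distrib V_V)
qed

lemma q_V: "q w F * V w = q w F"
proof -
  have "Ed f * Gh f * V w = Ed f * Gh f" if "f \<in> F" for f
  proof -
    have "f \<in> arcs E" "tail E f = w" using that F by auto
    then show ?thesis using Gh_V[of f] by (simp add: mult.assoc)
  qed
  then have "(\<Sum>f\<in>F. Ed f * Gh f) * V w = (\<Sum>f\<in>F. Ed f * Gh f)"
    by (simp add: sum_distrib_right)
  then show ?thesis using w by (simp add: q_def left_diff_distrib V_V)
qed

lemma V_q_other: "u \<in> verts E \<Longrightarrow> u \<noteq> w \<Longrightarrow> V u * q w F = 0"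
  by (metis V_mult V_q mult.assoc mult_zero_left w)

lemma q_V_other: "u \<in> verts E \<Longrightarrow> u \<noteq> w \<Longrightarrow> q w F * V u = 0"
  by (metis V_mult q_V mult.assoc mult_zero_right w)

lemma q_idem: "q w F * q w F = q w F"
proof -
  have "q w F * (\<Sum>f\<in>F. Ed f * Gh f) = 0"
    unfolding sum_distrib_left using F q_Ed
    by (intro sum.neutral) (auto simp: mult.assoc[symmetric])
  then have "q w F * q w F = q w F * V w" by (simp add: q_def[of w F] right_diff_distrib)
  then show ?thesis using q_V by simp
qed

lemma q_pe: "awalk u p x \<Longrightarrow> p \<noteq> [] \<Longrightarrow> q w F * pe p = (if u = w \<and> hd p \<notin> F then pe p else 0)"
  by (cases p) (auto simp: awalk_Cons_iff mult.assoc[symmetric] q_Ed)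

lemma ge_q: "awalk u p x \<Longrightarrow> p \<noteq> [] \<Longrightarrow> ge p * q w F = (if u = w \<and> hd p \<notin> F then ge p else 0)"
  by (cases p) (auto simp: awalk_Cons_iff mult.assoc Gh_q)

end

section \<open>Range projections of paths\<close>

definition proj :: "'e list \<Rightarrow> 'v \<Rightarrow> 'a" where
  "proj p w = pe p * V w * ge p"

lemma proj_mult_prefix:
  assumes "awalk u p w" "awalk w r x"
  shows "proj p w * proj (p @ r) x = proj (p @ r) x" "proj (p @ r) x * proj p w = proj (p @ r) x"
proof -
  have "proj p w * proj (p @ r) x = pe p * V w * (ge p * pe (p @ r) * V x) * ge (p @ r)"
    by (simp add: proj_def mult.assoc)
  also have "\<dots> = pe p * (V w * (pe r * V x)) * ge (p @ r)"
    unfolding ge_pe_append[OF assms] by (simp add: mult.assoc)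
  also have "\<dots> = proj (p @ r) x" by (simp only: V_pe_V[OF assms(2)]) (simp add: proj_def mult.assoc)
  finally show "proj p w * proj (p @ r) x = proj (p @ r) x" .
  have "proj (p @ r) x * proj p w = pe (p @ r) * (V x * ge (p @ r) * pe p) * V w * ge p"
    by (simp add: proj_def mult.assoc)
  also have "\<dots> = pe (p @ r) * (V x * ge r * V w) * ge p"
    unfolding ge_append_pe[OF assms] by (simp add: mult.assoc)
  also have "\<dots> = proj (p @ r) x" by (simp only: V_ge_V[OF assms(2)]) (simp add: proj_def mult.assoc)
  finally show "proj (p @ r) x * proj p w = proj (p @ r) x" .
qed

lemma proj_V:
  assumes "awalk u p w"
  shows "V u * proj p w = proj p w" "proj p w * V u = proj p w"
  using V_pe_V[OF assms] V_ge_V[OF assms] by (simp_all add: proj_def mult.assoc[symmetric]) (simp add: mult.assoc)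

text \<open>Two paths from the same vertex are either comparable, and then the projection of the
  longer lies under that of the shorter, or they part at some edge, and then the projections are
  orthogonal. They are also orthogonal for different start vertices.\<close>

lemma proj_commute:
  assumes p: "awalk u p w" and r: "awalk u' r x"
  shows "proj p w * proj r x = proj r x * proj p w"
proof (cases "u = u'")
  case False
  then have "V u * V u' = 0" "V u' * V u = 0"
    using V_mult awalk_hd_in_verts[OF p] awalk_hd_in_verts[OF r] by auto
  then show ?thesis using proj_V[OF p] proj_V[OF r] by (metis mult.assoc mult_zero_left mult_zero_right)
next
  case True
  consider s where "r = p @ s" | s where "p = r @ s" | "\<not> prefix p r" "\<not> prefix r p"
    by (auto simp: prefix_def)
  then show ?thesis
  proof cases
    case 1
    then have "awalk w s x" using p r True by (metis awalk_appendE awalk_unique_end)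
    then show ?thesis using proj_mult_prefix[OF p] 1 by simp
  next
    case 2
    then have "awalk x s w" using p r True by (metis awalk_appendE awalk_unique_end)
    then show ?thesis using proj_mult_prefix[OF r] 2 by simp
  next
    case 3
    then have "ge p * pe r = 0" "ge r * pe p = 0" using ge_pe_parallel p r by metis+
    then have "pe p * V w * (ge p * pe r) * V x * ge r = 0" "pe r * V x * (ge r * pe p) * V w * ge p = 0" by simp_all
    then show ?thesis by (simp add: proj_def mult.assoc)
  qed
qed

text \<open>The local units of an ideal generated by elements of \<open>T\<close> are built from
  these. Since \<open>q w F\<close> alone fixes only elements starting at w, it is conjugated by all
  paths ending there.\<close>

definition range_idems :: "'a set \<Rightarrow> 'a set" where
  "range_idems I = {pe p * q w F * ge p | p w F. (\<exists>u. awalk u p w) \<and> finite F \<and> F \<subseteq> out_arcs E w \<and> q w F \<in> I}"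

lemma range_idemsI: "awalk u p w \<Longrightarrow> finite F \<Longrightarrow> F \<subseteq> out_arcs E w \<Longrightarrow> q w F \<in> I \<Longrightarrow> pe p * q w F * ge p \<in> range_idems I"
  unfolding range_idems_def by blast

lemma range_idemsE:
  assumes "d \<in> range_idems I"
  obtains u p w F where "awalk u p w" "finite F" "F \<subseteq> out_arcs E w" "q w F \<in> I" "d = pe p * q w F * ge p" "w \<in> verts E"
  using assms awalk_last_in_verts unfolding range_idems_def by blast

lemma corner_mult:
  assumes p: "awalk u p w" and t: "V w * t = t" and t': "t' * V w = t'"
  shows "a * t' * ge p * (pe p * t * b) = a * t' * t * b"
proof -
  have "a * t' * ge p * (pe p * t * b) = a * t' * ge p * (pe p * (V w * t) * b)" using t by simp
  also have "\<dots> = a * t' * (ge p * pe p * V w) * t * b" by (simp add: mult.assoc)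
  also have "\<dots> = a * t' * t * b" using ge_pe[OF p] t' by (metis mult.assoc)
  finally show ?thesis .
qed

lemma range_idems_idem: "d \<in> range_idems I \<Longrightarrow> d * d = d"
  by (erule range_idemsE) (simp add: corner_mult V_q q_V q_idem mult.assoc[of "pe _" "q _ _" "q _ _"])

lemma range_idems_I: assumes "idl I" "d \<in> range_idems I" shows "d \<in> I"
proof -
  obtain u p w F where d: "awalk u p w" "finite F" "F \<subseteq> out_arcs E w" "q w F \<in> I" "d = pe p * q w F * ge p" "w \<in> verts E"
    using assms(2) by (elim range_idemsE)
  have "(pe p * V w) * q w F * (V w * ge p) \<in> I"
    using d assms(1) by (intro idl_left idl_right pe_L ge_L)
  also have "(pe p * V w) * q w F * (V w * ge p) = pe p * (V w * q w F * V w) * ge p"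
    by (simp add: mult.assoc)
  also have "V w * q w F * V w = q w F" using d by (simp add: V_q q_V)
  finally show ?thesis using d(5) by simp
qed

text \<open>Writing each conjugate as a combination of range projections reduces commutation to
  \<open>proj_commute\<close>.\<close>

lemma range_idems_eq:
  assumes "awalk u p w" "F \<subseteq> out_arcs E w"
  shows "pe p * q w F * ge p = proj p w - (\<Sum>e\<in>F. proj (p @ [e]) (head E e))"
proof -
  have "pe p * (Ed e * Gh e) * ge p = proj (p @ [e]) (head E e)" if "e \<in> F" for e
  proof -
    have "proj (p @ [e]) (head E e) = pe p * (Ed e * V (head E e)) * Gh e * ge p"
      by (simp add: proj_def mult.assoc)
    also have "Ed e * V (head E e) = Ed e" using that assms by (intro Ed_V) auto
    finally show ?thesis by (simp add: mult.assoc)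
  qed
  then have "pe p * (\<Sum>e\<in>F. Ed e * Gh e) * ge p = (\<Sum>e\<in>F. proj (p @ [e]) (head E e))"
    by (simp add: sum_distrib_left sum_distrib_right)
  then show ?thesis by (simp add: q_def right_diff_distrib left_diff_distrib proj_def)
qed

lemma range_idems_commute: assumes "d \<in> range_idems I" "d' \<in> range_idems I" shows "d * d' = d' * d"
proof -
  \<comment> \<open>Used twice: with a range projection as a, it makes every d commute with all
    projections; this is then the hypothesis that allows a to be the other idempotent.\<close>
  have *: "a * d = d * a"
    if d: "d \<in> range_idems I" and a: "\<And>u p w. awalk u p w \<Longrightarrow> a * proj p w = proj p w * a" for a d
  proof -
    obtain u p w F where "awalk u p w" "F \<subseteq> out_arcs E w" "d = pe p * q w F * ge p"
      using d by (elim range_idemsE)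
    then have eq: "d = proj p w - (\<Sum>e\<in>F. proj (p @ [e]) (head E e))"
      by (simp add: range_idems_eq)
    have "a * proj (p @ [e]) (head E e) = proj (p @ [e]) (head E e) * a" if "e \<in> F" for e
    proof -
      have "e \<in> arcs E" "tail E e = w" using that \<open>F \<subseteq> out_arcs E w\<close> by auto
      then have "awalk w [e] (head E e)" using arc_implies_awalk by blast
      then show ?thesis using \<open>awalk u p w\<close> by (intro a awalk_appendI)
    qed
    then show ?thesis
      using a[OF \<open>awalk u p w\<close>]
      by (simp add: eq right_diff_distrib left_diff_distrib sum_distrib_left sum_distrib_right)
  qed
  have "proj p w * d = d * proj p w" if "awalk u p w" for u p w
    by (rule *[OF assms(1)]) (rule proj_commute[OF that])
  then have "d * proj p w = proj p w * d" if "awalk u p w" for u p w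
    using that by metis
  then show ?thesis by (rule *[OF assms(2)])
qed

text \<open>The first edge of p avoids F, so \<open>q w F\<close> fixes p, and the product of the
  ghost of p, \<open>q w F\<close> and p is the vertex x.\<close>

lemma V_range_mem:
  assumes I: "idl I" and t: "q w F \<in> I" "finite F" "F \<subseteq> out_arcs E w" and p: "awalk w p x" "p \<noteq> []" "hd p \<notin> F"
  shows "V x \<in> I"
proof -
  have "(V x * ge p) * q w F * (pe p * V x) \<in> I"
    using I t p by (intro idl_left idl_right ge_L pe_L)
  moreover have "(V x * ge p) * q w F * (pe p * V x) = V x * ge p * (q w F * pe p) * V x" by (simp add: mult.assoc)
  also have "q w F * pe p = pe p" using q_pe[OF _ t(2,3) p(1,2)] p awalk_hd_in_verts[OF p(1)] by simp
  also have "V x * ge p * pe p * V x = V x * (ge p * pe p * V x)" by (simp add: mult.assoc)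
  also have "\<dots> = V x" using ge_pe[OF p(1)] V_V awalk_last_in_verts[OF p(1)] by simp
  finally show ?thesis by simp
qed

text \<open>Let m have path part p, middle vertex x and ghost part r. If r is empty,
  \<open>m * t\<close> is 0 or \<open>pe p * t\<close>, and the conjugate of t by p fixes it. If r
  is nonempty, t either kills its ghost or leaves it unchanged; in the latter case x lies in I by
  \<open>V_range_mem\<close>, and the conjugate of x by p fixes m.\<close>

lemma Mon_mult_T:
  assumes I: "idl I" and m: "m \<in> Mon" and t: "t \<in> T" "t \<in> I"
  shows "m * t = 0 \<or> (\<exists>d\<in>range_idems I. d * (m * t) = m * t)"
proof -
  obtain p r u u' x where m: "awalk u p x" "awalk u' r x" "m = pe p * V x * ge r" using m by (elim MonE)
  obtain w F where t': "t = q w F" "w \<in> verts E" "finite F" "F \<subseteq> out_arcs E w" using t by (auto simp: T_def)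
  have x: "x \<in> verts E" using m awalk_last_in_verts by blast
  show ?thesis
  proof (cases r)
    case Nil
    then have mt: "m * t = pe p * (V x * t)" using m by (simp add: mult.assoc)
    show ?thesis
    proof (cases "x = w")
      case True
      then have "m * t = pe p * t" using mt t' V_q by simp
      moreover have "pe p * t * ge p * (pe p * t * 1) = pe p * t * t * 1"
        using m True t' by (intro corner_mult[OF m(1)]) (auto simp: V_q q_V)
      ultimately have "pe p * t * ge p * (m * t) = m * t" using t' q_idem by (simp add: mult.assoc)
      moreover have "pe p * t * ge p \<in> range_idems I" using range_idemsI m t t' True by metis
      ultimately show ?thesis by blast
    next
      case False
      then show ?thesis using mt t' V_q_other x by simp
    qed
  next
    case (Cons e r')
    have mt: "m * t = pe p * V x * (ge r * t)" using m by (simp add: mult.assoc)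
    show ?thesis
    proof (cases "u' = w \<and> hd r \<notin> F")
      case True
      then have eq: "m * t = m" using mt t' m(3) ge_q[OF t'(2-4) m(2)] Cons by simp
      have "V x \<in> I" using V_range_mem[OF I _ t'(3,4)] t t' m True Cons by blast
      then have "pe p * V x * ge p \<in> range_idems I" using range_idemsI[OF m(1), of "{}"] by simp
      moreover have "pe p * V x * ge p * (pe p * V x * ge r) = pe p * V x * V x * ge r"
        using V_V[OF x] by (intro corner_mult[OF m(1)])
      ultimately show ?thesis using eq m(3) V_V[OF x] by (metis mult.assoc)
    next
      case False
      then have "m * t = 0" using mt t' ge_q[OF t'(2-4) m(2)] Cons by auto
      then show ?thesis ..
    qed
  qed
qed

lemma T_mult_Mon:
  assumes I: "idl I" and m: "m \<in> Mon" and t: "t \<in> T" "t \<in> I"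
  shows "t * m = 0 \<or> (\<exists>d\<in>range_idems I. (t * m) * d = t * m)"
proof -
  obtain p r u u' x where m: "awalk u p x" "awalk u' r x" "m = pe p * V x * ge r" using m by (elim MonE)
  obtain w F where t': "t = q w F" "w \<in> verts E" "finite F" "F \<subseteq> out_arcs E w" using t by (auto simp: T_def)
  have x: "x \<in> verts E" using m awalk_last_in_verts by blast
  show ?thesis
  proof (cases p)
    case Nil
    then have mt: "t * m = t * V x * ge r" using m by (simp add: mult.assoc)
    show ?thesis
    proof (cases "x = w")
      case True
      then have "t * m = t * ge r" using mt t' q_V by simp
      moreover have "1 * t * ge r * (pe r * t * ge r) = 1 * t * t * ge r"
        using m True t' by (intro corner_mult[OF m(2)]) (auto simp: V_q q_V)
      ultimately have "t * m * (pe r * t * ge r) = t * m" using t' q_idem by (simp add: mult.assoc)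
      moreover have "pe r * t * ge r \<in> range_idems I" using range_idemsI m t t' True by metis
      ultimately show ?thesis by blast
    next
      case False
      then show ?thesis using mt t' q_V_other x by simp
    qed
  next
    case (Cons e p')
    have mt: "t * m = (t * pe p) * V x * ge r" using m by (simp add: mult.assoc)
    show ?thesis
    proof (cases "u = w \<and> hd p \<notin> F")
      case True
      then have eq: "t * m = m" using mt t' m(3) q_pe[OF t'(2-4) m(1)] Cons by simp
      have "V x \<in> I" using V_range_mem[OF I _ t'(3,4)] t t' m True Cons by blast
      then have "pe r * V x * ge r \<in> range_idems I" using range_idemsI[OF m(2), of "{}"] by simp
      moreover have "pe p * V x * ge r * (pe r * V x * ge r) = pe p * V x * V x * ge r"
        using V_V[OF x] by (intro corner_mult[OF m(2)])
      ultimately show ?thesis using eq m(3) V_V[OF x] by (metis mult.assoc)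
    next
      case False
      then have "t * m = 0" using mt t' q_pe[OF t'(2-4) m(1)] Cons by auto
      then show ?thesis ..
    qed
  qed
qed

text \<open>Passes from single products to sums: x involves finitely many of the idempotents, and a
  left unit for these is a left unit for x. The alternative z = 0 covers products that are
  killed.\<close>

lemma span_left_units:
  assumes "x \<in> span {z. z = 0 \<or> (\<exists>d\<in>D. d * z = z)}"
  shows "\<exists>D'\<subseteq>D. finite D' \<and> (\<forall>u. (\<forall>d\<in>D'. u * d = d) \<longrightarrow> u * x = x)"
  using assms
proof induct
  case span_zero
  then show ?case by (intro exI[of _ "{}"]) auto
next
  case (span_step z x c)
  then obtain D' where D': "D' \<subseteq> D" "finite D'" "\<And>u. (\<forall>d\<in>D'. u * d = d) \<Longrightarrow> u * x = x" by blast
  obtain D'' where D'': "D'' \<subseteq> D" "finite D''" "\<And>u. (\<forall>d\<in>D''. u * d = d) \<Longrightarrow> u * z = z"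
  proof (cases "z = 0")
    case True
    then show ?thesis using that[of "{}"] by auto
  next
    case False
    then obtain d where d: "d \<in> D" "d * z = z" using span_step(1) by auto
    then have "u * z = z" if "u * d = d" for u using that by (metis mult.assoc)
    then show ?thesis using that[of "{d}"] d by auto
  qed
  show ?case
  proof (intro exI[of _ "D' \<union> D''"] conjI allI impI)
    fix u assume "\<forall>d\<in>D' \<union> D''. u * d = d"
    then show "u * (sc c * z + x) = sc c * z + x"
      using D'(3)[of u] D''(3)[of u] by (simp add: distrib_left sc_left_commute)
  qed (use D' D'' in auto)
qed

lemma span_right_units:
  assumes "x \<in> span {z. z = 0 \<or> (\<exists>d\<in>D. z * d = z)}"
  shows "\<exists>D'\<subseteq>D. finite D' \<and> (\<forall>u. (\<forall>d\<in>D'. d * u = d) \<longrightarrow> x * u = x)"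
  using assms
proof induct
  case span_zero
  then show ?case by (intro exI[of _ "{}"]) auto
next
  case (span_step z x c)
  then obtain D' where D': "D' \<subseteq> D" "finite D'" "\<And>u. (\<forall>d\<in>D'. d * u = d) \<Longrightarrow> x * u = x" by blast
  obtain D'' where D'': "D'' \<subseteq> D" "finite D''" "\<And>u. (\<forall>d\<in>D''. d * u = d) \<Longrightarrow> z * u = z"
  proof (cases "z = 0")
    case True
    then show ?thesis using that[of "{}"] by auto
  next
    case False
    then obtain d where d: "d \<in> D" "z * d = z" using span_step(1) by auto
    then have "z * u = z" if "d * u = d" for u using that by (metis mult.assoc)
    then show ?thesis using that[of "{d}"] d by auto
  qed
  show ?case
  proof (intro exI[of _ "D' \<union> D''"] conjI allI impI)
    fix u assume "\<forall>d\<in>D' \<union> D''. d * u = d"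
    then show "(sc c * z + x) * u = sc c * z + x"
      using D'(3)[of u] D''(3)[of u] by (simp add: distrib_right mult.assoc)
  qed (use D' D'' in auto)
qed

lemma s_unital_gid:
  assumes S: "S \<subseteq> T"
  shows "s_unital (gid S)"
proof -
  define D where "D = range_idems (gid S)"
  let ?I = "gid S" and ?Zl = "{z. z = 0 \<or> (\<exists>d\<in>D. d * z = z)}"
    and ?Zr = "{z. z = 0 \<or> (\<exists>d\<in>D. z * d = z)}"
  have SL: "S \<subseteq> L" using S T_L by blast
  have I: "idl ?I" by (rule gid_idl[OF SL])
  \<comment> \<open>Only the left factor x is expanded in monomials, because a left unit of m s is
    also one of m s y. For right units the factor y is expanded.\<close>
  have left: "?I \<subseteq> span ?Zl"
    unfolding gid_def[of S]
  proof (rule span_leastI, safe)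
    fix x s y assume *: "x \<in> L" "s \<in> S" "y \<in> L"
    from \<open>x \<in> L\<close> show "x * s * y \<in> span ?Zl"
      unfolding L_def mult.assoc
    proof (rule span_mult_right)
      fix m assume "m \<in> Mon"
      then have "m * s = 0 \<or> (\<exists>d\<in>D. d * (m * s) = m * s)"
        using * S gid_base[OF SL] unfolding D_def by (intro Mon_mult_T[OF I]) auto
      then have "m * s * y = 0 \<or> (\<exists>d\<in>D. d * (m * s * y) = m * s * y)"
        by (metis mult.assoc mult_zero_left)
      then have "m * s * y \<in> ?Zl" by blast
      then have "m * (s * y) \<in> ?Zl" by (simp only: mult.assoc)
      then show "m * (s * y) \<in> span ?Zl" by (rule span_base)
    qed
  qed
  have right: "?I \<subseteq> span ?Zr"
    unfolding gid_def[of S]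
  proof (rule span_leastI, safe)
    fix x s y assume *: "x \<in> L" "s \<in> S" "y \<in> L"
    from \<open>y \<in> L\<close> show "x * s * y \<in> span ?Zr"
      unfolding L_def
    proof (rule span_mult_left)
      fix m assume "m \<in> Mon"
      then have "s * m = 0 \<or> (\<exists>d\<in>D. (s * m) * d = s * m)"
        using * S gid_base[OF SL] unfolding D_def by (intro T_mult_Mon[OF I]) auto
      then have "x * (s * m) = 0 \<or> (\<exists>d\<in>D. x * (s * m) * d = x * (s * m))"
        by (metis mult.assoc mult_zero_right)
      then have "x * (s * m) \<in> ?Zr" by blast
      then have "x * s * m \<in> ?Zr" by (simp only: mult.assoc)
      then show "x * s * m \<in> span ?Zr" by (rule span_base)
    qed
  qed
  have D: "D \<subseteq> ?I" using range_idems_I[OF I] unfolding D_def by blast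
  have idem: "d * d = d" if "d \<in> D" for d
    using that unfolding D_def by (rule range_idems_idem)
  have comm: "d * d' = d' * d" if "d \<in> D" "d' \<in> D" for d d'
    using that unfolding D_def by (rule range_idems_commute)
  have "\<exists>u\<in>?I. u * x = x" if x: "x \<in> ?I" for x
  proof -
    obtain D' where D': "D' \<subseteq> D" "finite D'" "\<And>u. (\<forall>d\<in>D'. u * d = d) \<Longrightarrow> u * x = x"
      using span_left_units[OF subsetD[OF left x]] by blast
    obtain u where "u \<in> ?I" "\<And>d. d \<in> D' \<Longrightarrow> u * d = d"
      by (rule commuting_idempotents_unit[OF I D'(2) subset_trans[OF D'(1) D]
          idem[OF subsetD[OF D'(1)]] comm[OF subsetD[OF D'(1)] subsetD[OF D'(1)]]]) blast+
    then show ?thesis using D'(3) by blast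
  qed
  moreover have "\<exists>u\<in>?I. x * u = x" if x: "x \<in> ?I" for x
  proof -
    obtain D' where D': "D' \<subseteq> D" "finite D'" "\<And>u. (\<forall>d\<in>D'. d * u = d) \<Longrightarrow> x * u = x"
      using span_right_units[OF subsetD[OF right x]] by blast
    obtain u where "u \<in> ?I" "\<And>d. d \<in> D' \<Longrightarrow> d * u = d"
      by (rule commuting_idempotents_unit[OF I D'(2) subset_trans[OF D'(1) D]
          idem[OF subsetD[OF D'(1)]] comm[OF subsetD[OF D'(1)] subsetD[OF D'(1)]]]) blast+
    then show ?thesis using D'(3) by blast
  qed
  ultimately show ?thesis using I by (simp add: s_unital_def)
qed

lemma gid_Un:
  assumes "S \<subseteq> L" "S' \<subseteq> L"
  shows "gid (S \<union> S') = gid S + gid S'"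
proof
  have "idl (gid S + gid S')" "gid S \<subseteq> gid S + gid S'" "gid S' \<subseteq> gid S + gid S'"
    using assms by (auto intro!: idl_plus gid_idl subset_plus_left subset_plus_right)
  then show "gid (S \<union> S') \<subseteq> gid S + gid S'"
    using gid_base assms by (intro gid_least) blast+
  have "idl (gid (S \<union> S'))" "S \<union> S' \<subseteq> gid (S \<union> S')"
    using assms gid_base[of "S \<union> S'"] by (auto intro!: gid_idl)
  then show "gid S + gid S' \<subseteq> gid (S \<union> S')"
    by (intro plus_leastI gid_least) auto
qed

end

section \<open>Reduction to loops\<close>

context leavitt_family begin

text \<open>All ghost parts are based at u and have length at most n, so the elements are fixed by
  \<open>V u\<close> on the right. For n = 0 they are combinations of genuine paths ending at
  u.\<close>

definition ghost_bounded :: "nat \<Rightarrow> 'v \<Rightarrow> 'a set" where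
  "ghost_bounded n u = span {pe p * V x * ge r | p x r. (\<exists>u'. awalk u' p x) \<and> awalk u r x \<and> length r \<le> n}"

lemma ghost_bounded_gen: "awalk u' p x \<Longrightarrow> awalk u r x \<Longrightarrow> length r \<le> n \<Longrightarrow> pe p * V x * ge r \<in> ghost_bounded n u"
  unfolding ghost_bounded_def by (rule span_base) blast

lemma ghost_bounded_mono: "m \<le> n \<Longrightarrow> ghost_bounded m u \<subseteq> ghost_bounded n u"
  unfolding ghost_bounded_def[of m]
proof (rule span_leastI[of _ "{pe p * V x * ge r | p x r. (\<exists>u'. awalk u' p x) \<and> awalk u r x \<and> length r \<le> n}", folded ghost_bounded_def], rule subsetI)
  fix s assume "m \<le> n" "s \<in> {pe p * V x * ge r | p x r. (\<exists>u'. awalk u' p x) \<and> awalk u r x \<and> length r \<le> m}"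
  then obtain p x r u' where "awalk u' p x" "awalk u r x" "length r \<le> n" "s = pe p * V x * ge r" by auto
  then show "s \<in> ghost_bounded n u" using ghost_bounded_gen by blast
qed

lemma ghost_bounded_V:
  assumes "x \<in> ghost_bounded n u"
  shows "x * V u = x"
  using assms unfolding ghost_bounded_def
proof induct
  case (span_step s x c)
  then obtain p y r where "awalk u r y" "s = pe p * V y * ge r" by blast
  then have "s * V u = s" using V_ge_V[of u r y] by (simp add: mult.assoc)
  then show ?case using span_step by (simp add: distrib_right mult.assoc)
qed simp

lemma ghost_bounded_0_Ed:
  assumes x: "x \<in> ghost_bounded 0 u" and e: "e \<in> arcs E" "tail E e = u"
  shows "x * Ed e \<in> ghost_bounded 0 (head E e)"
  using x unfolding ghost_bounded_def[of 0 u]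
proof (rule span_mult_right[of _ _ _ "{pe p * V x * ge r | p x r. (\<exists>u'. awalk u' p x) \<and> awalk (head E e) r x \<and> length r \<le> 0}", folded ghost_bounded_def])
  fix s assume "s \<in> {pe p * V x * ge r |p x r. (\<exists>u'. awalk u' p x) \<and> awalk u r x \<and> length r \<le> 0}"
  then obtain p u' where p: "awalk u' p u" "s = pe p * V u" by (auto simp: awalk_Nil_iff)
  have "s * Ed e = pe p * (V u * Ed e)" using p by (simp add: mult.assoc)
  also have "V u * Ed e = Ed e * V (head E e)" using V_Ed[of e] Ed_V[of e] e by simp
  finally have eq: "s * Ed e = pe (p @ [e]) * V (head E e) * ge []" by (simp add: mult.assoc)
  have "awalk u' (p @ [e]) (head E e)"
    using p e arc_implies_awalk[of e] by (auto intro: awalk_appendI)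
  then show "s * Ed e \<in> ghost_bounded 0 (head E e)"
    unfolding eq using e by (intro ghost_bounded_gen) (auto simp: awalk_Nil_iff)
qed

text \<open>Each monomial with a ghost part is split at its rightmost ghost edge e. Since f vanishes
  off F, a further monomial can be added to f e whether or not e occurred before.\<close>

lemma ghost_bounded_decomp:
  assumes "x \<in> ghost_bounded (Suc n) u"
  shows "\<exists>y F f. y \<in> ghost_bounded 0 u \<and> finite F \<and> F \<subseteq> out_arcs E u \<and> (\<forall>e. if e \<in> F then f e \<in> ghost_bounded n (head E e) else f e = 0) \<and>
    x = y + (\<Sum>e\<in>F. f e * Gh e)"
  using assms unfolding ghost_bounded_def[of "Suc n"]
proof induct
  case span_zero
  show ?case by (intro exI[of _ 0] exI[of _ "{}"] exI[of _ "\<lambda>_. 0"]) (simp add: ghost_bounded_def span.span_zero)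
next
  case (span_step s x c)
  then obtain y F f where IH: "y \<in> ghost_bounded 0 u" "finite F" "F \<subseteq> out_arcs E u"
    "\<And>e. if e \<in> F then f e \<in> ghost_bounded n (head E e) else f e = 0" "x = y + (\<Sum>e\<in>F. f e * Gh e)" by blast
  obtain p x' r u' where s: "awalk u' p x'" "awalk u r x'" "length r \<le> Suc n" "s = pe p * V x' * ge r"
    using span_step(1) by blast
  show ?case
  proof (cases r)
    case Nil
    then have "s \<in> ghost_bounded 0 u" using s ghost_bounded_gen[of u' p x' u r 0] by simp
    then have "sc c * s + y \<in> ghost_bounded 0 u" using IH(1) by (simp add: ghost_bounded_def span_add span_scale)
    then show ?thesis using IH
      by (intro exI[of _ "sc c * s + y"] exI[of _ F] exI[of _ f]) (simp add: add.assoc)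
  next
    case (Cons e r')
    have f0: "f e = 0" if "e \<notin> F" for e using IH(4)[of e] that by simp
    define a where "a = sc c * (pe p * V x' * ge r')"
    define g where "g e' = f e' + (if e' = e then a else 0)" for e'
    have r': "e \<in> arcs E" "tail E e = u" "awalk (head E e) r' x'" "length r' \<le> n"
      using s Cons by (auto simp: awalk_Cons_iff)
    then have a: "a \<in> ghost_bounded n (head E e)"
      unfolding a_def using ghost_bounded_gen[OF s(1) r'(3,4)] by (simp add: ghost_bounded_def span_scale)
    have "(\<Sum>e'\<in>insert e F. g e' * Gh e') = (\<Sum>e'\<in>insert e F. f e' * Gh e') + (\<Sum>e'\<in>insert e F. if e' = e then a * Gh e else 0)"
      by (simp add: g_def distrib_right sum.distrib[symmetric] if_distrib[of "\<lambda>x. x * _"] cong: if_cong sum.cong)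
    also have "(\<Sum>e'\<in>insert e F. if e' = e then a * Gh e else 0) = a * Gh e"
      using IH(2) by (simp add: sum.delta del: sum.insert)
    also have "(\<Sum>e'\<in>insert e F. f e' * Gh e') = (\<Sum>e'\<in>F. f e' * Gh e')"
      using IH(2) f0 by (intro sum.mono_neutral_right) auto
    also have "a * Gh e = sc c * s" using s Cons by (simp add: a_def mult.assoc)
    finally have "sc c * s + x = y + (\<Sum>e'\<in>insert e F. g e' * Gh e')" using IH(5) by (simp add: ac_simps)
    moreover have "if e' \<in> insert e F then g e' \<in> ghost_bounded n (head E e') else g e' = 0" for e'
      using IH(4)[of e'] a by (auto simp: g_def ghost_bounded_def span_add split: if_splits)
    ultimately show ?thesis
      using IH(1-3) r' by (intro exI[of _ y] exI[of _ "insert e F"] exI[of _ g]) auto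
  qed
qed

lemma ghost_bounded_exhaust:
  assumes "x \<in> L" "u \<in> verts E"
  shows "\<exists>n. x * V u \<in> ghost_bounded n u"
  using assms(1) unfolding L_def
proof induct
  case span_zero
  then show ?case by (simp add: ghost_bounded_def span.span_zero)
next
  case (span_step m x c)
  then obtain n where n: "x * V u \<in> ghost_bounded n u" by blast
  obtain p r u' u'' w where m: "awalk u' p w" "awalk u'' r w" "m = pe p * V w * ge r" using span_step by (elim MonE)
  have "m * V u = pe p * (V w * ge r * V u'') * V u" using m(3) V_ge_V[OF m(2)] by (simp add: mult.assoc)
  also have "\<dots> = pe p * (V w * ge r) * (V u'' * V u)" by (simp add: mult.assoc)
  finally have "m * V u = pe p * (V w * ge r) * (V u'' * V u)" .
  then have "m * V u \<in> ghost_bounded (length r) u"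
  proof (cases "u = u''")
    case True
    then have "m * V u = m" using m(3) V_ge_V[OF m(2)] by (simp add: mult.assoc)
    then show ?thesis using m True ghost_bounded_gen[OF m(1,2), of "length r"] by simp
  qed (use V_mult assms awalk_hd_in_verts[OF m(2)] in \<open>simp add: ghost_bounded_def span.span_zero\<close>)
  then have "sc c * (m * V u) + x * V u \<in> ghost_bounded (max n (length r)) u"
    using n ghost_bounded_mono[of n "max n (length r)" u] ghost_bounded_mono[of "length r" "max n (length r)" u]
    unfolding ghost_bounded_def by (intro span_add span_scale) auto
  then show ?case by (auto simp: distrib_right mult.assoc)
qed

text \<open>If some x e with e in F stays outside I, it has shorter ghost parts and the induction
  continues. Otherwise x is congruent modulo I to \<open>x * q u F\<close>, where
  \<open>q u F\<close> kills every term ending in the ghost of an edge of F and leaves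
  \<open>y * q u F\<close> with y free of ghosts.\<close>

lemma ghost_reduction:
  assumes P: "idl P" and I: "idl I"
  shows "x \<in> ghost_bounded n u \<Longrightarrow> u \<in> verts E \<Longrightarrow> x \<in> P \<Longrightarrow> x \<notin> I \<Longrightarrow>
    \<exists>w F y. w \<in> verts E \<and> finite F \<and> F \<subseteq> out_arcs E w \<and> y \<in> ghost_bounded 0 w \<and> y * q w F \<in> P \<and> y * q w F \<notin> I"
proof (induct n arbitrary: x u)
  case 0
  then show ?case using ghost_bounded_V[OF 0(1)] by (intro exI[of _ u] exI[of _ "{}"] exI[of _ x]) simp
next
  case (Suc n)
  obtain y F f where d: "y \<in> ghost_bounded 0 u" "finite F" "F \<subseteq> out_arcs E u"
    "\<And>e. if e \<in> F then f e \<in> ghost_bounded n (head E e) else f e = 0" "x = y + (\<Sum>e\<in>F. f e * Gh e)"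
    using ghost_bounded_decomp[OF Suc.prems(1)] by blast
  have xe: "x * Ed e \<in> ghost_bounded n (head E e)" if "e \<in> F" for e
  proof -
    have e: "e \<in> arcs E" "tail E e = u" using that d by auto
    have "f g * Gh g * Ed e = (if g = e then f e else 0)" if "g \<in> F" for g
      using that d(3) d(4)[of e] e Gh_Ed[of g e] ghost_bounded_V[of "f e" n "head E e"] by (auto simp: mult.assoc)
    then have "(\<Sum>g\<in>F. f g * Gh g) * Ed e = f e"
      using that d(2) by (simp add: sum_distrib_right)
    then have "x * Ed e = y * Ed e + f e" using d(5) by (simp add: distrib_right)
    moreover have "y * Ed e \<in> ghost_bounded n (head E e)" using ghost_bounded_0_Ed[OF d(1) e] ghost_bounded_mono[of 0 n] by auto
    ultimately show ?thesis using d(4)[of e] that by (simp add: ghost_bounded_def span_add)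
  qed
  show ?case
  proof (cases "\<exists>e\<in>F. x * Ed e \<notin> I")
    case True
    then obtain e where e: "e \<in> F" "x * Ed e \<notin> I" by blast
    then have "e \<in> arcs E" using d by auto
    then show ?thesis using Suc.hyps[OF xe[OF e(1)]] e Suc.prems P by (auto intro: idl_right Ed_L)
  next
    case False
    have "(\<Sum>e\<in>F. f e * Gh e) * q u F = 0"
      using d(3) Suc.prems(2) d(2) Gh_q[of u F]
      by (auto simp: sum_distrib_right mult.assoc intro!: sum.neutral)
    then have xq: "x * q u F = y * q u F" using d(5) by (simp add: distrib_right)
    have "x = x * q u F + (\<Sum>e\<in>F. x * Ed e * Gh e)"
      using ghost_bounded_V[OF Suc.prems(1)] by (simp add: q_def right_diff_distrib sum_distrib_left mult.assoc)
    moreover have "(\<Sum>e\<in>F. x * Ed e * Gh e) \<in> I"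
    proof (rule idl_sum[OF I])
      fix e assume "e \<in> F"
      then have "x * Ed e \<in> I" "e \<in> arcs E" using False d(3) by auto
      then show "x * Ed e * Gh e \<in> I" using idl_right[OF I Gh_L] by blast
    qed
    ultimately have "x * q u F \<notin> I" using Suc.prems(4) I idl_add by metis
    moreover have "x * q u F \<in> P" using Suc.prems d q_T T_L P by (intro idl_right) auto
    ultimately show ?thesis
      using xq d Suc.prems by (intro exI[of _ u] exI[of _ F] exI[of _ y]) simp
  qed
qed

section \<open>Combinations of paths with a common end\<close>

definition psum :: "'e list set \<Rightarrow> ('e list \<Rightarrow> 'k) \<Rightarrow> 'v \<Rightarrow> 'a" where
  "psum A k w = (\<Sum>p\<in>A. sc (k p) * (pe p * V w))"

lemma ghost_bounded_0_psum:
  assumes "y \<in> ghost_bounded 0 w"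
  shows "\<exists>A k. finite A \<and> (\<forall>p\<in>A. k p \<noteq> 0 \<and> (\<exists>u. awalk u p w)) \<and> y = psum A k w"
proof -
  have "\<exists>A k. finite A \<and> (\<forall>p\<in>A. \<exists>u. awalk u p w) \<and> (\<forall>p. p \<notin> A \<longrightarrow> k p = 0) \<and> y = psum A k w"
    using assms unfolding ghost_bounded_def
  proof induct
    case span_zero
    show ?case by (intro exI[of _ "{}"] exI[of _ "\<lambda>_. 0"]) (simp add: psum_def)
  next
    case (span_step s y c)
    then obtain A k where IH: "finite A" "\<forall>p\<in>A. \<exists>u. awalk u p w" "\<And>p. p \<notin> A \<Longrightarrow> k p = 0" "y = psum A k w" by blast
    obtain p u where p: "awalk u p w" "s = pe p * V w" using span_step(1) by (auto simp: awalk_Nil_iff)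
    define k' where "k' r = (if r = p then c else 0) + k r" for r
    have "psum (insert p A) k' w
      = (\<Sum>r\<in>insert p A. if r = p then sc c * s else 0) + (\<Sum>r\<in>insert p A. sc (k r) * (pe r * V w))"
      unfolding psum_def sum.distrib[symmetric]
      by (intro sum.cong) (auto simp: k'_def sc_add sc_zero distrib_right p(2))
    also have "(\<Sum>r\<in>insert p A. if r = p then sc c * s else 0) = sc c * s"
      using IH(1) by (simp add: sum.delta del: sum.insert)
    also have "(\<Sum>r\<in>insert p A. sc (k r) * (pe r * V w)) = y"
      unfolding IH(4) psum_def using IH(1,3) by (intro sum.mono_neutral_right) (auto simp: sc_zero)
    finally have "sc c * s + y = psum (insert p A) k' w" by simp
    moreover have "k' r = 0" if "r \<notin> insert p A" for r
      using that IH(3)[of r] by (simp add: k'_def)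
    moreover have "finite (insert p A)" "\<forall>r\<in>insert p A. \<exists>u. awalk u r w" using IH(1,2) p(1) by auto
    ultimately show ?case by blast
  qed
  then obtain A k where A: "finite A" "\<forall>p\<in>A. \<exists>u. awalk u p w" "y = psum A k w" by blast
  have "psum A k w = psum {p \<in> A. k p \<noteq> 0} k w"
    unfolding psum_def using A(1) by (intro sum.mono_neutral_right) (auto simp: sc_zero)
  then show ?thesis using A by (intro exI[of _ "{p \<in> A. k p \<noteq> 0}"] exI[of _ k]) auto
qed

lemma ge_pe_cases:
  assumes p: "awalk u p x" and r: "awalk u' r w" and len: "length p \<le> length r"
  shows "V x * ge p * (pe r * V w) =
    (if prefix p r \<and> awalk x (drop (length p) r) w then pe (drop (length p) r) * V w else 0)"
proof (cases "prefix p r")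
  case True
  then obtain s where s: "r = p @ s" by (auto simp: prefix_def)
  then obtain y where y: "awalk u' p y" "awalk y s w" using r by (auto elim: awalk_appendE)
  show ?thesis
  proof (cases "awalk x s w")
    case True
    have "V x * ge p * (pe r * V w) = V x * (ge p * pe (p @ s) * V w)" using s by (simp add: mult.assoc)
    also have "\<dots> = pe s * V w"
      unfolding ge_pe_append[OF p True] by (rule V_pe_V[OF True])
    finally show ?thesis using True s by simp
  next
    case False
    \<comment> \<open>A nonempty p shares its first edge with r, hence its start, and the remainder
      would be a walk from x. An empty p does not determine its vertex, so the product can vanish
      although p is a prefix.\<close>
    have "p = []"
    proof (rule ccontr)
      assume "p \<noteq> []"
      then have "u = u'" using p y awalk_unique_start by blast
      then have "x = y" using p y awalk_unique_end by blast
      then show False using y False by simp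
    qed
    then have "x \<noteq> y" "y = u'" using False y by (auto simp: awalk_Nil_iff)
    have "V x * ge p * (pe r * V w) = (V x * V u') * (pe r * V w)"
      using \<open>p = []\<close> V_pe_V[OF r] by (simp add: mult.assoc)
    also have "\<dots> = 0" using \<open>x \<noteq> y\<close> \<open>y = u'\<close> V_mult awalk_last_in_verts[OF p] awalk_hd_in_verts[OF r] by simp
    finally show ?thesis using False s by simp
  qed
next
  case False
  then have "\<not> prefix r p" using len by (auto simp: prefix_def)
  then have "ge p * pe r = 0" using False p r ge_pe_parallel by blast
  then have "V x * (ge p * pe r) * V w = 0" by simp
  then show ?thesis using False by (simp add: mult.assoc)
qed

lemma ge_psum:
  assumes p: "awalk u p x" and A: "finite A" "\<And>r. r \<in> A \<Longrightarrow> (\<exists>u'. awalk u' r w) \<and> length p \<le> length r"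
  shows "V x * ge p * psum A k w = psum {r. p @ r \<in> A \<and> awalk x r w} (\<lambda>r. k (p @ r)) w"
proof -
  let ?A' = "{r. p @ r \<in> A \<and> awalk x r w}"
  have "V x * ge p * psum A k w = (\<Sum>r\<in>A. sc (k r) * (V x * ge p * (pe r * V w)))"
    by (simp add: psum_def sum_distrib_left sc_left_commute)
  also have "\<dots> = (\<Sum>r\<in>A. if prefix p r \<and> awalk x (drop (length p) r) w
      then sc (k r) * (pe (drop (length p) r) * V w) else 0)"
  proof (rule sum.cong)
    fix r assume "r \<in> A"
    then obtain u' where "awalk u' r w" "length p \<le> length r" using A(2) by blast
    then show "sc (k r) * (V x * ge p * (pe r * V w)) = (if prefix p r \<and> awalk x (drop (length p) r) w
      then sc (k r) * (pe (drop (length p) r) * V w) else 0)"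
      using ge_pe_cases[OF p] by simp
  qed simp
  also have "\<dots> = (\<Sum>r\<in>(\<lambda>r. p @ r) ` ?A'. sc (k r) * (pe (drop (length p) r) * V w))"
    using A(1) by (intro sum.mono_neutral_cong_right) (auto simp: prefix_def)
  also have "\<dots> = psum ?A' (\<lambda>r. k (p @ r)) w"
    by (subst sum.reindex) (auto simp: inj_on_def psum_def)
  finally show ?thesis .
qed

lemma psum_pe:
  assumes "awalk w p x" "finite A"
  shows "psum A k w * (pe p * V x) = psum ((\<lambda>r. r @ p) ` A) (\<lambda>r. k (take (length r - length p) r)) x"
proof -
  have "psum A k w * (pe p * V x) = (\<Sum>r\<in>A. sc (k r) * (pe (r @ p) * V x))"
    using V_pe_V[OF assms(1)] by (simp add: psum_def sum_distrib_right mult.assoc)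
  also have "\<dots> = psum ((\<lambda>r. r @ p) ` A) (\<lambda>r. k (take (length r - length p) r)) x"
    unfolding psum_def by (subst sum.reindex) (auto simp: inj_on_def)
  finally show ?thesis .
qed

text \<open>The empty list stands for the vertex w, so \<open>k [] \<noteq> 0\<close> says that this
  combination of closed paths has a nonzero constant term.\<close>

definition loop_sum :: "'a set \<Rightarrow> 'v \<Rightarrow> 'e list set \<Rightarrow> ('e list \<Rightarrow> 'k) \<Rightarrow> bool" where
  "loop_sum P w A k \<longleftrightarrow> finite A \<and> [] \<in> A \<and> k [] \<noteq> 0 \<and> (\<forall>p\<in>A. awalk w p w) \<and> psum A k w \<in> P"

text \<open>The term p survives exactly if p t = t r for some r, and becomes r. Then p and r have
  equal length, so p is recovered from r as \<open>take (length r) (t @ r)\<close>; this explains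
  the new coefficient function.\<close>

lemma conj_psum:
  assumes A: "finite A" "\<And>p. p \<in> A \<Longrightarrow> awalk w p w" and t: "awalk w t x"
  shows "V x * ge t * psum A k w * (pe t * V x)
    = psum {r. \<exists>p\<in>A. p @ t = t @ r} (\<lambda>r. k (take (length r) (t @ r))) x"
proof -
  let ?B = "(\<lambda>r. r @ t) ` A"
  have "V x * ge t * psum A k w * (pe t * V x)
    = V x * ge t * psum ?B (\<lambda>r. k (take (length r - length t) r)) x"
    using psum_pe[OF t A(1)] by (simp add: mult.assoc)
  also have "\<dots> = psum {r. t @ r \<in> ?B \<and> awalk x r x} (\<lambda>r. k (take (length (t @ r) - length t) (t @ r))) x"
    using A t by (intro ge_psum) (auto intro!: awalk_appendI)
  also have "{r. t @ r \<in> ?B \<and> awalk x r x} = {r. \<exists>p\<in>A. p @ t = t @ r}"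
  proof -
    have "awalk x r x" if "p \<in> A" "p @ t = t @ r" for p r
    proof -
      have "awalk w (t @ r) x" using A(2)[OF that(1)] t that(2) awalk_appendI by metis
      then show ?thesis using t by (metis awalk_appendE awalk_unique_end)
    qed
    then show ?thesis by (auto simp: image_iff) metis
  qed
  finally show ?thesis by simp
qed

lemma conj_set_finite: "finite A \<Longrightarrow> finite {r. \<exists>p\<in>A. p @ t = t @ r}"
proof -
  assume "finite A"
  moreover have "{r. \<exists>p\<in>A. p @ t = t @ r} \<subseteq> (\<lambda>p. drop (length t) (p @ t)) ` A"
  proof
    fix r assume "r \<in> {r. \<exists>p\<in>A. p @ t = t @ r}"
    then obtain p where "p \<in> A" "p @ t = t @ r" by blast
    then show "r \<in> (\<lambda>p. drop (length t) (p @ t)) ` A" by (intro image_eqI[of _ _ p]) simp_all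
  qed
  ultimately show ?thesis by (meson finite_imageI finite_subset)
qed

text \<open>The trivial path gives r = [] with the same coefficient, so the constant term is kept.
  Membership in P is asked of the product with t, because in \<open>reduction\<close> this product
  is what is known to lie in P.\<close>

lemma loop_sum_conj:
  assumes P: "idl P" and ls: "finite A" "[] \<in> A" "k [] \<noteq> 0" "\<And>p. p \<in> A \<Longrightarrow> awalk w p w" and t: "awalk w t x"
    and mem: "psum A k w * (pe t * V x) \<in> P"
  shows "loop_sum P x {r. \<exists>p\<in>A. p @ t = t @ r} (\<lambda>r. k (take (length r) (t @ r)))"
proof -
  have "awalk x r x" if "p \<in> A" "p @ t = t @ r" for p r
  proof -
    have "awalk w (t @ r) x" using ls(4)[OF that(1)] t that(2) awalk_appendI by metis
    then show ?thesis using t by (metis awalk_appendE awalk_unique_end)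
  qed
  moreover have "V x * ge t * (psum A k w * (pe t * V x)) \<in> P"
    by (rule idl_left[OF P ge_L[OF t] mem])
  ultimately show ?thesis
    unfolding loop_sum_def using ls conj_set_finite[OF ls(1)] conj_psum[OF ls(1,4) t, of k]
    by (auto simp: mult.assoc)
qed

lemma loop_reduction:
  assumes P: "idl P" and I: "idl I" and t: "t = q w F" "w \<in> verts E" "finite F" "F \<subseteq> out_arcs E w"
  shows "finite A \<Longrightarrow> (\<And>p. p \<in> A \<Longrightarrow> k p \<noteq> 0 \<and> (\<exists>u. awalk u p w)) \<Longrightarrow> psum A k w * t \<in> P \<Longrightarrow> psum A k w * t \<notin> I \<Longrightarrow>
    \<exists>A k. finite A \<and> [] \<in> A \<and> k [] \<noteq> 0 \<and> (\<forall>p\<in>A. awalk w p w) \<and> psum A k w * t \<in> P \<and> psum A k w * t \<notin> I"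
proof (induct "card A" arbitrary: A rule: less_induct)
  case less
  have "A \<noteq> {}" using less.prems(4) idl_zero[OF I] by (auto simp: psum_def)
  define p where "p = arg_min_on length A"
  have p: "p \<in> A" "\<And>r. r \<in> A \<Longrightarrow> length p \<le> length r"
    unfolding p_def using \<open>A \<noteq> {}\<close> less.prems(1) by (auto intro: arg_min_if_finite arg_min_least)
  obtain u where u: "awalk u p w" using p less.prems(2) by blast
  let ?A' = "{r. p @ r \<in> A \<and> awalk w r w}"
  have fin: "finite ?A'"
  proof (rule finite_subset)
    show "?A' \<subseteq> drop (length p) ` A"
    proof
      fix r assume "r \<in> ?A'"
      then show "r \<in> drop (length p) ` A" by (intro image_eqI[of _ _ "p @ r"]) simp_all
    qed
  qed (use less.prems(1) in simp)
  have eq: "V w * ge p * psum A k w = psum ?A' (\<lambda>r. k (p @ r)) w"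
    using p less.prems(2) by (intro ge_psum[OF u less.prems(1)]) blast
  have inP: "V w * ge p * (psum A k w * t) \<in> P"
    by (rule idl_left[OF P ge_L[OF u] less.prems(3)])
  show ?case
  proof (cases "V w * ge p * (psum A k w * t) \<in> I")
    case False
    then show ?thesis
      using inP fin p(1) less.prems(2) t(2) eq
      by (intro exI[of _ ?A'] exI[of _ "\<lambda>r. k (p @ r)"]) (auto simp: mult.assoc[symmetric] awalk_Nil_iff)
  next
    case True
    let ?A1 = "(\<lambda>r. p @ r) ` ?A'"
    have A1: "?A1 \<subseteq> A" "p \<in> ?A1" using p(1) t(2) by (auto simp: awalk_Nil_iff image_iff)
    have "(pe p * V w) * (V w * ge p * (psum A k w * t)) = pe p * (V w * V w) * ge p * psum A k w * t"
      by (simp add: mult.assoc)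
    also have "\<dots> = pe p * (V w * ge p * psum A k w) * t"
      unfolding V_V[OF t(2)] by (simp add: mult.assoc)
    also have "\<dots> = pe p * psum ?A' (\<lambda>r. k (p @ r)) w * t"
      unfolding eq ..
    also have "pe p * psum ?A' (\<lambda>r. k (p @ r)) w = psum ?A1 k w"
      unfolding psum_def by (subst sum.reindex) (auto simp: inj_on_def sum_distrib_left sc_left_commute mult.assoc)
    finally have "psum ?A1 k w * t = (pe p * V w) * (V w * ge p * (psum A k w * t))" by simp
    then have A1I: "psum ?A1 k w * t \<in> I" "psum ?A1 k w * t \<in> P"
      using idl_left[OF I pe_L[OF u] True] idl_left[OF P pe_L[OF u] inP] by simp_all
    have "psum A k w = psum (A - ?A1) k w + psum ?A1 k w"
      unfolding psum_def using A1(1) less.prems(1) by (rule sum.subset_diff)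
    then have split: "psum A k w * t = psum (A - ?A1) k w * t + psum ?A1 k w * t" by (simp add: distrib_right)
    have "psum (A - ?A1) k w * t \<notin> I"
      using less.prems(4) idl_add[OF I _ A1I(1)] unfolding split by blast
    moreover have "psum (A - ?A1) k w * t \<in> P"
      using split idl_diff[OF P less.prems(3) A1I(2)] by simp
    moreover have "card (A - ?A1) < card A"
      using A1 p(1) less.prems(1) by (intro psubset_card_mono) auto
    ultimately show ?thesis using less.hyps[of "A - ?A1"] less.prems(1,2) by simp
  qed
qed

lemma idl_descale:
  assumes "idl I" "sc c * x \<in> I" "c \<noteq> 0"
  shows "x \<in> I"
proof -
  have "sc (1 / c) * (sc c * x) \<in> I" by (rule idl_scale[OF assms(1,2)])
  then show ?thesis using assms(3) by (simp add: mult.assoc[symmetric] sc_mult[symmetric] sc_one)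
qed

lemma q_mult_psum:
  assumes t: "w \<in> verts E" "finite F" "F \<subseteq> out_arcs E w"
    and A: "finite A" "[] \<in> A" "\<And>p. p \<in> A \<Longrightarrow> p \<noteq> [] \<Longrightarrow> q w F * (pe p * V w) = 0"
  shows "q w F * psum A k w = sc (k []) * q w F"
proof -
  have "q w F * psum A k w = (\<Sum>p\<in>A. if p = [] then sc (k []) * q w F else 0)"
    unfolding psum_def sum_distrib_left sc_left_commute
    using q_V[OF t] A(3) by (intro sum.cong) auto
  also have "\<dots> = sc (k []) * q w F" using A(1,2) by (simp add: sum.delta)
  finally show ?thesis .
qed

text \<open>After the two previous reductions P contains a combination of closed paths at w times
  some t = \<open>q w F\<close> outside I. Suppose every edge leaving w outside F ended in I. A
  closed path through such an edge would force w, hence t, into I; so t would kill all nonconstant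
  terms, and multiplying by t on the left would put t into P, against P \<inter> T \<subseteq> I. So
  some edge e outside F ends outside I. As t e = e, conjugation by e removes t.\<close>

lemma reduction:
  assumes P: "idl P" and I: "idl I" and PT: "P \<inter> T \<subseteq> I" and nsub: "\<not> P \<subseteq> I"
  obtains w A k where "w \<in> verts E" "V w \<notin> I" "loop_sum P w A k"
proof -
  obtain x where x: "x \<in> P" "x \<notin> I" "x \<in> L" using nsub P idl_L by blast
  obtain W where W: "W \<subseteq> verts E" "x * vsum W = x" using x(3) by (elim local_unit)
  have "\<exists>u\<in>W. x * V u \<notin> I"
  proof (rule ccontr)
    assume "\<not> (\<exists>u\<in>W. x * V u \<notin> I)"
    then have "(\<Sum>u\<in>W. x * V u) \<in> I" by (intro idl_sum[OF I]) blast
    then show False using W x by (simp add: vsum_def sum_distrib_left)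
  qed
  then obtain u where u: "u \<in> verts E" "x * V u \<notin> I" using W by blast
  obtain n where n: "x * V u \<in> ghost_bounded n u" using ghost_bounded_exhaust[OF x(3) u(1)] by blast
  have "x * V u \<in> P" using x u by (intro idl_right[OF P] V_L)
  then obtain w F y where y: "w \<in> verts E" "finite F" "F \<subseteq> out_arcs E w" "y \<in> ghost_bounded 0 w"
    "y * q w F \<in> P" "y * q w F \<notin> I"
    using ghost_reduction[OF P I n u(1) _ u(2)] by blast
  define t where "t = q w F"
  obtain A0 k0 where A0: "finite A0" "\<And>p. p \<in> A0 \<Longrightarrow> k0 p \<noteq> 0 \<and> (\<exists>u. awalk u p w)" "y = psum A0 k0 w"
    using ghost_bounded_0_psum[OF y(4)] by blast
  obtain A k where A: "finite A" "[] \<in> A" "k [] \<noteq> 0" "\<And>p. p \<in> A \<Longrightarrow> awalk w p w"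
    "psum A k w * t \<in> P" "psum A k w * t \<notin> I"
    using loop_reduction[OF P I t_def y(1-3) A0(1,2)] y(5,6) A0(3) unfolding t_def by blast
  have tI: "t \<notin> I" and tL: "t \<in> L" and tT: "t \<in> T"
  proof -
    have "psum A k w \<in> L"
      unfolding psum_def using A(4) by (intro sum_L sc_L pe_L)
    then show "t \<notin> I" using A(6) idl_left[OF I] by blast
    show "t \<in> T" unfolding t_def by (intro q_T y)
    then show "t \<in> L" using T_L by blast
  qed
  have "\<exists>e\<in>out_arcs E w - F. V (head E e) \<notin> I"
  proof (rule ccontr)
    assume "\<not> (\<exists>e\<in>out_arcs E w - F. V (head E e) \<notin> I)"
    then have all: "V (head E e) \<in> I" if "e \<in> out_arcs E w - F" for e using that by blast
    have "t * (pe p * V w) = 0" if pA: "p \<in> A" "p \<noteq> []" for p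
    proof (cases "hd p \<in> F")
      case True
      then show ?thesis using q_pe[OF y(1-3) A(4)[OF pA(1)] pA(2)] by (simp add: t_def mult.assoc[symmetric])
    next
      case False
      obtain e r where p: "p = e # r" using pA(2) by (cases p) auto
      then have e: "e \<in> arcs E" "tail E e = w" "awalk (head E e) r w"
        using A(4)[OF pA(1)] by (auto simp: awalk_Cons_iff)
      then have "V (head E e) \<in> I" using all False p by auto
      then have "(V w * ge r) * V (head E e) * (pe r * V w) \<in> I"
        by (intro idl_left[OF I] idl_right[OF I] ge_L[OF e(3)] pe_L[OF e(3)])
      also have "(V w * ge r) * V (head E e) * (pe r * V w) = V w * (ge r * pe r * V w)"
        using V_ge_V[OF e(3)] by (simp add: mult.assoc)
      also have "\<dots> = V w" using ge_pe[OF e(3)] V_V[OF y(1)] by simp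
      finally have "V w * t \<in> I" using tL by (intro idl_right[OF I])
      then show ?thesis using tI V_q[OF y(1-3)] by (simp add: t_def)
    qed
    then have "t * psum A k w = sc (k []) * t"
      unfolding t_def by (intro q_mult_psum[OF y(1-3) A(1,2)])
    then have "t * (psum A k w * t) = sc (k []) * t"
      using q_idem[OF y(1-3)] by (simp add: t_def mult.assoc[symmetric]) (simp add: mult.assoc)
    then have "sc (k []) * t \<in> P" using idl_left[OF P tL A(5)] by simp
    then have "t \<in> P" using A(3) by (rule idl_descale[OF P])
    then show False using PT tT tI by blast
  qed
  then obtain e where e: "e \<in> arcs E" "tail E e = w" "e \<notin> F" "V (head E e) \<notin> I" by auto
  have "awalk w [e] (head E e)" using e arc_implies_awalk by blast
  moreover have "psum A k w * (pe [e] * V (head E e)) \<in> P"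
  proof -
    have "t * Ed e = Ed e" using q_Ed[OF y(1-3) e(1)] e by (simp add: t_def)
    then have "psum A k w * (pe [e] * V (head E e)) = psum A k w * t * Ed e"
      using e by (simp add: mult.assoc Ed_V)
    then show ?thesis using A(5) e idl_right[OF P] Ed_L by metis
  qed
  ultimately have "loop_sum P (head E e) {r. \<exists>p\<in>A. p @ [e] = [e] @ r} (\<lambda>r. k (take (length r) ([e] @ r)))"
    by (intro loop_sum_conj[where A = A and k = k and w = w, OF P A(1-4)])
  then show ?thesis using e that by (meson head_in_verts)
qed

end

section \<open>Primes that are not generated by idempotents\<close>

context leavitt_family begin

lemma loop_sum_minimal:
  assumes P: "idl P" and nsub: "\<not> P \<subseteq> gid (P \<inter> T)"
  obtains w A k d where "w \<in> verts E" "V w \<notin> P" "loop_sum P w A k" "awalk w d w" "d \<noteq> []"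
    "\<And>t u. awalk w t u \<Longrightarrow> V u \<notin> P \<Longrightarrow> prefix t (d @ t)"
proof -
  have PT: "P \<inter> T \<subseteq> L" using T_L by blast
  \<comment> \<open>The minimum is taken over all vertices outside P at once, because conjugation by
    t moves a combination from w to the end of t.\<close>
  define Q where "Q n \<longleftrightarrow> (\<exists>w A k. w \<in> verts E \<and> V w \<notin> P \<and> loop_sum P w A k \<and> card A = n)" for n
  obtain w A k where "w \<in> verts E" "V w \<notin> gid (P \<inter> T)" "loop_sum P w A k"
    using reduction[OF P gid_idl[OF PT] _ nsub] gid_base[OF PT] by (metis subsetI)
  moreover from this have "V w \<notin> P" using gid_base[OF PT] V_T by blast
  ultimately have "\<exists>n. Q n" unfolding Q_def by blast
  then have "Q (LEAST n. Q n)" by (rule LeastI_ex)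
  then obtain w A k where w: "w \<in> verts E" "V w \<notin> P" "loop_sum P w A k" and card: "card A = (LEAST n. Q n)"
    unfolding Q_def by blast
  have A: "finite A" "[] \<in> A" "k [] \<noteq> 0" "\<And>p. p \<in> A \<Longrightarrow> awalk w p w" "psum A k w \<in> P"
    using w(3) by (auto simp: loop_sum_def)
  have "\<exists>d\<in>A. d \<noteq> []"
  proof (rule ccontr)
    assume "\<not> (\<exists>d\<in>A. d \<noteq> [])"
    then have "A = {[]}" using A(2) by blast
    then have "sc (k []) * V w \<in> P" using A(5) by (simp add: psum_def)
    then have "V w \<in> P" using A(3) by (rule idl_descale[OF P])
    then show False using w(2) by simp
  qed
  then obtain d where d: "d \<in> A" "d \<noteq> []" by blast
  have "prefix t (d @ t)" if t: "awalk w t u" "V u \<notin> P" for t u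
  proof (rule ccontr)
    assume neg: "\<not> prefix t (d @ t)"
    let ?A' = "{r. \<exists>p\<in>A. p @ t = t @ r}"
    have "loop_sum P u ?A' (\<lambda>r. k (take (length r) (t @ r)))"
      using A(5) by (intro loop_sum_conj[where A = A and k = k and w = w, OF P A(1-4) t(1)] idl_right[OF P pe_L[OF t(1)]])
    then have "Q (card ?A')" unfolding Q_def using t awalk_last_in_verts by blast
    then have "card A \<le> card ?A'" unfolding card by (rule Least_le)
    also have "?A' \<subseteq> (\<lambda>p. drop (length t) (p @ t)) ` (A - {d})"
    proof
      fix r assume "r \<in> ?A'"
      then obtain p where "p \<in> A" "p @ t = t @ r" by blast
      moreover from this neg have "p \<noteq> d" by auto
      ultimately show "r \<in> (\<lambda>p. drop (length t) (p @ t)) ` (A - {d})"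
        by (intro image_eqI[of _ _ p]) simp_all
    qed
    then have "card ?A' \<le> card (A - {d})"
      using A(1) by (meson card_image_le card_mono finite_Diff finite_imageI le_trans)
    also have "\<dots> < card A" using d(1) A(1) by (intro psubset_card_mono) auto
    finally show False by simp
  qed
  then show ?thesis using that w A(4)[OF d(1)] d(2) by blast
qed

lemma V_hereditary:
  assumes "idl I" "awalk u p x" "V u \<in> I"
  shows "V x \<in> I"
proof -
  have "(V x * ge p) * V u * (pe p * V x) \<in> I"
    using assms by (intro idl_left[OF assms(1)] idl_right[OF assms(1)] ge_L pe_L)
  also have "(V x * ge p) * V u * (pe p * V x) = V x * (ge p * pe p * V x)"
    using V_ge_V[OF assms(2)] by (simp add: mult.assoc)
  also have "\<dots> = V x" using ge_pe[OF assms(2)] V_V awalk_last_in_verts[OF assms(2)] by simp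
  finally show ?thesis .
qed

lemma loop_sum_q:
  assumes P: "idl P" and ls: "loop_sum P w A k" and t: "w \<in> verts E" "finite F" "F \<subseteq> out_arcs E w"
    and kill: "\<And>p. p \<in> A \<Longrightarrow> p \<noteq> [] \<Longrightarrow> q w F * (pe p * V w) = 0"
  shows "q w F \<in> P"
proof -
  have "q w F \<in> L" using q_T[OF t] T_L by blast
  then have "q w F * psum A k w \<in> P" using ls by (intro idl_left[OF P]) (auto simp: loop_sum_def)
  moreover have "q w F * psum A k w = sc (k []) * q w F"
  proof (rule q_mult_psum[OF t])
    show "finite A" "[] \<in> A" using ls by (simp_all add: loop_sum_def)
  qed (rule kill)
  ultimately have "sc (k []) * q w F \<in> P" by simp
  then show ?thesis by (rule idl_descale[OF P]) (use ls in \<open>simp add: loop_sum_def\<close>)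
qed

definition comm_mod :: "'a set \<Rightarrow> 'a \<Rightarrow> 'a \<Rightarrow> bool" where
  "comm_mod G a b \<longleftrightarrow> a * b - b * a \<in> G"

lemma comm_mod_sym: "idl G \<Longrightarrow> comm_mod G a b \<Longrightarrow> comm_mod G b a"
  unfolding comm_mod_def using idl_uminus[of G "a * b - b * a"] by simp

lemma comm_mod_mult:
  assumes G: "idl G" and L: "a \<in> L" "a' \<in> L" and c: "comm_mod G a b" "comm_mod G a' b"
  shows "comm_mod G (a * a') b"
proof -
  have "a * (a' * b - b * a') + (a * b - b * a) * a' \<in> G"
    using c L unfolding comm_mod_def by (intro idl_add[OF G] idl_left[OF G] idl_right[OF G])
  then show ?thesis by (simp add: comm_mod_def algebra_simps)
qed

lemma comm_mod_span:
  assumes G: "idl G" and a: "a \<in> span S" and S: "\<And>s. s \<in> S \<Longrightarrow> comm_mod G s b"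
  shows "comm_mod G a b"
  using a
proof induct
  case span_zero
  then show ?case using idl_zero[OF G] by (simp add: comm_mod_def)
next
  case (span_step s x c)
  have "sc c * (s * b - b * s) + (x * b - b * x) \<in> G"
    using span_step S unfolding comm_mod_def by (intro idl_add[OF G] idl_scale[OF G]) auto
  then show ?case by (simp add: comm_mod_def algebra_simps sc_left_commute)
qed

lemma comm_mod_cong:
  assumes G: "idl G" and "a - a' \<in> G" "b \<in> L" "comm_mod G a' b"
  shows "comm_mod G a b"
proof -
  have "((a - a') * b - b * (a - a')) + (a' * b - b * a') \<in> G"
    using idl_add[OF G idl_diff[OF G idl_right[OF G assms(3,2)] idl_left[OF G assms(3,2)]]] assms(4)
    unfolding comm_mod_def by blast
  then show ?thesis by (simp add: comm_mod_def algebra_simps)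
qed

lemma prefix_replicate:
  "prefix t (d @ t) \<Longrightarrow> prefix t (concat (replicate n d) @ t)"
  by (induct n) (auto simp: prefix_def, metis append.assoc)

text \<open>If t is a prefix of d t, it is one of d^n t for every n. Once d^n is at least as long as
  t, it contains all of t, so t reads along the periodic word d d d ...\<close>

lemma prefix_replicate_long:
  assumes "prefix t (d @ t)" "d \<noteq> []" "length t \<le> n"
  shows "prefix t (concat (replicate n d))"
proof -
  have "1 \<le> length d" using assms(2) by (cases d) auto
  then have "n \<le> length (concat (replicate n d))" by (induct n) auto
  then have "length t \<le> length (concat (replicate n d))" using assms(3) by linarith
  then show ?thesis using prefix_replicate[OF assms(1), of n]
    by (metis prefixI prefix_length_prefix)
qed

lemma awalk_replicate: "awalk w d w \<Longrightarrow> awalk w (concat (replicate n d)) w"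
  by (induct n) (auto simp: awalk_Nil_iff intro: awalk_appendI awalk_hd_in_verts)

lemma first_entry:
  "awalk u p x \<Longrightarrow> V u \<notin> N \<Longrightarrow> V x \<in> N \<Longrightarrow>
    \<exists>p1 e p2. p = p1 @ e # p2 \<and> V (tail E e) \<notin> N \<and> V (head E e) \<in> N"
proof (induct p arbitrary: u)
  case (Cons e p)
  then have e: "u = tail E e" "awalk (head E e) p x" by (auto simp: awalk_Cons_iff)
  show ?case
  proof (cases "V (head E e) \<in> N")
    case True
    then show ?thesis using Cons.prems e by (intro exI[of _ "[]"] exI[of _ e] exI[of _ p]) simp
  next
    case False
    then obtain p1 f p2 where "p = p1 @ f # p2" "V (tail E f) \<notin> N" "V (head E f) \<in> N"
      using Cons.hyps[OF e(2)] Cons.prems by blast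
    then show ?thesis by (intro exI[of _ "e # p1"] exI[of _ f] exI[of _ p2]) simp
  qed
qed (auto simp: awalk_Nil_iff)

end

text \<open>The data produced by \<open>loop_sum_minimal\<close>. The assumption
  \<open>unique\<close> makes every walk from w that ends outside P follow d d d ...: the cycle
  through w has no exit modulo P.\<close>

locale nongraded_prime = leavitt_family E sc V Ed Gh
  for E :: "('v, 'e) pre_digraph" and sc :: "'k::field \<Rightarrow> 'a::ring_1"
    and V :: "'v \<Rightarrow> 'a" and Ed Gh :: "'e \<Rightarrow> 'a" +
  fixes P :: "'a set" and w :: 'v and A :: "'e list set" and k :: "'e list \<Rightarrow> 'k" and d :: "'e list"
  assumes prime: "prime_idl P" and w: "w \<in> verts E" "V w \<notin> P" and ls: "loop_sum P w A k"
    and d: "awalk w d w" "d \<noteq> []"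
    and unique: "\<And>t u. awalk w t u \<Longrightarrow> V u \<notin> P \<Longrightarrow> prefix t (d @ t)"
begin

lemma P: "idl P"
  using prime by (rule prime_idl_idl)

definition G :: "'a set" where
  "G = gid (P \<inter> T)"

lemma G: "idl G"
  unfolding G_def using T_L by (intro gid_idl) blast

lemma G_P: "G \<subseteq> P"
  unfolding G_def by (intro gid_least P) blast

lemma T_G: "t \<in> T \<Longrightarrow> t \<in> P \<Longrightarrow> t \<in> G"
  unfolding G_def using T_L by (intro gid_base) blast+

lemma walks_comparable:
  assumes "awalk w s u" "V u \<notin> P" "awalk w t x" "V x \<notin> P" "length s \<le> length t"
  shows "prefix s t"
proof -
  have "prefix s (concat (replicate (length t) d))" "prefix t (concat (replicate (length t) d))"
    using unique assms d(2) prefix_replicate_long by blast+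
  then show ?thesis using assms(5) prefix_length_prefix by blast
qed

text \<open>Comparison with \<open>t @ [e]\<close> shows that all nonempty closed paths at the
  source of e start with e. So \<open>q (tail E e) {e}\<close> kills every nonconstant term of the
  combination conjugated by t, and therefore lies in P. Modulo \<open>G\<close>, e behaves like the
  only edge leaving its source.\<close>

lemma q_edge_P:
  assumes t: "awalk w (t @ [e]) x" and x: "V x \<notin> P"
  shows "q (tail E e) {e} \<in> G"
proof -
  let ?u = "tail E e"
  have e: "e \<in> arcs E" "awalk w t ?u" "x = head E e"
    using t by (auto elim!: awalk_appendE simp: awalk_Cons_iff awalk_Nil_iff)
  have u: "V ?u \<notin> P"
    using V_hereditary[OF P, of ?u "[e]" x] x e arc_implies_awalk[of e] by blast
  let ?A' = "{r. \<exists>p\<in>A. p @ t = t @ r}"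
  have A: "finite A" "[] \<in> A" "k [] \<noteq> 0" "\<And>p. p \<in> A \<Longrightarrow> awalk w p w" "psum A k w \<in> P"
    using ls by (auto simp: loop_sum_def)
  have ls': "loop_sum P ?u ?A' (\<lambda>r. k (take (length r) (t @ r)))"
    using A(5) by (intro loop_sum_conj[where A = A and k = k and w = w, OF P A(1-4) e(2)] idl_right[OF P pe_L[OF e(2)]])
  have "q ?u {e} \<in> P"
  proof (rule loop_sum_q[OF P ls'])
    fix r assume r: "r \<in> ?A'" "r \<noteq> []"
    then have walk: "awalk ?u r ?u" using ls' by (auto simp: loop_sum_def)
    have "prefix (t @ [e]) (t @ r)"
      using r(2) u x by (intro walks_comparable[OF t _ awalk_appendI[OF e(2) walk]]) (cases r; simp)+
    then have "hd r = e" by (cases r) auto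
    then have "q ?u {e} * pe r = 0" using q_pe[of ?u "{e}", OF _ _ _ walk r(2)] e(1) by simp
    then show "q ?u {e} * (pe r * V ?u) = 0" by (simp add: mult.assoc[symmetric])
  qed (use e in auto)
  then show ?thesis using e(1) by (intro T_G q_T) auto
qed

text \<open>Each further edge e replaces its source by \<open>Ed e * Gh e\<close> through
  \<open>q_edge_P\<close>.\<close>

lemma V_proj_G:
  "awalk w t u \<Longrightarrow> V u \<notin> P \<Longrightarrow> V w - pe t * V u * ge t \<in> G"
proof (induct t arbitrary: u rule: rev_induct)
  case Nil
  then show ?case using idl_zero[OF G] by (simp add: awalk_Nil_iff)
next
  case (snoc e t)
  let ?y = "tail E e"
  have e: "e \<in> arcs E" "awalk w t ?y" "u = head E e"
    using snoc.prems by (auto elim!: awalk_appendE simp: awalk_Cons_iff awalk_Nil_iff)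
  have "V ?y \<notin> P"
    using V_hereditary[OF P, of ?y "[e]" u] snoc.prems(2) e arc_implies_awalk[of e] by blast
  then have "V w - pe t * V ?y * ge t \<in> G" using snoc.hyps e(2) by blast
  moreover have "(pe t * V ?y) * q ?y {e} * (V ?y * ge t) \<in> G"
    using q_edge_P[OF snoc.prems] e(2) by (intro idl_left[OF G] idl_right[OF G] pe_L ge_L)
  moreover have "(pe t * V ?y) * q ?y {e} * (V ?y * ge t) = pe t * (V ?y * q ?y {e} * V ?y) * ge t"
    by (simp add: mult.assoc)
  moreover have "V ?y * q ?y {e} * V ?y = V ?y - Ed e * V u * Gh e"
    using V_q[of ?y "{e}"] q_V[of ?y "{e}"] e Ed_V[of e] by (simp add: q_def)
  ultimately have "(V w - pe t * V ?y * ge t) + pe t * (V ?y - Ed e * V u * Gh e) * ge t \<in> G"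
    by (simp add: idl_add[OF G])
  then show ?case by (simp add: algebra_simps)
qed

text \<open>As a prefix of a power of d, the walk t can be continued by some r to that power, which
  returns to w. By \<open>V_proj_G\<close>, w is congruent to t r times its ghost; compressing this
  between the ghost of t and t gives the congruence for u.\<close>

lemma walk_return:
  assumes t: "awalk w t u" "V u \<notin> P"
  obtains r where "awalk u r w" "V u - pe r * V w * ge r \<in> G"
proof -
  have "prefix t (concat (replicate (length t) d))"
    using prefix_replicate_long[OF unique[OF t] d(2)] by simp
  then obtain r where r: "concat (replicate (length t) d) = t @ r" by (auto simp: prefix_def)
  have tr: "awalk w (t @ r) w" using awalk_replicate[OF d(1)] r by metis
  then have ur: "awalk u r w" using t by (metis awalk_appendE awalk_unique_end)
  have "(V u * ge t) * (V w - pe (t @ r) * V w * ge (t @ r)) * (pe t * V u) \<in> G"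
    using V_proj_G[OF tr w(2)] t by (intro idl_left[OF G] idl_right[OF G] ge_L pe_L)
  also have "(V u * ge t) * (V w - pe (t @ r) * V w * ge (t @ r)) * (pe t * V u)
    = V u * (ge t * (V w * (pe t * V u)))
      - V u * (ge t * pe (t @ r) * V w) * ge (t @ r) * pe t * V u"
    by (simp only: right_diff_distrib left_diff_distrib mult.assoc)
  also have "V u * (ge t * (V w * (pe t * V u))) = V u"
    unfolding V_pe_V[OF t(1)] using ge_pe[OF t(1)] V_V awalk_last_in_verts[OF t(1)] by (simp add: mult.assoc)
  also have "V u * (ge t * pe (t @ r) * V w) * ge (t @ r) * pe t * V u
    = V u * (pe r * V w) * ge (t @ r) * pe t * V u"
    unfolding ge_pe_append[OF t(1) ur] ..
  also have "\<dots> = pe r * (V w * ge (t @ r) * pe t) * V u"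
    unfolding V_pe_V[OF ur] by (simp add: mult.assoc)
  also have "\<dots> = pe r * V w * ge r"
    unfolding ge_append_pe[OF t(1) ur] using V_ge_V[OF ur] by (simp add: mult.assoc)
  finally show ?thesis using that ur by blast
qed

section \<open>The corner at the vertex of the cycle\<close>

definition loop_monomials :: "'a set" where
  "loop_monomials = {pe r * V w * ge s | r s. awalk w r w \<and> awalk w s w}"

text \<open>A monomial whose middle vertex y lies in P belongs to \<open>G\<close>. Otherwise y is
  replaced by a return path s times its ghost, which closes both paths of the monomial at w.\<close>

lemma Mon_corner:
  assumes m: "m \<in> Mon"
  shows "\<exists>y\<in>span loop_monomials. V w * m * V w - y \<in> G"
proof -
  obtain p r u u' y where m: "awalk u p y" "awalk u' r y" "m = pe p * V y * ge r" using m by (elim MonE)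
  have "V w * m * V w = V w * (pe p * V y) * (V y * ge r) * V w"
    using V_V[of y] awalk_last_in_verts[OF m(1)] m(3) by (metis mult.assoc)
  also have "\<dots> = (V w * V u) * (pe p * V y) * (V y * ge r) * (V u' * V w)"
    using V_pe_V[OF m(1)] V_ge_V[OF m(2)] by (metis mult.assoc)
  finally have eq: "V w * m * V w = (V w * V u) * (pe p * V y) * (V y * ge r) * (V u' * V w)" .
  show ?thesis
  proof (cases "u = w \<and> u' = w")
    case False
    then have "V w * m * V w = 0"
      unfolding eq using V_mult w awalk_hd_in_verts[OF m(1)] awalk_hd_in_verts[OF m(2)] by auto
    then show ?thesis using idl_zero[OF G] by (intro bexI[of _ 0] span_zero) simp
  next
    case True
    then have m': "awalk w p y" "awalk w r y" using m by auto
    have eq': "V w * m * V w = m"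
      using m(3) V_pe_V[OF m'(1)] V_ge_V[OF m'(2)] by (metis mult.assoc)
    have y: "y \<in> verts E" using m awalk_last_in_verts by blast
    have m_eq: "m = (pe p * V y) * V y * (V y * ge r)" using m(3) V_V[OF y] by (metis mult.assoc)
    show ?thesis
    proof (cases "V y \<in> P")
      case True
      then have "V y \<in> G" using T_G V_T y by blast
      then have "m \<in> G" unfolding m_eq using m by (intro idl_left[OF G] idl_right[OF G] pe_L ge_L)
      then show ?thesis using eq' span_zero by (intro bexI[of _ 0]) auto
    next
      case False
      then obtain s where s: "awalk y s w" "V y - pe s * V w * ge s \<in> G" using walk_return m'(1) by blast
      have "(pe p * V y) * (V y - pe s * V w * ge s) * (V y * ge r) \<in> G"
        using s m by (intro idl_left[OF G] idl_right[OF G] pe_L ge_L)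
      also have "(pe p * V y) * (V y - pe s * V w * ge s) * (V y * ge r)
        = m - pe p * (V y * (pe s * V w)) * (ge s * V y) * ge r"
        unfolding m_eq by (simp add: right_diff_distrib left_diff_distrib mult.assoc)
      also have "pe p * (V y * (pe s * V w)) * (ge s * V y) * ge r = pe (p @ s) * V w * ge (r @ s)"
        unfolding V_pe_V[OF s(1)] using V_ge_V[OF s(1)] by (simp add: mult.assoc)
      finally have "m - pe (p @ s) * V w * ge (r @ s) \<in> G" .
      moreover have "pe (p @ s) * V w * ge (r @ s) \<in> loop_monomials"
        unfolding loop_monomials_def using awalk_appendI[OF m'(1) s(1)] awalk_appendI[OF m'(2) s(1)] by blast
      ultimately show ?thesis using eq' span_base by metis
    qed
  qed
qed

lemma corner:
  assumes "x \<in> L"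
  shows "\<exists>y\<in>span loop_monomials. V w * x * V w - y \<in> G"
  using assms unfolding L_def
proof induct
  case span_zero
  then show ?case using idl_zero[OF G] span.span_zero by (intro bexI[of _ 0]) auto
next
  case (span_step m x c)
  then obtain y z where yz: "y \<in> span loop_monomials" "V w * x * V w - y \<in> G" "z \<in> span loop_monomials" "V w * m * V w - z \<in> G"
    using Mon_corner by blast
  have "sc c * (V w * m * V w - z) + (V w * x * V w - y) \<in> G"
    using yz by (intro idl_add[OF G] idl_scale[OF G])
  also have "sc c * (V w * m * V w - z) + (V w * x * V w - y) = V w * (sc c * m + x) * V w - (sc c * z + y)"
    by (simp add: algebra_simps sc_left_commute)
  finally show ?case using yz by (intro bexI[of _ "sc c * z + y"] span_add span_scale)
qed

text \<open>Both lists are walks from w to w of the same length, and walks from w ending outside P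
  are comparable.\<close>

lemma closed_commute:
  assumes "awalk w r w" "awalk w s w"
  shows "r @ s = s @ r"
proof -
  have "awalk w (r @ s) w" "awalk w (s @ r) w" using assms by (auto intro: awalk_appendI)
  then have "prefix (r @ s) (s @ r)" using w(2) by (intro walks_comparable) auto
  then obtain z where z: "s @ r = (r @ s) @ z" by (auto simp: prefix_def)
  then have "length z = 0" by (metis add_cancel_right_right add.commute length_append)
  then show ?thesis using z by simp
qed

lemma pe_closed_mult: "awalk w r w \<Longrightarrow> awalk w s w \<Longrightarrow> (pe r * V w) * (pe s * V w) = pe (r @ s) * V w"
  using V_pe_V[of w s w] by (simp add: mult.assoc)

lemma ge_closed_mult: "awalk w r w \<Longrightarrow> awalk w s w \<Longrightarrow> (V w * ge r) * (V w * ge s) = V w * ge (s @ r)"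
  using V_ge_V[of w r w] by (simp add: mult.assoc[symmetric])

lemma ge_pe_closed: "awalk w s w \<Longrightarrow> (V w * ge s) * (pe s * V w) = V w"
  using ge_pe[of w s w] V_V[OF w(1)] by (simp add: mult.assoc)

lemma pe_ge_closed: "awalk w s w \<Longrightarrow> (pe s * V w) * (V w * ge s) - V w \<in> G"
  using V_proj_G[of s w] w(2) V_V[OF w(1)] idl_uminus[OF G, of "V w - pe s * V w * ge s"]
  by (simp add: mult.assoc) (metis mult.assoc)

text \<open>Modulo \<open>G\<close> the ghost of s is the inverse of s in the corner, and r commutes
  with s by \<open>closed_commute\<close>; hence it commutes with the inverse.\<close>

lemma comm_pe_ge:
  assumes r: "awalk w r w" and s: "awalk w s w"
  shows "comm_mod G (pe r * V w) (V w * ge s)"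
proof -
  let ?p = "pe r * V w" and ?p' = "pe s * V w" and ?g' = "V w * ge s"
  have "V w * ?p = ?p" using V_pe_V[OF r] .
  then have "?p * ?g' = (?g' * ?p') * ?p * ?g'" unfolding ge_pe_closed[OF s] by (simp add: mult.assoc)
  also have "\<dots> = ?g' * (?p' * ?p) * ?g'" by (simp only: mult.assoc)
  also have "?p' * ?p = ?p * ?p'"
    unfolding pe_closed_mult[OF r s] pe_closed_mult[OF s r] closed_commute[OF r s] ..
  finally have 1: "?p * ?g' = ?g' * ?p * (?p' * ?g')" by (simp only: mult.assoc)
  have "?g' * ?p * V w = ?g' * ?p" using V_V[OF w(1)] by (simp add: mult.assoc)
  then have "?p * ?g' - ?g' * ?p = ?g' * ?p * (?p' * ?g' - V w)"
    unfolding 1 by (simp only: right_diff_distrib)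
  also have "\<dots> \<in> G" using pe_ge_closed[OF s] r s by (intro idl_left[OF G] mult_L pe_L ge_L)
  finally show ?thesis unfolding comm_mod_def .
qed

lemma comm_loop_monomials:
  assumes "a \<in> loop_monomials" "b \<in> loop_monomials"
  shows "comm_mod G a b"
proof -
  \<comment> \<open>Reduces the first argument to a path and a ghost path. It is applied to each
    argument in turn, with \<open>comm_mod_sym\<close> in between.\<close>
  have *: "comm_mod G a b"
    if a: "a \<in> loop_monomials" and b: "b \<in> L" "\<And>r. awalk w r w \<Longrightarrow> comm_mod G (pe r * V w) b"
      "\<And>r. awalk w r w \<Longrightarrow> comm_mod G (V w * ge r) b" for a b
  proof -
    obtain r s where rs: "awalk w r w" "awalk w s w" "a = pe r * V w * ge s" using a unfolding loop_monomials_def by blast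
    have "comm_mod G ((pe r * V w) * (V w * ge s)) b"
      by (rule comm_mod_mult[OF G pe_L[OF rs(1)] ge_L[OF rs(2)] b(2)[OF rs(1)] b(3)[OF rs(2)]])
    moreover have "(pe r * V w) * (V w * ge s) = a" using rs V_V[OF w(1)] by (metis mult.assoc)
    ultimately show ?thesis by simp
  qed
  have zero: "comm_mod G x y" if "x * y = y * x" for x y
    using that idl_zero[OF G] by (simp add: comm_mod_def)
  have bL: "b \<in> L"
  proof -
    obtain r s where "awalk w r w" "awalk w s w" "b = pe r * V w * ge s" using assms(2) unfolding loop_monomials_def by blast
    then show ?thesis using MonI Mon_L by blast
  qed
  show ?thesis
  proof (rule *[OF assms(1) bL])
    fix r assume r: "awalk w r w"
    have pe: "comm_mod G (pe s * V w) (pe r * V w)" if "awalk w s w" for s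
      using that r by (intro zero) (simp add: pe_closed_mult closed_commute[OF r] del: pe_simps)
    have ge: "comm_mod G (V w * ge s) (V w * ge r)" if "awalk w s w" for s
      using that r by (intro zero) (simp add: ge_closed_mult closed_commute[OF r] del: ge_simps)
    show "comm_mod G (pe r * V w) b"
      by (rule comm_mod_sym[OF G], rule *[OF assms(2) pe_L[OF r] pe], assumption,
          rule comm_mod_sym[OF G comm_pe_ge[OF r]])
    show "comm_mod G (V w * ge r) b"
      by (rule comm_mod_sym[OF G], rule *[OF assms(2) ge_L[OF r] comm_pe_ge[OF _ r]], assumption, rule ge)
  qed
qed

lemma corner_commute:
  assumes "x \<in> L" "y \<in> L"
  shows "comm_mod G (V w * x * V w) (V w * y * V w)"
proof -
  obtain x' where x': "x' \<in> span loop_monomials" "V w * x * V w - x' \<in> G" using corner[OF assms(1)] by blast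
  obtain y' where y': "y' \<in> span loop_monomials" "V w * y * V w - y' \<in> G" using corner[OF assms(2)] by blast
  have "loop_monomials \<subseteq> L" unfolding loop_monomials_def using MonI Mon_L by blast
  then have ClL: "span loop_monomials \<subseteq> L" by (rule idl_span[OF idl_whole])
  have yL: "V w * y * V w \<in> L" using assms w by (intro mult_L V_L)
  have "comm_mod G s y'" if "s \<in> loop_monomials" for s
    using that comm_loop_monomials comm_mod_span[OF G y'(1)] comm_mod_sym[OF G] by blast
  then have "comm_mod G x' y'" using comm_mod_span[OF G x'(1)] by blast
  then have "comm_mod G y' x'" by (rule comm_mod_sym[OF G])
  then have "comm_mod G (V w * y * V w) x'" using comm_mod_cong[OF G y'(2)] x'(1) ClL by blast
  then have "comm_mod G x' (V w * y * V w)" by (rule comm_mod_sym[OF G])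
  then show ?thesis using comm_mod_cong[OF G x'(2) yL] by blast
qed

text \<open>Primeness yields a monomial m with a m w outside P. Its ghost part starts at w, so its
  middle vertex y is reached from w and lies outside P. Replacing y by a return path s times its
  ghost shows that a p s stays outside P, where p is the path part of m.\<close>

lemma prime_connect:
  assumes a: "a \<in> L" "a \<notin> P"
  obtains u s where "awalk u s w" "a * (pe s * V w) \<notin> P"
proof -
  have "\<exists>x\<in>L. a * x * V w \<notin> P"
    using prime_idl_elem[OF prime a(1) V_L[OF w(1)]] a(2) w(2) by blast
  then obtain x where x: "x \<in> span Mon" "a * x * V w \<notin> P" unfolding L_def by blast
  have "\<exists>m\<in>Mon. a * m * V w \<notin> P"
  proof (rule ccontr)
    assume "\<not> (\<exists>m\<in>Mon. a * m * V w \<notin> P)"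
    then have *: "a * (m * V w) \<in> P" if "m \<in> Mon" for m using that by (simp add: mult.assoc)
    have "a * (x * V w) \<in> P" using x(1)
      by induct (auto simp: distrib_right distrib_left mult.assoc sc_left_commute
          intro: idl_zero[OF P] idl_add[OF P] idl_scale[OF P] *)
    then show False using x(2) by (simp add: mult.assoc)
  qed
  then obtain m where m: "m \<in> Mon" "a * m * V w \<notin> P" by blast
  then obtain p r u u' y where y: "awalk u p y" "awalk u' r y" "m = pe p * V y * ge r" by (elim MonE)
  have yv: "y \<in> verts E" using y awalk_last_in_verts by blast
  have ay: "a * (pe p * V y) \<notin> P"
  proof
    assume "a * (pe p * V y) \<in> P"
    then have "a * (pe p * V y) * ((V y * ge r) * V w) \<in> P"
      by (rule idl_right[OF P mult_L[OF ge_L[OF y(2)] V_L[OF w(1)]]])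
    moreover have "a * (pe p * V y) * ((V y * ge r) * V w) = a * m * V w"
      using y(3) V_V[OF yv] by (metis mult.assoc)
    ultimately show False using m by simp
  qed
  have "u' = w"
  proof (rule ccontr)
    assume "u' \<noteq> w"
    have "V y * ge r * V w = (V y * ge r) * (V u' * V w)" using V_ge_V[OF y(2)] by (metis mult.assoc)
    then have "V y * ge r * V w = 0" using \<open>u' \<noteq> w\<close> V_mult w awalk_hd_in_verts[OF y(2)] by simp
    then have "a * m * V w = 0" using y(3) by (simp add: mult.assoc)
    then show False using m idl_zero[OF P] by simp
  qed
  have "V y \<notin> P"
    using ay idl_left[OF P mult_L[OF a(1) pe_L[OF y(1)]], of "V y"] V_V[OF yv] by (auto simp: mult.assoc)
  then obtain s where s: "awalk y s w" "V y - pe s * V w * ge s \<in> G"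
    using walk_return y(2) \<open>u' = w\<close> by blast
  have "a * (pe (p @ s) * V w) \<notin> P"
  proof
    assume *: "a * (pe (p @ s) * V w) \<in> P"
    have "a * (pe p * V y) * (V y - pe s * V w * ge s) \<in> P"
      using s(2) G_P a y by (intro idl_left[OF P] mult_L pe_L) auto
    moreover have "a * (pe (p @ s) * V w) * (V w * ge s) \<in> P"
      by (rule idl_right[OF P ge_L[OF s(1)] *])
    moreover have "a * (pe p * V y) * (V y - pe s * V w * ge s) + a * (pe (p @ s) * V w) * (V w * ge s)
      = a * (pe p * (V y * V y)) - a * (pe p * (V y * (pe s * V w)) * ge s) + a * (pe p * pe s * (V w * V w) * ge s)"
      by (simp add: right_diff_distrib mult.assoc)
    moreover have "\<dots> = a * (pe p * V y)"
      unfolding V_pe_V[OF s(1)] V_V[OF yv] V_V[OF w(1)] by (simp add: mult.assoc)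
    ultimately show False using ay idl_add[OF P] by metis
  qed
  then show ?thesis using that awalk_appendI[OF y(1) s(1)] by blast
qed

text \<open>Otherwise \<open>reduction\<close> gives a combination of closed paths at some u outside
  ?N, and u is connected to w, which lies in ?N. The combination is conjugated along the connecting
  path up to the edge e by which it first enters ?N. A nontrivial closed path that survives would
  end with e and lead from inside ?N back to the source of e outside ?N, against heredity. Only the
  constant term is left, so P contains the end of e and with it w.\<close>

lemma P_subset: "P \<subseteq> gid (insert (V w) (P \<inter> T))"
proof (rule ccontr)
  let ?N = "gid (insert (V w) (P \<inter> T))"
  have SL: "insert (V w) (P \<inter> T) \<subseteq> L" using T_L V_L w by blast
  have N: "idl ?N" by (rule gid_idl[OF SL])
  assume "\<not> P \<subseteq> ?N"
  then obtain u B l where u: "u \<in> verts E" "V u \<notin> ?N" "loop_sum P u B l"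
    using reduction[OF P N] gid_base[OF SL] by (metis subsetI insertCI)
  then have "V u \<notin> P" using gid_base[OF SL] V_T by blast
  then obtain u' s where s: "awalk u' s w" "V u * (pe s * V w) \<notin> P" using prime_connect V_L u(1) by blast
  have "u' = u"
  proof (rule ccontr)
    assume "u' \<noteq> u"
    have "V u * (pe s * V w) = (V u * V u') * (pe s * V w)" using V_pe_V[OF s(1)] by (simp add: mult.assoc)
    then have "V u * (pe s * V w) = 0" using \<open>u' \<noteq> u\<close> V_mult u(1) awalk_hd_in_verts[OF s(1)] by auto
    then show False using s(2) idl_zero[OF P] by simp
  qed
  moreover have "V w \<in> ?N" using gid_base[OF SL] by blast
  ultimately obtain p1 e p2 where e: "s = p1 @ e # p2" "V (tail E e) \<notin> ?N" "V (head E e) \<in> ?N"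
    using first_entry[of u s w ?N] s(1) u(2) by blast
  have walks: "awalk u p1 (tail E e)" "awalk (head E e) p2 w" "e \<in> arcs E"
    using s(1) \<open>u' = u\<close> e(1) by (auto elim!: awalk_appendE simp: awalk_Cons_iff)
  have p1e: "awalk u (p1 @ [e]) (head E e)"
    using walks arc_implies_awalk[of e] by (blast intro: awalk_appendI)
  have B: "finite B" "[] \<in> B" "l [] \<noteq> 0" "\<And>p. p \<in> B \<Longrightarrow> awalk u p u" "psum B l u \<in> P"
    using u(3) by (auto simp: loop_sum_def)
  let ?B' = "{r. \<exists>p\<in>B. p @ (p1 @ [e]) = (p1 @ [e]) @ r}"
  have ls': "loop_sum P (head E e) ?B' (\<lambda>r. l (take (length r) ((p1 @ [e]) @ r)))"
    using B(5) by (intro loop_sum_conj[where A = B and k = l and w = u, OF P B(1-4) p1e] idl_right[OF P pe_L[OF p1e]])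
  have "r = []" if r: "r \<in> ?B'" for r
  proof (rule ccontr)
    assume "r \<noteq> []"
    then obtain r' f where r': "r = r' @ [f]" by (cases r rule: rev_cases) auto
    obtain p where p: "p \<in> B" "p @ p1 @ [e] = (p1 @ [e]) @ r" using r by auto
    then have eq: "p @ p1 = (p1 @ [e]) @ r'" using r' by simp
    have "awalk u (p @ p1) (tail E e)" using B(4)[OF p(1)] walks(1) by (rule awalk_appendI)
    then have "awalk (head E e) r' (tail E e)"
      unfolding eq using p1e by (metis awalk_appendE awalk_unique_end)
    then show False using V_hereditary[OF N] e by blast
  qed
  then have "q (head E e) {} \<in> P"
    using walks(3) by (intro loop_sum_q[OF P ls']) auto
  then have "V (head E e) \<in> P" by simp
  then show False using V_hereditary[OF P walks(2)] w(2) by blast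
qed

text \<open>On a nonempty path t acts as 0 or as 1. Once t fixes a path to w, that path and its
  ghost carry t to the vertex w.\<close>

lemma V_in_gid:
  assumes t: "t \<in> T" "t \<notin> P"
  shows "V w \<in> gid {t}"
proof -
  obtain x F where x: "t = q x F" "x \<in> verts E" "finite F" "F \<subseteq> out_arcs E x" using t by (auto simp: T_def)
  have tL: "t \<in> L" using t T_L by blast
  obtain u s where s: "awalk u s w" "t * (pe s * V w) \<notin> P" using prime_connect[OF tL t(2)] by blast
  \<comment> \<open>Appending d makes the path nonempty. Since w is d times its ghost modulo
    \<open>G\<close>, the product with t remains nonzero.\<close>
  have sd: "awalk u (s @ d) w" using s(1) d(1) by (rule awalk_appendI)
  have "t * pe (s @ d) \<noteq> 0"
  proof
    assume *: "t * pe (s @ d) = 0"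
    have "t * (pe s * V w) * (V w - pe d * V w * ge d) \<in> P"
      using V_proj_G[OF d(1) w(2)] G_P s(1) tL by (intro idl_left[OF P] mult_L pe_L) auto
    also have "t * (pe s * V w) * (V w - pe d * V w * ge d)
      = t * (pe s * (V w * V w)) - t * (pe s * (V w * (pe d * V w)) * ge d)"
      by (simp add: right_diff_distrib mult.assoc)
    also have "\<dots> = t * (pe s * V w) - t * pe (s @ d) * (V w * ge d)"
      unfolding V_pe_V[OF d(1)] V_V[OF w(1)] by (simp add: mult.assoc)
    finally show False using * s(2) by simp
  qed
  then have ts: "t * pe (s @ d) = pe (s @ d)"
    using q_pe[OF x(2-4) sd] d(2) x(1) by (auto split: if_splits)
  have "(V w * ge (s @ d)) * t * (pe (s @ d) * V w) \<in> gid {t}"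
    using gid_base[of "{t}" t] tL sd by (intro idl_left[OF gid_idl] idl_right[OF gid_idl] ge_L pe_L) auto
  also have "(V w * ge (s @ d)) * t * (pe (s @ d) * V w) = V w * (ge (s @ d) * (t * pe (s @ d)) * V w)"
    by (simp only: mult.assoc)
  also have "\<dots> = V w" unfolding ts ge_pe[OF sd] by (rule V_V[OF w(1)])
  finally show ?thesis .
qed

end

context leavitt_family begin

section \<open>Polynomials evaluated at a closed path\<close>

definition ev :: "'v \<Rightarrow> 'e list \<Rightarrow> 'k poly \<Rightarrow> 'a" where
  "ev w c f = fold_coeffs (\<lambda>a x. sc a * V w + pe c * x) f 0"

lemma ev_0 [simp]: "ev w c 0 = 0"
  by (simp add: ev_def)

lemma ev_pCons: "ev w c (pCons a f) = sc a * V w + pe c * ev w c f"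
proof (cases "f = 0")
  case True
  then show ?thesis by (cases "a = 0") (simp_all add: ev_def sc_zero)
qed (simp add: ev_def)

lemma ev_add: "ev w c (f + g) = ev w c f + ev w c g"
proof (induct f g rule: poly_induct2)
  case (pCons a f b g)
  have "ev w c (pCons a f + pCons b g) = sc (a + b) * V w + pe c * ev w c (f + g)"
    by (simp add: ev_pCons)
  then show ?case unfolding pCons ev_pCons sc_add distrib_left distrib_right by (simp add: ac_simps)
qed simp

lemma ev_smult: "ev w c (smult a f) = sc a * ev w c f"
  by (induct f) (simp_all add: ev_pCons sc_mult distrib_left sc_left_commute[of "pe _"] mult.assoc)

lemma ev_sum: "ev w c (sum f A) = (\<Sum>i\<in>A. ev w c (f i))"
  by (induct A rule: infinite_finite_induct) (simp_all add: ev_add)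

lemma ev_monom: "ev w c (monom a n) = sc a * (pe (concat (replicate n c)) * V w)"
  by (induct n) (simp_all add: monom_0 monom_Suc ev_pCons sc_left_commute[of "pe _"] sc_zero mult.assoc)

context
  fixes w c
  assumes c: "awalk w c w" "c \<noteq> []"
begin

lemma V_ev: "V w * ev w c f = ev w c f"
proof (induct f)
  case (pCons a f)
  have "V w * (pe c * ev w c f) = pe c * ev w c f"
    using pe_V_nonempty(1)[OF c] by (simp add: mult.assoc[symmetric])
  then show ?case
    using V_V[OF awalk_hd_in_verts[OF c(1)]] by (simp add: ev_pCons distrib_left sc_left_commute[of "V w"])
qed simp

lemma ev_V: "ev w c f * V w = ev w c f"
  by (induct f) (use V_V[OF awalk_hd_in_verts[OF c(1)]] in \<open>simp_all add: ev_pCons distrib_right mult.assoc\<close>)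

lemma ev_L: "ev w c f \<in> L"
proof (induct f)
  case (pCons a f)
  then show ?case unfolding ev_pCons
    using c by (intro add_L sc_L V_L pe_mult_L[OF c(1)] awalk_hd_in_verts[OF c(1)])
qed (simp add: zero_L)

text \<open>Constants are sent to multiples of \<open>V w\<close>, not of the ambient 1, and
  \<open>V w\<close> acts as the identity on all values.\<close>

lemma ev_mult: "ev w c (f * g) = ev w c f * ev w c g"
  by (induct f) (use V_ev in \<open>simp_all add: ev_pCons ev_add ev_smult sc_zero distrib_right mult.assoc\<close>)

end

end

context nongraded_prime begin

text \<open>By comparability a shortest nonempty closed walk is a prefix of every nonempty closed
  walk; removing it leaves a shorter closed walk.\<close>

lemma cycle_generator:
  obtains c where "awalk w c w" "c \<noteq> []" "\<And>r. awalk w r w \<Longrightarrow> \<exists>n. r = concat (replicate n c)"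
proof -
  obtain c where c: "awalk w c w" "c \<noteq> []" "\<And>r. awalk w r w \<Longrightarrow> r \<noteq> [] \<Longrightarrow> length c \<le> length r"
    using ex_has_least_nat[of "\<lambda>r. awalk w r w \<and> r \<noteq> []" d length] d by blast
  have "\<exists>n. r = concat (replicate n c)" if "awalk w r w" for r
    using that
  proof (induct "length r" arbitrary: r rule: less_induct)
    case less
    show ?case
    proof (cases "r = []")
      case True
      then show ?thesis by (intro exI[of _ 0]) simp
    next
      case False
      then have "prefix c r" using c w(2) less.prems by (intro walks_comparable) auto
      then obtain s where s: "r = c @ s" by (auto simp: prefix_def)
      then have "awalk w s w" using c(1) less.prems by (metis awalk_appendE awalk_unique_end)
      moreover have "length s < length r" using s c(2) by simp
      ultimately obtain n where "s = concat (replicate n c)" using less.hyps by blast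
      then show ?thesis using s by (intro exI[of _ "Suc n"]) simp
    qed
  qed
  then show ?thesis using that c by blast
qed

text \<open>Compressed to the corner, x can be moved past the value of f modulo \<open>G\<close>. So
  f x g lies in P as soon as f g does, and elementwise primeness applies.\<close>

lemma prime_ev:
  assumes c: "awalk w c w" "c \<noteq> []" and fg: "ev w c f * ev w c g \<in> P"
  shows "ev w c f \<in> P \<or> ev w c g \<in> P"
proof (rule prime_idl_elem[OF prime ev_L[OF c] ev_L[OF c]])
  fix x assume x: "x \<in> L"
  let ?f = "ev w c f" and ?g = "ev w c g" and ?x = "V w * x * V w"
  have xL: "?x \<in> L" using x w by (intro mult_L V_L)
  have "?f * ?x - ?x * ?f \<in> G"
    using corner_commute[OF ev_L[OF c] x, of f] unfolding comm_mod_def V_ev[OF c] ev_V[OF c] .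
  then have "(?f * ?x - ?x * ?f) * ?g \<in> P" using G_P ev_L[OF c] by (intro idl_right[OF P]) auto
  moreover have "?x * (?f * ?g) \<in> P" by (rule idl_left[OF P xL fg])
  ultimately have "(?f * ?x - ?x * ?f) * ?g + ?x * (?f * ?g) \<in> P" by (rule idl_add[OF P])
  also have "(?f * ?x - ?x * ?f) * ?g + ?x * (?f * ?g) = (?f * V w) * x * (V w * ?g)"
    by (simp add: left_diff_distrib mult.assoc)
  finally show "?f * x * ?g \<in> P" unfolding V_ev[OF c] ev_V[OF c] .
qed

text \<open>Evaluation at the cycle makes the corner at \<^term>\<open>w\<close> a field modulo \<^term>\<open>P\<close>.\<close>

lemma V_in_ideal_above:
  assumes c: "awalk w c w" "c \<noteq> []" and p0: "p0 \<noteq> 0" "ev w c p0 \<in> P"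
    and K: "idl K" "P \<subseteq> K" and f: "ev w c f \<in> K" "ev w c f \<notin> P"
  shows "V w \<in> K"
proof -
  have f0: "f \<noteq> 0" using f(2) idl_zero[OF P] by auto
  \<comment> \<open>By division with remainder, h generates the ideal of all polynomials with value
    in K.\<close>
  obtain h where h: "h \<noteq> 0" "ev w c h \<in> K" "\<And>g. g \<noteq> 0 \<Longrightarrow> ev w c g \<in> K \<Longrightarrow> degree h \<le> degree g"
    using ex_has_least_nat[of "\<lambda>g. g \<noteq> 0 \<and> ev w c g \<in> K" f degree] f0 f(1) by blast
  have dvd: "h dvd g" if g: "ev w c g \<in> K" for g
  proof (rule ccontr)
    assume "\<not> h dvd g"
    then have "g mod h \<noteq> 0" by (simp add: dvd_eq_mod_eq_0)
    have "ev w c g = ev w c (h * (g div h) + g mod h)" by simp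
    also have "\<dots> = ev w c h * ev w c (g div h) + ev w c (g mod h)"
      by (simp only: ev_add ev_mult[OF c])
    finally have "ev w c (g mod h) = ev w c g - ev w c h * ev w c (g div h)" by simp
    also have "\<dots> \<in> K" using g h(2) ev_L[OF c] by (intro idl_diff[OF K(1)] idl_right[OF K(1)])
    finally have "degree h \<le> degree (g mod h)" using h(3) \<open>g mod h \<noteq> 0\<close> by blast
    then show False using degree_mod_less[OF h(1), of g] \<open>g mod h \<noteq> 0\<close> by simp
  qed
  have hP: "ev w c h \<notin> P"
  proof
    assume "ev w c h \<in> P"
    moreover obtain g where "f = h * g" using dvd[OF f(1)] by (rule dvdE)
    ultimately have "ev w c f \<in> P" using ev_L[OF c] by (simp add: ev_mult[OF c] idl_right[OF P])
    then show False using f(2) by simp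
  qed
  obtain p where p: "p \<noteq> 0" "ev w c p \<in> P" "\<And>g. g \<noteq> 0 \<Longrightarrow> ev w c g \<in> P \<Longrightarrow> degree p \<le> degree g"
    using ex_has_least_nat[of "\<lambda>g. g \<noteq> 0 \<and> ev w c g \<in> P" p0 degree] p0 by blast
  \<comment> \<open>In p = h g the value of h is outside P, so that of g is in P. Minimality of the
    degree of p then forces h to be constant.\<close>
  have "h dvd p" using dvd p(2) K(2) by blast
  then obtain g where g: "p = h * g" by (rule dvdE)
  then have "ev w c g \<in> P" using p(2) hP prime_ev[OF c, of h g] by (simp add: ev_mult[OF c])
  moreover have g0: "g \<noteq> 0" using p(1) g by auto
  ultimately have "degree p \<le> degree g" using p(3) by blast
  then have "degree h = 0" using g g0 h(1) by (simp add: degree_mult_eq)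
  then obtain a where a: "h = [:a:]" by (metis degree_eq_zeroE)
  then have "sc a * V w \<in> K" using h(2) by (simp add: ev_pCons)
  then show ?thesis by (rule idl_descale[OF K(1)]) (use a h(1) in auto)
qed

text \<open>An element of J outside P is moved into the corner by multiplications that keep it
  outside P. A high power of the cycle clears its ghosts, so that modulo \<open>G\<close> it becomes
  a polynomial in the cycle, and \<open>V_in_ideal_above\<close> applies with K = J + P.\<close>

lemma V_in_plus:
  assumes J: "idl J" "\<not> J \<subseteq> P"
  shows "V w \<in> J + P"
proof -
  obtain c where c: "awalk w c w" "c \<noteq> []" and powers: "\<And>r. awalk w r w \<Longrightarrow> \<exists>n. r = concat (replicate n c)"
    by (rule cycle_generator) blast
  have A: "finite A" "[] \<in> A" "k [] \<noteq> 0" "\<And>p. p \<in> A \<Longrightarrow> awalk w p w" "psum A k w \<in> P"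
    using ls by (auto simp: loop_sum_def)
  obtain \<nu> where \<nu>: "\<And>r. awalk w r w \<Longrightarrow> r = concat (replicate (\<nu> r) c)" using powers by metis
  define p0 where "p0 = (\<Sum>r\<in>A. monom (k r) (\<nu> r))"
  have "ev w c p0 = psum A k w"
    unfolding p0_def psum_def ev_sum ev_monom using A(4) \<nu> by (intro sum.cong) auto
  then have evp0: "ev w c p0 \<in> P" using A(5) by simp
  \<comment> \<open>The empty closed walk is the only one with exponent 0, so the constant
    coefficient is the nonzero \<open>k []\<close>.\<close>
  have "coeff p0 0 = (\<Sum>r\<in>A. if r = [] then k [] else 0)"
    unfolding p0_def coeff_sum
  proof (rule sum.cong)
    fix r assume "r \<in> A"
    then have r: "r = concat (replicate (\<nu> r) c)" using \<nu> A(4) by blast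
    have "\<nu> r = 0 \<longleftrightarrow> r = []"
      by (subst (2) r) (use c(2) in \<open>auto simp: gr0_conv_Suc neq0_conv[symmetric] simp del: neq0_conv\<close>)
    then show "coeff (monom (k r) (\<nu> r)) 0 = (if r = [] then k [] else 0)" by auto
  qed simp
  also have "\<dots> = k []" using A(1,2) by simp
  finally have "p0 \<noteq> 0" using A(3) by auto
  obtain j where j: "j \<in> J" "j \<notin> P" "j \<in> L" using J idl_L by blast
  obtain u s where s: "awalk u s w" "j * (pe s * V w) \<notin> P" using prime_connect j by blast
  have jsL: "j * (pe s * V w) \<in> L" using j s by (intro mult_L pe_L)
  obtain x where x: "x \<in> L" "V w * x * (j * (pe s * V w)) \<notin> P"
    using prime_idl_elem[OF prime V_L[OF w(1)] jsL] w(2) s(2) by blast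
  define b where "b = V w * x * (j * (pe s * V w))"
  have "b \<in> J"
    unfolding b_def using x j s w by (intro idl_left[OF J(1)] idl_right[OF J(1)] mult_L V_L pe_L)
  have "b \<notin> P" using x(2) by (simp add: b_def)
  have bV: "b * V w = b" using V_V[OF w(1)] by (simp add: b_def mult.assoc)
  obtain y where y: "y \<in> span loop_monomials" "b - y \<in> G"
  proof -
    have "V w * (x * (j * (pe s * V w))) * V w = b" using V_V[OF w(1)] by (simp add: b_def mult.assoc)
    then show ?thesis using corner[OF mult_L[OF x(1) jsL]] that by auto
  qed
  \<comment> \<open>The claim covers all large n, since a single power of the cycle has to clear the
    ghosts of all terms of y.\<close>
  have "\<exists>N. \<forall>n\<ge>N. y * (pe (concat (replicate n c)) * V w) \<in> range (ev w c)"
    using y(1)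
  proof induct
    case span_zero
    then show ?case using ev_0[of w c] by (auto intro: range_eqI[of _ _ 0])
  next
    case (span_step z y a)
    then obtain N where N: "\<And>n. n \<ge> N \<Longrightarrow> y * (pe (concat (replicate n c)) * V w) \<in> range (ev w c)" by blast
    obtain r s where rs: "awalk w r w" "awalk w s w" "z = pe r * V w * ge s" using span_step(1) unfolding loop_monomials_def by blast
    show ?case
    proof (intro exI[of _ "max N (\<nu> s)"] allI impI)
      fix n assume n: "max N (\<nu> s) \<le> n"
      then have split: "concat (replicate n c) = s @ concat (replicate (n - \<nu> s) c)"
        by (subst \<nu>[OF rs(2)]) (simp add: concat_append[symmetric] replicate_add[symmetric] del: concat_append)
      have t: "awalk w (concat (replicate (n - \<nu> s) c)) w" by (rule awalk_replicate[OF c(1)])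
      have "z * (pe (concat (replicate n c)) * V w) = pe r * V w * (ge s * pe (s @ concat (replicate (n - \<nu> s) c)) * V w)"
        unfolding split rs(3) by (simp add: mult.assoc)
      also have "\<dots> = pe r * (V w * (pe (concat (replicate (n - \<nu> s) c)) * V w))"
        unfolding ge_pe_append[OF rs(2) t] by (simp only: mult.assoc)
      also have "\<dots> = pe (r @ concat (replicate (n - \<nu> s) c)) * V w"
        unfolding V_pe_V[OF t] by (simp add: mult.assoc)
      also have "r @ concat (replicate (n - \<nu> s) c) = concat (replicate (\<nu> r + (n - \<nu> s)) c)"
        by (subst \<nu>[OF rs(1)]) (simp add: replicate_add)
      also have "pe (concat (replicate (\<nu> r + (n - \<nu> s)) c)) * V w = ev w c (monom 1 (\<nu> r + (n - \<nu> s)))"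
        by (simp add: ev_monom sc_one)
      finally have z: "z * (pe (concat (replicate n c)) * V w) = ev w c (monom 1 (\<nu> r + (n - \<nu> s)))" .
      obtain g where g: "y * (pe (concat (replicate n c)) * V w) = ev w c g" using N[of n] n by auto
      have "(sc a * z + y) * (pe (concat (replicate n c)) * V w) = ev w c (smult a (monom 1 (\<nu> r + (n - \<nu> s))) + g)"
        using z g by (simp add: distrib_right mult.assoc ev_add ev_smult)
      then show "(sc a * z + y) * (pe (concat (replicate n c)) * V w) \<in> range (ev w c)" by blast
    qed
  qed
  then obtain n f where nf: "y * (pe (concat (replicate n c)) * V w) = ev w c f" by blast
  define t where "t = concat (replicate n c)"
  have t: "awalk w t w" unfolding t_def by (rule awalk_replicate[OF c(1)])
  have diff: "b * (pe t * V w) - ev w c f \<in> P"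
    using idl_right[OF G pe_L[OF t] y(2)] G_P nf by (auto simp: t_def left_diff_distrib)
  \<comment> \<open>Multiplication by t is reversible modulo P, because w is t times its ghost
    modulo \<open>G\<close>.\<close>
  have bt: "b * (pe t * V w) \<notin> P"
  proof
    assume *: "b * (pe t * V w) \<in> P"
    have "b * (V w - pe t * V w * ge t) \<in> P"
      using V_proj_G[OF t w(2)] G_P \<open>b \<in> J\<close> J idl_L by (intro idl_left[OF P]) auto
    moreover have "b * (pe t * V w) * (V w * ge t) \<in> P" by (rule idl_right[OF P ge_L[OF t] *])
    moreover have "b * (V w - pe t * V w * ge t) + b * (pe t * V w) * (V w * ge t)
      = b * V w - b * (pe t * V w * ge t) + b * (pe t * (V w * V w) * ge t)"
      by (simp add: right_diff_distrib mult.assoc)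
    moreover have "\<dots> = b" unfolding V_V[OF w(1)] bV by simp
    ultimately show False using \<open>b \<notin> P\<close> idl_add[OF P] by metis
  qed
  have K: "idl (J + P)" "P \<subseteq> J + P" "J \<subseteq> J + P"
    using idl_plus[OF J(1) P] subset_plus_left[OF P] subset_plus_right[OF J(1)] by blast+
  have evK: "ev w c f \<in> J + P"
  proof -
    have "b * (pe t * V w) \<in> J" by (rule idl_right[OF J(1) pe_L[OF t] \<open>b \<in> J\<close>])
    then have "b * (pe t * V w) - (b * (pe t * V w) - ev w c f) \<in> J + P"
      by (rule idl_diff[OF K(1) subsetD[OF K(3)] subsetD[OF K(2) diff]])
    then show ?thesis by simp
  qed
  have evP: "ev w c f \<notin> P"
    using bt idl_add[OF P diff, of "ev w c f"] by auto
  show ?thesis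
    by (rule V_in_ideal_above[OF c \<open>p0 \<noteq> 0\<close> evp0 K(1,2) evK evP])
qed

end

context leavitt_family begin

lemma prime_structure:
  assumes prime: "prime_idl P" and "\<not> P \<subseteq> gid (P \<inter> T)"
  obtains w where "w \<in> verts E" "V w \<notin> P" "P \<subseteq> gid (insert (V w) (P \<inter> T))"
    "\<And>t. t \<in> T \<Longrightarrow> t \<notin> P \<Longrightarrow> V w \<in> gid {t}"
    "\<And>J. idl J \<Longrightarrow> \<not> J \<subseteq> P \<Longrightarrow> V w \<in> J + P"
    "\<And>x y. x \<in> L \<Longrightarrow> y \<in> L \<Longrightarrow> comm_mod (gid (P \<inter> T)) (V w * x * V w) (V w * y * V w)"
proof -
  obtain w A k d where "w \<in> verts E" "V w \<notin> P" "loop_sum P w A k" "awalk w d w" "d \<noteq> []"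
    "\<And>t u. awalk w t u \<Longrightarrow> V u \<notin> P \<Longrightarrow> prefix t (d @ t)"
    using loop_sum_minimal[OF prime_idl_idl[OF prime] assms(2)] by blast
  then interpret nongraded_prime E sc V Ed Gh P w A k d
    using prime by unfold_locales auto
  show ?thesis
    by (rule that[OF w P_subset V_in_gid V_in_plus]) (auto intro: corner_commute[unfolded G_def])
qed

text \<open>Elements of I and J have units in ?N, and these are sums of terms x w y up to elements
  of \<open>gid S\<close>. Inserting units before, between and after a and b leads to products with
  w in all three places, where the commutative corner swaps the factors. Errors in
  \<open>gid S\<close> are harmless: it is idempotent, hence contained in J I.\<close>

lemma iprod_subset_swap:
  assumes S: "S \<subseteq> T" and w: "w \<in> verts E" and I: "idl I" and J: "idl J"
    and sub: "gid S \<subseteq> I" "gid S \<subseteq> J" "I \<subseteq> gid (insert (V w) S)" "J \<subseteq> gid (insert (V w) S)"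
    and comm: "\<And>x y. x \<in> L \<Longrightarrow> y \<in> L \<Longrightarrow> comm_mod (gid S) (V w * x * V w) (V w * y * V w)"
  shows "I \<bullet> J \<subseteq> J \<bullet> I"
proof (rule iprod_leastI)
  let ?N = "gid (insert (V w) S)"
  have SL: "S \<subseteq> L" using S T_L by blast
  have G: "idl (gid S)" by (rule gid_idl[OF SL])
  have N: "s_unital ?N" using S V_T w by (intro s_unital_gid) auto
  have M: "idl (J \<bullet> I)" by (rule idl_iprod[OF J I])
  have GM: "gid S \<subseteq> J \<bullet> I"
    using s_unital_iprod_left[OF s_unital_gid[OF S] G] iprod_mono[OF sub(2,1)] by simp
  \<comment> \<open>Admitting 1 for a and b lets a unit be inserted at either end of a
    product.\<close>
  have through_V: "a * u * b \<in> J \<bullet> I"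
    if u: "u \<in> ?N" and ab: "a \<in> insert 1 L" "b \<in> insert 1 L"
      and *: "\<And>x y. x \<in> L \<Longrightarrow> y \<in> L \<Longrightarrow> a * x * V w * y * b \<in> J \<bullet> I" for a u b
    using u unfolding gid_def
  proof induct
    case span_zero
    then show ?case using idl_zero[OF M] by simp
  next
    case (span_step s v c)
    then obtain x s' y where s: "x \<in> L" "s' \<in> insert (V w) S" "y \<in> L" "s = x * s' * y" by blast
    have "a * s * b \<in> J \<bullet> I"
    proof (cases "s' = V w")
      case False
      then have "s \<in> gid S"
        using s gid_base[OF SL] by (auto intro!: idl_right[OF G s(3)] idl_left[OF G s(1)])
      then have "a * s * b \<in> gid S" using ab idl_left[OF G] idl_right[OF G] by auto
      then show ?thesis using GM by blast
    qed (use s * in \<open>simp add: mult.assoc\<close>)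
    then have "sc c * (a * s * b) + a * v * b \<in> J \<bullet> I"
      using span_step by (intro idl_add[OF M] idl_scale[OF M])
    then show ?case by (simp add: distrib_left distrib_right sc_left_commute mult.assoc)
  qed
  fix a b assume a: "a \<in> I" and b: "b \<in> J"
  note aL = idl_L[OF I] and bL = idl_L[OF J]
  \<comment> \<open>Here the corner commutes. The three occurrences of w are then removed by
    inserting units: on the right, in the middle, on the left.\<close>
  have 1: "V w * a * V w * b * V w \<in> J \<bullet> I" if a: "a \<in> I" and b: "b \<in> J" for a b
  proof -
    have "(V w * a * V w) * (V w * b * V w) - (V w * b * V w) * (V w * a * V w) \<in> J \<bullet> I"
      using comm[OF aL[OF a] bL[OF b]] GM unfolding comm_mod_def by blast
    moreover have "(V w * b * V w) * (V w * a * V w) \<in> J \<bullet> I"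
      using a b w by (intro iprod.prod idl_left[OF I] idl_right[OF I] idl_left[OF J] idl_right[OF J] V_L)
    ultimately have "(V w * a * V w) * (V w * b * V w) \<in> J \<bullet> I" using idl_add[OF M] by fastforce
    also have "(V w * a * V w) * (V w * b * V w) = V w * a * (V w * V w) * b * V w" by (simp add: mult.assoc)
    finally show ?thesis unfolding V_V[OF w] .
  qed
  have 2: "V w * a * V w * b \<in> J \<bullet> I" if a: "a \<in> I" and b: "b \<in> J" for a b
  proof -
    obtain u where u: "u \<in> ?N" "b * u = b" using s_unital_right_unit[OF N] b sub(4) by blast
    have zL: "V w * a * V w * b \<in> L" by (intro mult_L V_L[OF w] aL[OF a] bL[OF b])
    have "(V w * a * V w * b) * u * 1 \<in> J \<bullet> I"
    proof (rule through_V[OF u(1)])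
      fix x y assume xy: "x \<in> L" "y \<in> L"
      have "V w * a * V w * (b * x) * V w * y \<in> J \<bullet> I"
        by (rule idl_right[OF M xy(2) 1[OF a idl_right[OF J xy(1) b]]])
      then show "(V w * a * V w * b) * x * V w * y * 1 \<in> J \<bullet> I" by (simp add: mult.assoc)
    qed (use zL in auto)
    then show ?thesis using u(2) by (simp add: mult.assoc)
  qed
  have 3: "V w * a * b \<in> J \<bullet> I" if a: "a \<in> I" and b: "b \<in> J" for a b
  proof -
    obtain u where u: "u \<in> ?N" "a * u = a" using s_unital_right_unit[OF N] a sub(3) by blast
    have "V w * a * u * b \<in> J \<bullet> I"
    proof (rule through_V[OF u(1)])
      fix x y assume xy: "x \<in> L" "y \<in> L"
      show "V w * a * x * V w * y * b \<in> J \<bullet> I"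
        using 2[OF idl_right[OF I xy(1) a] idl_left[OF J xy(2) b]] by (simp add: mult.assoc)
    qed (use mult_L[OF V_L[OF w] aL[OF a]] bL[OF b] in auto)
    moreover have "V w * a * u = V w * a" using u(2) by (simp add: mult.assoc)
    ultimately show ?thesis by simp
  qed
  obtain u where u: "u \<in> ?N" "u * a = a" using s_unital_left_unit[OF N] a sub(3) by blast
  have "1 * u * (a * b) \<in> J \<bullet> I"
  proof (rule through_V[OF u(1)])
    fix x y assume xy: "x \<in> L" "y \<in> L"
    show "1 * x * V w * y * (a * b) \<in> J \<bullet> I"
      using idl_left[OF M xy(1) 3[OF idl_left[OF I xy(2) a] b]] by (simp add: mult.assoc)
  qed (use mult_L[OF aL[OF a] bL[OF b]] in auto)
  then show "a * b \<in> J \<bullet> I" using u(2) by (simp add: mult.assoc[symmetric])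
qed (rule iprod.add)

section \<open>Separation of distinct primes\<close>

lemma separated_between:
  assumes A: "idl A" and B: "idl B" and N: "s_unital N" "A \<subseteq> N" "N \<subseteq> B"
  shows "separated A B"
proof -
  have "A \<bullet> B = A" "B \<bullet> A = A"
    using iprod_subset_left[OF A B] iprod_subset_right[OF B A] iprod_mono[OF order_refl N(3), of A] iprod_mono[OF N(3) order_refl, of A]
      s_unital_iprod_right[OF N(1) A] s_unital_iprod_left[OF N(1) A] N(2) by auto
  moreover have "N \<subseteq> A + B" using N(3) subset_plus_right[OF A] by blast
  ultimately show ?thesis unfolding separated_def using A B N by blast
qed

lemma separated_s_unital:
  assumes A: "s_unital A" and B: "idl B"
  shows "separated A B"
  unfolding separated_def
  using s_unital_iprod_left[OF A B] s_unital_iprod_right[OF A B] A B subset_plus_left[OF B, of A]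
  by (auto dest: s_unital_idl)

text \<open>An x in A \<inter> B is m x + n x with m in M and n in N. Here m x lies in M B, which
  equals B M because M has local units, hence in both A B and B A; likewise n x. So both products
  equal the intersection.\<close>

lemma separated_plus:
  assumes A: "idl A" and B: "idl B" and M: "s_unital M" "M \<subseteq> A" and N: "s_unital N" "N \<subseteq> B"
    and sub: "A \<inter> B \<subseteq> M + N" and u: "s_unital (M + N)"
  shows "separated A B"
proof -
  have "A \<inter> B \<subseteq> A \<bullet> B \<and> A \<inter> B \<subseteq> B \<bullet> A"
  proof -
    have "x \<in> A \<bullet> B \<and> x \<in> B \<bullet> A" if x: "x \<in> A \<inter> B" for x
    proof -
      obtain u where "u \<in> M + N" "u * x = x" using s_unital_left_unit[OF u] sub x by blast
      then obtain m n where mn: "m \<in> M" "n \<in> N" "x = m * x + n * x"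
        by (auto elim!: set_plus_elim simp: distrib_right)
      have m: "m * x \<in> M \<bullet> B" "n * x \<in> N \<bullet> A" using mn x by (auto intro: iprod.prod)
      moreover have "M \<bullet> B = B \<bullet> M" "N \<bullet> A = A \<bullet> N"
        using s_unital_iprod_left s_unital_iprod_right M(1) N(1) A B by metis+
      moreover have "M \<bullet> B \<subseteq> A \<bullet> B" "B \<bullet> M \<subseteq> B \<bullet> A" "N \<bullet> A \<subseteq> B \<bullet> A" "A \<bullet> N \<subseteq> A \<bullet> B"
        using iprod_mono[OF M(2) order_refl] iprod_mono[OF order_refl M(2)]
          iprod_mono[OF N(2) order_refl] iprod_mono[OF order_refl N(2)] by blast+
      ultimately have "m * x \<in> A \<bullet> B" "n * x \<in> A \<bullet> B" "m * x \<in> B \<bullet> A" "n * x \<in> B \<bullet> A" by auto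
      then show ?thesis using mn(3) iprod.add by metis
    qed
    then show ?thesis by blast
  qed
  then have "A \<bullet> B = B \<bullet> A"
    using iprod_subset_left[OF A B] iprod_subset_right[OF A B] iprod_subset_left[OF B A] iprod_subset_right[OF B A]
    by blast
  moreover have "M + N \<subseteq> A + B" using M(2) N(2) by (rule set_plus_mono2)
  ultimately show ?thesis unfolding separated_def using A B u sub by blast
qed

lemma separated_primes_neq:
  assumes P: "prime_idl P" "\<not> P \<subseteq> gid (P \<inter> T)" and Q: "prime_idl Q" "\<not> Q \<subseteq> gid (Q \<inter> T)"
    and neq: "\<not> Q \<inter> T \<subseteq> P"
  shows "separated P Q"
proof -
  note iP = prime_idl_idl[OF P(1)] and iQ = prime_idl_idl[OF Q(1)]
  \<comment> \<open>The ideal of an element t of Q \<inter> T outside P contains the cycle vertex w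
    of P. So w, and with it P, lies in the ideal generated by the idempotents of both
    primes.\<close>
  have absorb: "P \<subseteq> gid (P \<inter> T \<union> Q \<inter> T)" if P: "prime_idl P" "\<not> P \<subseteq> gid (P \<inter> T)" and neq: "\<not> Q \<inter> T \<subseteq> P" for P Q
  proof -
    obtain w where w: "P \<subseteq> gid (insert (V w) (P \<inter> T))" "\<And>t. t \<in> T \<Longrightarrow> t \<notin> P \<Longrightarrow> V w \<in> gid {t}"
      using prime_structure[OF P] by metis
    obtain t where t: "t \<in> Q" "t \<in> T" "t \<notin> P" using neq by blast
    have SL: "P \<inter> T \<union> Q \<inter> T \<subseteq> L" using T_L by blast
    have "gid {t} \<subseteq> gid (P \<inter> T \<union> Q \<inter> T)"
      using t gid_base[OF SL] by (intro gid_least gid_idl[OF SL]) auto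
    then have "gid (insert (V w) (P \<inter> T)) \<subseteq> gid (P \<inter> T \<union> Q \<inter> T)"
      using w(2)[OF t(2,3)] gid_base[OF SL] by (intro gid_least gid_idl[OF SL]) auto
    then show ?thesis using w(1) by blast
  qed
  have PN: "P \<subseteq> gid (P \<inter> T \<union> Q \<inter> T)" by (rule absorb[OF P neq])
  show ?thesis
  proof (cases "P \<inter> T \<subseteq> Q")
    case True
    then have "P \<inter> T \<union> Q \<inter> T = Q \<inter> T" by blast
    moreover have "gid (Q \<inter> T) \<subseteq> Q" by (rule gid_least[OF iQ]) blast
    ultimately show ?thesis
      using PN by (intro separated_between[OF iP iQ s_unital_gid[of "Q \<inter> T"]]) auto
  next
    case False
    have "gid (P \<inter> T \<union> Q \<inter> T) = gid (P \<inter> T) + gid (Q \<inter> T)"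
      using T_L by (intro gid_Un) blast+
    moreover have "s_unital (gid (P \<inter> T \<union> Q \<inter> T))" by (rule s_unital_gid) blast
    ultimately show ?thesis
      using PN by (intro separated_plus[OF iP iQ, of "gid (P \<inter> T)" "gid (Q \<inter> T)"] s_unital_gid gid_least iP iQ) auto
  qed
qed

lemma separated_primes_eq:
  assumes P: "prime_idl P" "\<not> P \<subseteq> gid (P \<inter> T)" and Q: "prime_idl Q" "\<not> Q \<subseteq> gid (Q \<inter> T)"
    and eq: "P \<inter> T = Q \<inter> T" and QP: "\<not> Q \<subseteq> P"
  shows "separated P Q"
proof -
  note iP = prime_idl_idl[OF P(1)] and iQ = prime_idl_idl[OF Q(1)]
  obtain w where w: "w \<in> verts E" "V w \<notin> P" "P \<subseteq> gid (insert (V w) (P \<inter> T))"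
    and plus: "\<And>J. idl J \<Longrightarrow> \<not> J \<subseteq> P \<Longrightarrow> V w \<in> J + P"
    and comm: "\<And>x y. x \<in> L \<Longrightarrow> y \<in> L \<Longrightarrow> comm_mod (gid (P \<inter> T)) (V w * x * V w) (V w * y * V w)"
    using prime_structure[OF P] by metis
  obtain u where u: "Q \<subseteq> gid (insert (V u) (Q \<inter> T))" "\<And>t. t \<in> T \<Longrightarrow> t \<notin> Q \<Longrightarrow> V u \<in> gid {t}"
    using prime_structure[OF Q] by metis
  let ?S = "P \<inter> T" and ?N = "gid (insert (V w) (P \<inter> T))"
  have S: "?S \<subseteq> T" "insert (V w) ?S \<subseteq> T" using V_T w by auto
  have NL: "insert (V w) ?S \<subseteq> L" using S(2) T_L by blast
  \<comment> \<open>The vertex w is an element of \<open>T\<close> outside P, so it is also outside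
    Q. Hence its ideal contains the cycle vertex u of Q, and one vertex serves both primes.\<close>
  have "V w \<in> T" "V w \<notin> Q" using V_T w eq by blast+
  then have "V u \<in> gid {V w}" by (rule u(2))
  moreover have "gid {V w} \<subseteq> ?N" using gid_base[OF NL] by (intro gid_least gid_idl[OF NL]) auto
  ultimately have "gid (insert (V u) (Q \<inter> T)) \<subseteq> ?N"
    using gid_base[OF NL] eq by (intro gid_least gid_idl[OF NL]) auto
  then have QN: "Q \<subseteq> ?N" using u(1) by blast
  have "gid ?S \<subseteq> P" by (rule gid_least[OF iP]) blast
  moreover have "gid ?S \<subseteq> Q" unfolding eq by (rule gid_least[OF iQ]) blast
  ultimately have GP: "gid ?S \<subseteq> P" "gid ?S \<subseteq> Q" .
  have "P \<bullet> Q = Q \<bullet> P"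
    using iprod_subset_swap[OF S(1) w(1) iP iQ GP w(3) QN comm]
      iprod_subset_swap[OF S(1) w(1) iQ iP GP(2,1) QN w(3) comm] by blast
  moreover have "s_unital ?N" by (rule s_unital_gid[OF S(2)])
  moreover have "?N \<subseteq> P + Q"
  proof (rule gid_least[OF idl_plus[OF iP iQ]])
    have "V w \<in> P + Q" using plus[OF iQ QP] by (simp add: add.commute)
    then show "insert (V w) ?S \<subseteq> P + Q" using subset_plus_left[OF iQ, of P] by blast
  qed
  ultimately show ?thesis unfolding separated_def using iP iQ w(3) by blast
qed

lemma separated_primes:
  assumes P: "prime_idl P" and Q: "prime_idl Q" and neq: "P \<noteq> Q"
  shows "separated P Q"
proof -
  note iP = prime_idl_idl[OF P] and iQ = prime_idl_idl[OF Q]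
  have graded: "s_unital P" if "idl P" "P \<subseteq> gid (P \<inter> T)" for P
    using that gid_least[OF that(1), of "P \<inter> T"] s_unital_gid[of "P \<inter> T"] by (simp add: subset_antisym)
  show ?thesis
  proof (cases "P \<subseteq> gid (P \<inter> T)")
    case True
    then show ?thesis using separated_s_unital graded iP iQ by blast
  next
    case nP: False
    show ?thesis
    proof (cases "Q \<subseteq> gid (Q \<inter> T)")
      case True
      then show ?thesis using separated_sym separated_s_unital graded iP iQ by blast
    next
      case nQ: False
      show ?thesis
      proof (cases "P \<inter> T = Q \<inter> T")
        case True
        then show ?thesis
          using separated_primes_eq[OF P nP Q nQ] separated_sym[OF separated_primes_eq[OF Q nQ P nP]] neq by blast
      next
        case False
        then show ?thesis
          using separated_primes_neq[OF P nP Q nQ] separated_sym[OF separated_primes_neq[OF Q nQ P nP]] by blast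
      qed
    qed
  qed
qed

lemma iprod_list_prime_powers:
  assumes "m > 0" "\<And>i. i \<in> {1..m} \<Longrightarrow> r i > 0" "\<And>i. i \<in> {1..m} \<Longrightarrow> prime_idl (P i)" "inj_on P {1..m}"
  shows "iprod_list (map (\<lambda>i. ipower (P i) (r i)) [1..<Suc m]) = (\<Inter>i\<in>{1..m}. ipower (P i) (r i))"
proof -
  have "separated (ipower (P i) (r i)) (ipower (P j) (r j))" if "i \<in> {1..m}" "j \<in> {1..m}" "i < j" for i j
    using that assms by (intro separated_powers separated_primes) (auto dest: inj_onD)
  then have "sorted_wrt separated (map (\<lambda>i. ipower (P i) (r i)) [1..<Suc m])"
    unfolding sorted_wrt_map by (intro sorted_wrt_mono_rel[OF _ sorted_wrt_upt]) auto
  then have "iprod_list (map (\<lambda>i. ipower (P i) (r i)) [1..<Suc m])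
    = \<Inter> (set (map (\<lambda>i. ipower (P i) (r i)) [1..<Suc m]))"
    using assms(1) by (intro iprod_list_eq_Inter) auto
  also have "set (map (\<lambda>i. ipower (P i) (r i)) [1..<Suc m]) = (\<lambda>i. ipower (P i) (r i)) ` {1..m}" by auto
  finally show ?thesis .
qed

end

section \<open>The algebra as a subring of a ring type\<close>

text \<open>Keeping w in the support of a lets conditions on the words of a be used in the induction
  step.\<close>

lemma poly_mapping_monomial_induct:
  assumes "P 0" and "\<And>w c f. w \<in> Poly_Mapping.keys a \<Longrightarrow> P f \<Longrightarrow> P (Poly_Mapping.single w c + f)"
  shows "P (a :: 'x \<Rightarrow>\<^sub>0 'c::comm_monoid_add)"
proof -
  have "Poly_Mapping.keys f \<subseteq> Poly_Mapping.keys a \<Longrightarrow> P f" for f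
  proof (induct f rule: update_induct)
    case const
    then show ?case by (simp add: assms(1))
  next
    case (update f w c)
    have eq: "Poly_Mapping.update w c f = Poly_Mapping.single w c + f"
      using update(1) by (intro poly_mapping_eqI) (auto simp: lookup_update lookup_add lookup_single when_def in_keys_iff)
    have "Poly_Mapping.keys (Poly_Mapping.update w c f) = insert w (Poly_Mapping.keys f)"
      using update(2) by (simp add: keys_update)
    then have "w \<in> Poly_Mapping.keys a" "Poly_Mapping.keys f \<subseteq> Poly_Mapping.keys a"
      using update(4) by auto
    then show ?case unfolding eq using update(3) by (intro assms(2))
  qed
  then show ?thesis by blast
qed

lemma single_0_central: "a * Poly_Mapping.single 0 c = Poly_Mapping.single 0 c * (a :: 'x::monoid_add \<Rightarrow>\<^sub>0 'k::field)"
  by (induct a rule: poly_mapping_monomial_induct)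
    (simp_all add: distrib_left distrib_right mult_single mult.commute)

definition free_unital :: "('v, 'e) pre_digraph \<Rightarrow> ('v, 'e, 'k::field) free_alg set" where
  "free_unital E = {a. \<forall>w \<in> Poly_Mapping.keys a. set (letters w) \<subseteq> generators E}"

lemma letters_plus [simp]: "letters (u + w) = letters u @ letters w"
  by (simp add: plus_free_word_def)

lemma letters_zero [simp]: "letters 0 = []"
  by (simp add: zero_free_word_def)

lemma free_unital_zero: "0 \<in> free_unital E"
  and free_unital_one: "1 \<in> free_unital E"
  by (simp_all add: free_unital_def)

lemma free_unital_single: "set (letters w) \<subseteq> generators E \<Longrightarrow> Poly_Mapping.single w c \<in> free_unital E"
  by (simp add: free_unital_def)

lemma free_unital_add: "a \<in> free_unital E \<Longrightarrow> b \<in> free_unital E \<Longrightarrow> a + b \<in> free_unital E"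
  unfolding free_unital_def using Poly_Mapping.keys_add[of a b] by blast

lemma free_unital_uminus: "a \<in> free_unital E \<Longrightarrow> - a \<in> free_unital E"
  by (simp add: free_unital_def)

lemma free_unital_mult: "a \<in> free_unital E \<Longrightarrow> b \<in> free_unital E \<Longrightarrow> a * b \<in> free_unital E"
  unfolding free_unital_def using keys_mult[of a b] by fastforce

abbreviation free_nonunital :: "('v, 'e) pre_digraph \<Rightarrow> ('v, 'e, 'k::field) free_alg set" where
  "free_nonunital E \<equiv> carrier (free_algebra E)"

lemma carrier_free_algebra:
  "free_nonunital E = {a. \<forall>w \<in> Poly_Mapping.keys a. letters w \<noteq> [] \<and> set (letters w) \<subseteq> generators E}"
  by (simp add: free_algebra_def)

lemma free_algebra_mult: "x \<otimes>\<^bsub>free_algebra E\<^esub> y = x * y"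
  by (simp add: free_algebra_def)

lemma free_algebra_add: "x \<oplus>\<^bsub>free_algebra E\<^esub> y = x + y"
  by (simp add: free_algebra_def)

text \<open>Lets the relation ideal absorb the unital free algebra: the constant acts by
  \<open>scale\<close>, and the rest is a multiplier that its closure clauses admit.\<close>

lemma free_unital_split:
  assumes "c \<in> free_unital E"
  obtains a k where "a \<in> free_nonunital E" "c = Poly_Mapping.single 0 k + a"
proof -
  define a where "a = c - Poly_Mapping.single 0 (Poly_Mapping.lookup c 0)"
  have "letters w \<noteq> [] \<and> set (letters w) \<subseteq> generators E" if "w \<in> Poly_Mapping.keys a" for w
  proof -
    have "Poly_Mapping.lookup a w \<noteq> 0" using that by (simp add: in_keys_iff)
    then have "w \<noteq> 0" "Poly_Mapping.lookup c w \<noteq> 0"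
      by (auto simp: a_def lookup_minus lookup_single when_def split: if_splits)
    then have "letters w \<noteq> []" "w \<in> Poly_Mapping.keys c"
      by (auto simp: in_keys_iff zero_free_word_def) (metis free_word.collapse)
    then show ?thesis using assms by (auto simp: free_unital_def)
  qed
  then have "a \<in> free_nonunital E" by (simp add: carrier_free_algebra)
  then show ?thesis using that[of a "Poly_Mapping.lookup c 0"] by (simp add: a_def)
qed

lemma carrier_zero: "0 \<in> free_nonunital E"
  by (simp add: carrier_free_algebra)

lemma carrier_add: "a \<in> free_nonunital E \<Longrightarrow> b \<in> free_nonunital E \<Longrightarrow> a + b \<in> free_nonunital E"
  unfolding carrier_free_algebra using Poly_Mapping.keys_add[of a b] by blast

lemma carrier_uminus: "a \<in> free_nonunital E \<Longrightarrow> - a \<in> free_nonunital E"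
  by (simp add: carrier_free_algebra)

lemma carrier_diff: "a \<in> free_nonunital E \<Longrightarrow> b \<in> free_nonunital E \<Longrightarrow> a - b \<in> free_nonunital E"
  using carrier_add[of a E "- b"] carrier_uminus[of b E] by simp

lemma carrier_mult: "a \<in> free_nonunital E \<Longrightarrow> b \<in> free_unital E \<Longrightarrow> a * b \<in> free_nonunital E"
  unfolding carrier_free_algebra free_unital_def using keys_mult[of a b] by fastforce

lemma carrier_free_unital: "a \<in> free_nonunital E \<Longrightarrow> a \<in> free_unital E"
  by (auto simp: carrier_free_algebra free_unital_def)

lemma carrier_scale: "a \<in> free_nonunital E \<Longrightarrow> scale c a \<in> free_nonunital E"
  unfolding scale_def using carrier_mult[of a E "Poly_Mapping.single 0 c"] free_unital_single[of 0 E c]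
  by (simp add: single_0_central)

lemma carrier_sum: "(\<And>i. i \<in> I \<Longrightarrow> f i \<in> free_nonunital E) \<Longrightarrow> sum f I \<in> free_nonunital E"
  by (induct I rule: infinite_finite_induct) (auto intro: carrier_zero carrier_add)

lemma gen_carrier: "x \<in> generators E \<Longrightarrow> gen x \<in> free_nonunital E"
  by (simp add: gen_def carrier_free_algebra)

lemma generators_intros:
  "v \<in> verts E \<Longrightarrow> Vertex v \<in> generators E" "e \<in> arcs E \<Longrightarrow> Edge e \<in> generators E"
  "e \<in> arcs E \<Longrightarrow> Ghost e \<in> generators E"
  by (auto simp: generators_def)

lemma (in wf_digraph) relations_carrier:
  assumes "x \<in> lpa_relations G" shows "x \<in> free_nonunital G"
  using assms
proof cases
  case (CK2 v)
  then show ?thesis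
    by (auto simp: regular_vertex_def intro!: carrier_diff carrier_sum carrier_mult gen_carrier
        carrier_free_unital generators_intros)
qed (auto intro!: carrier_diff carrier_mult gen_carrier carrier_free_unital generators_intros carrier_zero)

lemma (in wf_digraph) relation_ideal_carrier:
  assumes "x \<in> relation_ideal G" shows "x \<in> free_nonunital G"
  using assms by induct
    (auto intro: relations_carrier carrier_zero carrier_add carrier_scale carrier_mult carrier_free_unital)

lemma relation_ideal_uminus: "x \<in> relation_ideal E \<Longrightarrow> - x \<in> relation_ideal E"
  using relation_ideal.scale[of x E "- 1"] by (simp add: scale_def single_uminus)

lemma relation_ideal_diff: "x \<in> relation_ideal E \<Longrightarrow> y \<in> relation_ideal E \<Longrightarrow> x - y \<in> relation_ideal E"
  using relation_ideal.add[of x E "- y"] relation_ideal_uminus[of y E] by simp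

lemma relation_ideal_left: "c \<in> free_unital E \<Longrightarrow> x \<in> relation_ideal E \<Longrightarrow> c * x \<in> relation_ideal E"
  by (elim free_unital_split)
    (auto simp: distrib_right scale_def[symmetric] intro: relation_ideal.intros)

lemma relation_ideal_right: "c \<in> free_unital E \<Longrightarrow> x \<in> relation_ideal E \<Longrightarrow> x * c \<in> relation_ideal E"
  by (elim free_unital_split)
    (auto simp: distrib_left single_0_central scale_def[symmetric] intro: relation_ideal.intros)

subsection \<open>A ring type containing all Leavitt path algebras\<close>

text \<open>
  The product over all graphs \<open>E\<close> of the unitized algebras \<open>L\<^sub>K(E)\<close>: a quotient type may not
  depend on the variable \<open>E\<close>, and in this product the defining relations of each factor become
  equations in a type of class \<^class>\<open>ring_1\<close>. Ill-formed graphs contribute the free unital algebra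
  modulo the zero ideal.
\<close>

definition rel_ideal :: "('v, 'e) pre_digraph \<Rightarrow> ('v, 'e, 'k::field) free_alg set" where
  "rel_ideal E = (if wf_digraph E then relation_ideal E else {0})"

lemma rel_ideal_closed:
  "0 \<in> rel_ideal E"
  "x \<in> rel_ideal E \<Longrightarrow> - x \<in> rel_ideal E"
  "x \<in> rel_ideal E \<Longrightarrow> y \<in> rel_ideal E \<Longrightarrow> x + y \<in> rel_ideal E"
  "c \<in> free_unital E \<Longrightarrow> x \<in> rel_ideal E \<Longrightarrow> c * x \<in> rel_ideal E"
  "c \<in> free_unital E \<Longrightarrow> x \<in> rel_ideal E \<Longrightarrow> x * c \<in> rel_ideal E"
  by (auto simp: rel_ideal_def relation_ideal_uminus relation_ideal_left relation_ideal_right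
      intro: relation_ideal.intros split: if_splits)

text \<open>The empty word does not occur in elements of the relation ideal of a well-formed graph.
  This gives 0 \<noteq> 1 in the ring type.\<close>

lemma one_notin_rel_ideal: "1 \<notin> rel_ideal E"
  using wf_digraph.relation_ideal_carrier[of E 1]
  by (auto simp: rel_ideal_def carrier_free_algebra)

text \<open>The relation is partial: only families whose component at each E uses generators of E
  are represented, so each component is a quotient of the right free algebra.\<close>

definition lpa_rel ::
  "(('v, 'e) pre_digraph \<Rightarrow> ('v, 'e, 'k::field) free_alg) \<Rightarrow> (('v, 'e) pre_digraph \<Rightarrow> ('v, 'e, 'k) free_alg) \<Rightarrow> bool" where
  "lpa_rel f g \<longleftrightarrow> (\<forall>E. f E \<in> free_unital E \<and> g E \<in> free_unital E \<and> f E - g E \<in> rel_ideal E)"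

lemma lpa_rel_part_equivp: "part_equivp lpa_rel"
proof (rule part_equivpI)
  show "\<exists>f. lpa_rel f f"
    by (rule exI[of _ "\<lambda>_. 0"]) (simp add: lpa_rel_def free_unital_zero rel_ideal_closed)
  show "symp lpa_rel"
    by (rule sympI) (metis lpa_rel_def minus_diff_eq rel_ideal_closed(2))
  show "transp lpa_rel"
  proof (rule transpI)
    fix f g h assume "lpa_rel f g" "lpa_rel g h"
    then have "f E - h E \<in> rel_ideal E" for E
      using rel_ideal_closed(3)[of "f E - g E" E "g E - h E"] by (simp add: lpa_rel_def)
    then show "lpa_rel f h" using \<open>lpa_rel f g\<close> \<open>lpa_rel g h\<close> by (simp add: lpa_rel_def)
  qed
qed

quotient_type (overloaded) ('v, 'e, 'k) lpa_product =
  "('v, 'e) pre_digraph \<Rightarrow> ('v, 'e, 'k::field) free_alg" / partial: lpa_rel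
  by (rule lpa_rel_part_equivp)

instantiation lpa_product :: (type, type, field) ring_1
begin

lift_definition zero_lpa_product :: "('a, 'b, 'c) lpa_product" is "\<lambda>_. 0"
  by (simp add: lpa_rel_def free_unital_zero rel_ideal_closed)

lift_definition one_lpa_product :: "('a, 'b, 'c) lpa_product" is "\<lambda>_. 1"
  by (simp add: lpa_rel_def free_unital_one rel_ideal_closed)

lift_definition plus_lpa_product :: "('a, 'b, 'c) lpa_product \<Rightarrow> ('a, 'b, 'c) lpa_product \<Rightarrow> ('a, 'b, 'c) lpa_product"
  is "\<lambda>f g E. f E + g E"
proof -
  fix f f' g g' :: "('a, 'b) pre_digraph \<Rightarrow> ('a, 'b, 'c) free_alg"
  assume *: "lpa_rel f f'" "lpa_rel g g'"
  have "f E + g E - (f' E + g' E) \<in> rel_ideal E" for E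
    using * rel_ideal_closed(3)[of "f E - f' E" E "g E - g' E"] by (simp add: lpa_rel_def algebra_simps)
  then show "lpa_rel (\<lambda>E. f E + g E) (\<lambda>E. f' E + g' E)"
    using * by (simp add: lpa_rel_def free_unital_add)
qed

lift_definition uminus_lpa_product :: "('a, 'b, 'c) lpa_product \<Rightarrow> ('a, 'b, 'c) lpa_product"
  is "\<lambda>f E. - f E"
proof -
  fix f f' :: "('a, 'b) pre_digraph \<Rightarrow> ('a, 'b, 'c) free_alg"
  assume *: "lpa_rel f f'"
  have "- f E - (- f' E) = - (f E - f' E)" for E by simp
  then show "lpa_rel (\<lambda>E. - f E) (\<lambda>E. - f' E)"
    using * unfolding lpa_rel_def by (metis free_unital_uminus rel_ideal_closed(2))
qed

lift_definition times_lpa_product :: "('a, 'b, 'c) lpa_product \<Rightarrow> ('a, 'b, 'c) lpa_product \<Rightarrow> ('a, 'b, 'c) lpa_product"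
  is "\<lambda>f g E. f E * g E"
proof -
  fix f f' g g' :: "('a, 'b) pre_digraph \<Rightarrow> ('a, 'b, 'c) free_alg"
  assume *: "lpa_rel f f'" "lpa_rel g g'"
  have "(f E - f' E) * g E + f' E * (g E - g' E) \<in> rel_ideal E" for E
    using * unfolding lpa_rel_def by (intro rel_ideal_closed(3-5)) auto
  then have "f E * g E - f' E * g' E \<in> rel_ideal E" for E
    by (simp add: algebra_simps)
  then show "lpa_rel (\<lambda>E. f E * g E) (\<lambda>E. f' E * g' E)"
    using * by (simp add: lpa_rel_def free_unital_mult)
qed

definition minus_lpa_product :: "('a, 'b, 'c) lpa_product \<Rightarrow> ('a, 'b, 'c) lpa_product \<Rightarrow> ('a, 'b, 'c) lpa_product"
  where "minus_lpa_product x y = x + (- y)"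

instance
proof
  fix a b c :: "('a, 'b, 'c) lpa_product"
  note defs = lpa_rel_def free_unital_add free_unital_mult free_unital_uminus free_unital_zero free_unital_one rel_ideal_closed
  show "a + b + c = a + (b + c)" by transfer (simp add: defs add.assoc)
  show "a + b = b + a" by transfer (simp add: defs add.commute)
  show "0 + a = a" by transfer (simp add: defs)
  show "- a + a = 0" by transfer (simp add: defs)
  show "a - b = a + - b" by (simp add: minus_lpa_product_def)
  show "a * b * c = a * (b * c)" by transfer (simp add: defs mult.assoc)
  show "(a + b) * c = a * c + b * c" by transfer (simp add: defs distrib_right)
  show "a * (b + c) = a * b + a * c" by transfer (simp add: defs distrib_left)
  show "1 * a = a" by transfer (simp add: defs)
  show "a * 1 = a" by transfer (simp add: defs)
  show "(0 :: ('a, 'b, 'c) lpa_product) \<noteq> 1"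
    by transfer (use rel_ideal_closed(2) one_notin_rel_ideal in \<open>force simp: lpa_rel_def\<close>)
qed

end

lemma abs_lpa_product_eq_iff:
  "lpa_rel f f \<Longrightarrow> lpa_rel g g \<Longrightarrow> abs_lpa_product f = abs_lpa_product g \<longleftrightarrow> lpa_rel f g"
  using Quotient_rel[OF Quotient_lpa_product, of f g] by blast

text \<open>Only the component at E is filled, so \<open>factor E\<close> is additive and
  multiplicative but does not send 1 to 1. On the free unital algebra of E its kernel is
  \<open>rel_ideal E\<close>.\<close>

definition factor :: "('v, 'e) pre_digraph \<Rightarrow> ('v, 'e, 'k::field) free_alg \<Rightarrow> ('v, 'e, 'k) lpa_product" where
  "factor E a = abs_lpa_product (\<lambda>E'. if E' = E then a else 0)"

text \<open>A constant family, not one supported at a single graph, so that \<open>scalar 1\<close>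
  is the unit of the ring type.\<close>

definition scalar :: "'k::field \<Rightarrow> ('v, 'e, 'k) lpa_product" where
  "scalar c = abs_lpa_product (\<lambda>E. Poly_Mapping.single 0 c)"

lemma lpa_rel_factor:
  "a \<in> free_unital E \<Longrightarrow> lpa_rel (\<lambda>E'. if E' = E then a else 0) (\<lambda>E'. if E' = E then a else 0)"
  by (simp add: lpa_rel_def free_unital_zero rel_ideal_closed)

lemma lpa_rel_scalar: "lpa_rel (\<lambda>E. Poly_Mapping.single 0 c) (\<lambda>E. Poly_Mapping.single 0 c)"
  by (simp add: lpa_rel_def free_unital_single rel_ideal_closed)

lemma factor_eq_iff:
  assumes "a \<in> free_unital E" "b \<in> free_unital E"
  shows "factor E a = factor E b \<longleftrightarrow> a - b \<in> rel_ideal E"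
  unfolding factor_def abs_lpa_product_eq_iff[OF assms[THEN lpa_rel_factor]]
proof
  assume "lpa_rel (\<lambda>E'. if E' = E then a else 0) (\<lambda>E'. if E' = E then b else 0)"
  then show "a - b \<in> rel_ideal E" unfolding lpa_rel_def by (auto dest: spec[of _ E])
qed (use assms in \<open>simp add: lpa_rel_def free_unital_zero rel_ideal_closed\<close>)

lemma factor_zero: "factor E 0 = 0"
  by (simp add: factor_def zero_lpa_product_def)

lemma factor_add:
  assumes "a \<in> free_unital E" "b \<in> free_unital E"
  shows "factor E (a + b) = factor E a + factor E b"
  unfolding factor_def plus_lpa_product.abs_eq[OF assms[THEN lpa_rel_factor]]
  by (rule arg_cong[of _ _ abs_lpa_product]) auto

lemma factor_mult:
  assumes "a \<in> free_unital E" "b \<in> free_unital E"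
  shows "factor E (a * b) = factor E a * factor E b"
  unfolding factor_def times_lpa_product.abs_eq[OF assms[THEN lpa_rel_factor]]
  by (rule arg_cong[of _ _ abs_lpa_product]) auto

lemma factor_scale:
  assumes "a \<in> free_unital E"
  shows "factor E (scale c a) = scalar c * factor E a"
  unfolding factor_def scalar_def scale_def
    times_lpa_product.abs_eq[OF lpa_rel_scalar lpa_rel_factor[OF assms]]
  by (rule arg_cong[of _ _ abs_lpa_product]) auto

lemma scalar_add: "scalar (c + d) = scalar c + scalar d"
  by (simp add: scalar_def plus_lpa_product.abs_eq[OF lpa_rel_scalar lpa_rel_scalar] single_add)

lemma scalar_mult: "scalar (c * d) = scalar c * scalar d"
  by (simp add: scalar_def times_lpa_product.abs_eq[OF lpa_rel_scalar lpa_rel_scalar] mult_single)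

lemma scalar_one: "scalar 1 = 1"
  by (simp add: scalar_def one_lpa_product_def)

lemma scalar_central: "x * scalar c = scalar c * x"
proof -
  obtain f where f: "lpa_rel f f" "x = abs_lpa_product f"
    using Quotient_abs_rep[OF Quotient_lpa_product, of x] Quotient_rep_reflp[OF Quotient_lpa_product, of x] by metis
  show ?thesis
    by (simp add: f(2) scalar_def times_lpa_product.abs_eq[OF f(1) lpa_rel_scalar]
        times_lpa_product.abs_eq[OF lpa_rel_scalar f(1)] single_0_central)
qed

lemma leavitt_family_factor:
  assumes "wf_digraph E"
  shows "leavitt_family E (scalar :: 'k::field \<Rightarrow> ('v, 'e, 'k) lpa_product)
    (\<lambda>v. factor E (gen (Vertex v))) (\<lambda>e. factor E (gen (Edge e))) (\<lambda>e. factor E (gen (Ghost e)))"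
proof -
  interpret wf_digraph E by fact
  have g: "(gen x :: ('v, 'e, 'k) free_alg) \<in> free_unital E" if "x \<in> generators E" for x
    using that gen_carrier carrier_free_unital by blast
  have rel: "factor E a * factor E b = factor E c"
    if "a * b - c \<in> lpa_relations E" "a \<in> free_unital E" "b \<in> free_unital E" "c \<in> free_unital E"
    for a b c :: "('v, 'e, 'k) free_alg"
    using that assms relation_ideal.rel[of "a * b - c" E]
    by (simp add: factor_mult[symmetric] factor_eq_iff free_unital_mult rel_ideal_def)
  note [intro] = g generators_intros free_unital_zero tail_in_verts head_in_verts
  show ?thesis
  proof (unfold_locales; (rule scalar_add scalar_mult scalar_one scalar_central)?)
    fix v w assume "v \<in> verts E" "w \<in> verts E"
    then show "factor E (gen (Vertex v)) * factor E (gen (Vertex w))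
        = (if v = w then factor E (gen (Vertex v)) else 0 :: ('v, 'e, 'k) lpa_product)"
      using rel[OF lpa_relations.vertices[of v E w]]
      by (auto simp: factor_zero g generators_intros free_unital_zero)
  next
    fix e f assume "e \<in> arcs E" "f \<in> arcs E"
    then show "factor E (gen (Ghost e)) * factor E (gen (Edge f))
        = (if e = f then factor E (gen (Vertex (head E e))) else 0 :: ('v, 'e, 'k) lpa_product)"
      using rel[OF lpa_relations.CK1[of e E f]]
      by (auto simp: factor_zero g generators_intros free_unital_zero)
  qed (auto intro!: rel lpa_relations.intros)
qed

text \<open>One inclusion writes monomials as products of generators; the other evaluates nonempty
  words letter by letter.\<close>

lemma span_eq_factor:
  assumes "wf_digraph E"
  shows "leavitt_family.L E (scalar :: 'k::field \<Rightarrow> ('v, 'e, 'k) lpa_product)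
    (\<lambda>v. factor E (gen (Vertex v))) (\<lambda>e. factor E (gen (Edge e))) (\<lambda>e. factor E (gen (Ghost e)))
    = factor E ` free_nonunital E" (is "?L = ?C")
proof -
  interpret leavitt_family E "scalar :: 'k \<Rightarrow> ('v, 'e, 'k) lpa_product"
    "\<lambda>v. factor E (gen (Vertex v))" "\<lambda>e. factor E (gen (Edge e))" "\<lambda>e. factor E (gen (Ghost e))"
    by (rule leavitt_family_factor[OF assms])
  have C_mult: "x * y \<in> ?C" if "x \<in> ?C" "y \<in> ?C" for x y
    using that by (auto simp: factor_mult[symmetric] carrier_free_unital intro!: imageI carrier_mult)
  have gen_C: "factor E (gen x) \<in> ?C" if "x \<in> generators E" for x
    using that by (intro imageI gen_carrier)
  have Mon_C: "Mon \<subseteq> ?C"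
  proof
    fix m assume "m \<in> Mon"
    then obtain p r u u' w where m: "awalk u p w" "awalk u' r w"
      "m = pe p * factor E (gen (Vertex w)) * ge r" by (elim MonE)
    have pe_C: "pe p * x \<in> ?C" if "awalk u p w" "x \<in> ?C" for u p x
      using that
    proof (induct p arbitrary: u)
      case (Cons e p)
      then have e: "e \<in> arcs E" "awalk (head E e) p w" by (simp_all add: awalk_Cons_iff)
      have "factor E (gen (Edge e)) * (pe p * x) \<in> ?C"
        by (intro C_mult gen_C generators_intros e(1) Cons.hyps[OF e(2) Cons.prems(2)])
      then show ?case by (simp add: mult.assoc)
    qed simp
    have ge_C: "x * ge r \<in> ?C" if "awalk u r w" "x \<in> ?C" for u r x
      using that
    proof (induct r arbitrary: u)
      case (Cons e r)
      then have e: "e \<in> arcs E" "awalk (head E e) r w" by (simp_all add: awalk_Cons_iff)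
      have "(x * ge r) * factor E (gen (Ghost e)) \<in> ?C"
        by (intro C_mult gen_C generators_intros e(1) Cons.hyps[OF e(2) Cons.prems(2)])
      then show ?case by (simp add: mult.assoc)
    qed simp
    have "factor E (gen (Vertex w)) \<in> ?C"
      using m awalk_last_in_verts by (intro gen_C generators_intros) blast
    then show "m \<in> ?C" unfolding m(3) using m by (intro ge_C pe_C)
  qed
  have "x \<in> ?C" if "x \<in> span Mon" for x
    using that
  proof induct
    case span_zero
    then show ?case using factor_zero carrier_zero by (metis imageI)
  next
    case (span_step s x c)
    then obtain a b where "a \<in> free_nonunital E" "b \<in> free_nonunital E" "s = factor E a" "x = factor E b"
      using Mon_C by blast
    then have "scalar c * s + x = factor E (scale c a + b)"
      by (simp add: factor_add factor_scale carrier_free_unital carrier_scale)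
    then show ?case using \<open>a \<in> _\<close> \<open>b \<in> _\<close> by (auto intro!: imageI carrier_add carrier_scale)
  qed
  moreover have "factor E a \<in> L" if a: "a \<in> free_nonunital E" for a
  proof -
    have word: "factor E (Poly_Mapping.single (Word xs) 1) \<in> L" if "xs \<noteq> []" "set xs \<subseteq> generators E" for xs
      using that
    proof (induct xs)
      case (Cons x xs)
      then have x: "factor E (gen x) \<in> L"
        by (auto simp: generators_def intro: V_L Ed_L Gh_L)
      show ?case
      proof (cases "xs = []")
        case True
        then show ?thesis using x by (simp add: gen_def)
      next
        case False
        have "Poly_Mapping.single (Word (x # xs)) 1 = gen x * Poly_Mapping.single (Word xs) (1 :: 'k)"
          by (simp add: gen_def mult_single plus_free_word_def)
        moreover have "(gen x :: ('v, 'e, 'k) free_alg) \<in> free_unital E"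
          using Cons.prems by (intro carrier_free_unital gen_carrier) simp
        moreover have "Poly_Mapping.single (Word xs) (1 :: 'k) \<in> free_unital E"
          using Cons.prems by (intro free_unital_single) simp
        ultimately show ?thesis using x Cons False by (simp add: factor_mult mult_L)
      qed
    qed simp
    have "factor E a \<in> L \<and> a \<in> free_unital E"
    proof (induct a rule: poly_mapping_monomial_induct)
      case 1
      then show ?case using zero_L by (simp add: factor_zero free_unital_zero)
    next
      case (2 w c f)
      then have w: "letters w \<noteq> []" "set (letters w) \<subseteq> generators E"
        using a by (auto simp: carrier_free_algebra)
      then have "factor E (Poly_Mapping.single w 1) \<in> L" using word[of "letters w"] by simp
      moreover have "Poly_Mapping.single w c = scale c (Poly_Mapping.single w 1)"
        by (simp add: scale_def mult_single)
      ultimately have "factor E (Poly_Mapping.single w c) \<in> L"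
        using w(2) by (simp add: factor_scale free_unital_single sc_L)
      then show ?case using 2 w(2) by (simp add: factor_add free_unital_single free_unital_add add_L)
    qed
    then show ?thesis by blast
  qed
  ultimately show ?thesis unfolding L_def by blast
qed

subsection \<open>Transfer to the quotient algebra\<close>

text \<open>No ring laws are assumed of R, whose unit field may be meaningless. Its additive group
  and its ideals are compared with those of L along the bijection \<phi>.\<close>

locale subring_model = nonunital_subring L
  for L :: "'a::ring set" +
  fixes R :: "('b, 'm) ring_scheme" (structure) and \<phi> :: "'b \<Rightarrow> 'a"
  assumes bij: "bij_betw \<phi> (carrier R) L"
    and zero_R: "\<zero> \<in> carrier R" "\<phi> \<zero> = 0"
    and add_R: "x \<in> carrier R \<Longrightarrow> y \<in> carrier R \<Longrightarrow> x \<oplus> y \<in> carrier R"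
      "x \<in> carrier R \<Longrightarrow> y \<in> carrier R \<Longrightarrow> \<phi> (x \<oplus> y) = \<phi> x + \<phi> y"
    and mult_R: "x \<in> carrier R \<Longrightarrow> y \<in> carrier R \<Longrightarrow> x \<otimes> y \<in> carrier R"
      "x \<in> carrier R \<Longrightarrow> y \<in> carrier R \<Longrightarrow> \<phi> (x \<otimes> y) = \<phi> x * \<phi> y"
begin

lemma inj: "x \<in> carrier R \<Longrightarrow> y \<in> carrier R \<Longrightarrow> \<phi> x = \<phi> y \<Longrightarrow> x = y"
  using bij by (auto simp: bij_betw_def dest: inj_onD)

lemma \<phi>_L: "x \<in> carrier R \<Longrightarrow> \<phi> x \<in> L"
  using bij by (auto simp: bij_betw_def)

lemma surj: assumes "y \<in> L" obtains x where "x \<in> carrier R" "\<phi> x = y"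
  using bij assms by (auto simp: bij_betw_def)

sublocale abelian_group R
proof (rule abelian_groupI)
  fix x assume x: "x \<in> carrier R"
  obtain y where "y \<in> carrier R" "\<phi> y = - \<phi> x" using surj uminus_L \<phi>_L[OF x] by metis
  then show "\<exists>y\<in>carrier R. y \<oplus> x = \<zero>"
    using x by (intro bexI[of _ y] inj) (simp_all add: add_R zero_R)
qed (auto intro!: inj simp: add_R zero_R add.assoc add.commute)

lemma \<phi>_minus: assumes "x \<in> carrier R" shows "\<phi> (\<ominus> x) = - \<phi> x"
proof -
  have "\<phi> (\<ominus> x) + \<phi> x = 0" using assms add_R(2)[of "\<ominus> x" x] l_neg zero_R by simp
  then show ?thesis by (simp add: eq_neg_iff_add_eq_0)
qed

lemma two_sided_ideal_image:
  assumes "two_sided_ideal I R"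
  shows "I \<subseteq> carrier R" "idl (\<phi> ` I)"
proof -
  from assms interpret additive_subgroup I R by (simp add: two_sided_ideal_def)
  show sub: "I \<subseteq> carrier R" by (rule a_subset)
  have mult: "x \<otimes> a \<in> I" "a \<otimes> x \<in> I" if "a \<in> I" "x \<in> carrier R" for a x
    using assms that by (auto simp: two_sided_ideal_def)
  show "idl (\<phi> ` I)"
  proof (rule idlI)
    show "\<phi> ` I \<subseteq> L" using sub \<phi>_L by blast
    show "0 \<in> \<phi> ` I" using zero_closed zero_R(2) by (metis imageI)
    show "x + y \<in> \<phi> ` I" if xy: "x \<in> \<phi> ` I" "y \<in> \<phi> ` I" for x y
    proof -
      obtain a b where ab: "a \<in> I" "b \<in> I" "x = \<phi> a" "y = \<phi> b" using xy by blast
      then have "x + y = \<phi> (a \<oplus> b)" using add_R(2)[of a b] sub by auto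
      then show ?thesis using ab by (auto intro!: imageI a_closed)
    qed
    show "- x \<in> \<phi> ` I" if x: "x \<in> \<phi> ` I" for x
    proof -
      obtain a where a: "a \<in> I" "x = \<phi> a" using x by blast
      then have "\<ominus> a \<in> I" by simp
      moreover have "- x = \<phi> (\<ominus> a)" using a \<phi>_minus[of a] sub by auto
      ultimately show ?thesis by simp
    qed
    show "a * x \<in> \<phi> ` I" if ax: "a \<in> L" "x \<in> \<phi> ` I" for a x
    proof -
      obtain b where b: "b \<in> carrier R" "\<phi> b = a" using surj[OF ax(1)] by blast
      obtain c where c: "c \<in> I" "x = \<phi> c" using ax(2) by blast
      have "a * x = \<phi> (b \<otimes> c)" using mult_R(2)[of b c] b c sub by auto
      then show ?thesis using mult(1)[OF c(1) b(1)] by (rule image_eqI)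
    qed
    show "x * a \<in> \<phi> ` I" if ax: "a \<in> L" "x \<in> \<phi> ` I" for a x
    proof -
      obtain b where b: "b \<in> carrier R" "\<phi> b = a" using surj[OF ax(1)] by blast
      obtain c where c: "c \<in> I" "x = \<phi> c" using ax(2) by blast
      have "x * a = \<phi> (c \<otimes> b)" using mult_R(2)[of c b] b c sub by auto
      then show ?thesis using mult(2)[OF c(1) b(1)] by (rule image_eqI)
    qed
  qed
qed

lemma two_sided_ideal_vimage:
  assumes I: "idl I"
  shows "two_sided_ideal {x \<in> carrier R. \<phi> x \<in> I} R"
proof -
  have "additive_subgroup {x \<in> carrier R. \<phi> x \<in> I} R"
  proof (intro additive_subgroupI add.subgroupI)
    show "{x \<in> carrier R. \<phi> x \<in> I} \<noteq> {}" using zero_R idl_zero[OF I] by auto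
  qed (auto simp: add_R idl_add[OF I] \<phi>_minus idl_uminus[OF I] simp flip: a_inv_def)
  then show ?thesis
    using I by (auto simp: two_sided_ideal_def mult_R intro: idl_left idl_right \<phi>_L)
qed

lemma ideal_prod_image:
  assumes I: "I \<subseteq> carrier R" and J: "J \<subseteq> carrier R"
  shows "ideal_prod R I J \<subseteq> carrier R" "\<phi> ` ideal_prod R I J = \<phi> ` I \<bullet> \<phi> ` J"
proof -
  have 1: "x \<in> carrier R \<and> \<phi> x \<in> \<phi> ` I \<bullet> \<phi> ` J" if "x \<in> ideal_prod R I J" for x
    using that
  proof induct
    case (prod i j)
    then have "i \<in> carrier R" "j \<in> carrier R" using I J by auto
    then show ?case using prod by (simp add: mult_R iprod.prod)
  next
    case (sum x y)
    then show ?case by (simp add: add_R iprod.add)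
  qed
  then show sub: "ideal_prod R I J \<subseteq> carrier R" by blast
  have "y \<in> \<phi> ` ideal_prod R I J" if "y \<in> \<phi> ` I \<bullet> \<phi> ` J" for y
    using that
  proof induct
    case (prod i j)
    then obtain a b where ab: "a \<in> I" "b \<in> J" "i = \<phi> a" "j = \<phi> b" by blast
    moreover from this have "a \<in> carrier R" "b \<in> carrier R" using I J by auto
    ultimately have "i * j = \<phi> (a \<otimes> b)" by (simp add: mult_R)
    then show ?case using ab by (auto intro!: imageI ideal_prod.prod)
  next
    case (add x y)
    then obtain a b where ab: "a \<in> ideal_prod R I J" "b \<in> ideal_prod R I J" "x = \<phi> a" "y = \<phi> b" by blast
    moreover from this have "a \<in> carrier R" "b \<in> carrier R" using sub by auto
    ultimately have "x + y = \<phi> (a \<oplus> b)" by (simp add: add_R)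
    then show ?case using ab by (auto intro!: imageI ideal_prod.sum)
  qed
  then show "\<phi> ` ideal_prod R I J = \<phi> ` I \<bullet> \<phi> ` J" using 1 by blast
qed

lemma ideal_power_image:
  "I \<subseteq> carrier R \<Longrightarrow> 0 < r \<Longrightarrow> ideal_power R I r \<subseteq> carrier R \<and> \<phi> ` ideal_power R I r = ipower (\<phi> ` I) r"
proof (induct r)
  case (Suc n)
  then show ?case by (cases n) (simp_all add: ideal_prod_image)
qed simp

lemma ideal_list_prod_image:
  "Is \<noteq> [] \<Longrightarrow> (\<And>I. I \<in> set Is \<Longrightarrow> I \<subseteq> carrier R) \<Longrightarrow>
    ideal_list_prod R Is \<subseteq> carrier R \<and> \<phi> ` ideal_list_prod R Is = iprod_list (map ((`) \<phi>) Is)"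
proof (induct Is rule: induct_list012)
  case (3 I J Is)
  then have "ideal_list_prod R (J # Is) \<subseteq> carrier R" "I \<subseteq> carrier R"
    "\<phi> ` ideal_list_prod R (J # Is) = iprod_list (map ((`) \<phi>) (J # Is))" by auto
  then show ?case by (simp add: ideal_prod_image)
qed simp_all

text \<open>Ideals of L are tested through their preimages, which are ideals of R; injectivity turns
  an inclusion of images back into one in R.\<close>

lemma prime_ideal_image:
  assumes "prime_ideal P R"
  shows "prime_idl (\<phi> ` P)"
proof -
  have P: "two_sided_ideal P R" "P \<noteq> carrier R" using assms by (auto simp: prime_ideal_def)
  note sub = two_sided_ideal_image(1)[OF P(1)]
  have img: "\<phi> ` {x \<in> carrier R. \<phi> x \<in> I} = I" if "I \<subseteq> L" for I
    using that bij by (auto simp: bij_betw_def)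
  show ?thesis
    unfolding prime_idl_def
  proof (intro conjI allI impI)
    show "idl (\<phi> ` P)" by (rule two_sided_ideal_image(2)[OF P(1)])
    show "\<phi> ` P \<noteq> L"
      using bij P(2) sub by (metis bij_betw_def inj_on_image_eq_iff order_refl)
    fix I J assume IJ: "idl I" "idl J" "I \<bullet> J \<subseteq> \<phi> ` P"
    let ?I = "{x \<in> carrier R. \<phi> x \<in> I}" and ?J = "{x \<in> carrier R. \<phi> x \<in> J}"
    have imgs: "\<phi> ` ?I = I" "\<phi> ` ?J = J" using IJ img by (auto intro!: img dest: idl_L)
    have *: "\<phi> ` ideal_prod R ?I ?J \<subseteq> \<phi> ` P" "ideal_prod R ?I ?J \<subseteq> carrier R"
      using ideal_prod_image[of ?I ?J] imgs IJ(3) by auto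
    have "ideal_prod R ?I ?J \<subseteq> P"
    proof
      fix x assume x: "x \<in> ideal_prod R ?I ?J"
      then obtain y where "y \<in> P" "\<phi> x = \<phi> y" using *(1) by blast
      moreover from this have "x = y" using x *(2) sub inj by blast
      ultimately show "x \<in> P" by simp
    qed
    then have "?I \<subseteq> P \<or> ?J \<subseteq> P"
      using assms two_sided_ideal_vimage[OF IJ(1)] two_sided_ideal_vimage[OF IJ(2)]
      unfolding prime_ideal_def by blast
    then have "\<phi> ` ?I \<subseteq> \<phi> ` P \<or> \<phi> ` ?J \<subseteq> \<phi> ` P" by (elim disjE) (simp_all add: image_mono)
    then show "I \<subseteq> \<phi> ` P \<or> J \<subseteq> \<phi> ` P" unfolding imgs .
  qed
qed

end

section \<open>The quotient algebra modelled in the ring type\<close>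

context
  fixes E :: "('v, 'e) pre_digraph"
  assumes wf: "wf_digraph E"
begin

interpretation wf_digraph E by (rule wf)

abbreviation coset :: "('v, 'e, 'k::field) free_alg \<Rightarrow> ('v, 'e, 'k) lpa_elem" where
  "coset a \<equiv> relation_ideal E +>\<^bsub>free_algebra E\<^esub> a"

lemma coset_iff: "b \<in> coset a \<longleftrightarrow> b - a \<in> relation_ideal E"
  by (auto simp: a_r_coset_def' free_algebra_def image_iff) (metis add.commute diff_add_cancel)

lemma coset_eq_iff: "coset a = coset b \<longleftrightarrow> a - b \<in> relation_ideal E"
proof
  assume "coset a = coset b"
  then show "a - b \<in> relation_ideal E" using coset_iff[of a a] coset_iff[of a b] by (simp add: relation_ideal.zero)
next
  assume *: "a - b \<in> relation_ideal E"
  have "x - a \<in> relation_ideal E \<longleftrightarrow> x - b \<in> relation_ideal E" for x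
    using relation_ideal.add[OF _ *, of "x - a"] relation_ideal_diff[OF _ *, of "x - b"] by auto
  then show "coset a = coset b" by (auto simp: coset_iff)
qed

lemma coset_add: "set_add (free_algebra E) (coset a) (coset b) = coset (a + b)"
proof -
  have "x \<in> set_add (free_algebra E) (coset a) (coset b) \<longleftrightarrow> x \<in> coset (a + b)" for x
  proof
    assume "x \<in> set_add (free_algebra E) (coset a) (coset b)"
    then obtain y z where "y \<in> coset a" "z \<in> coset b" "x = y + z" by (auto simp: set_add_def' free_algebra_add)
    then show "x \<in> coset (a + b)"
      using relation_ideal.add[of "y - a" E "z - b"] by (simp add: coset_iff algebra_simps)
  next
    assume "x \<in> coset (a + b)"
    then have "x - b \<in> coset a" "b \<in> coset b" by (auto simp: coset_iff relation_ideal.zero algebra_simps)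
    then show "x \<in> set_add (free_algebra E) (coset a) (coset b)"
      by (simp add: set_add_def' free_algebra_add) (metis diff_add_cancel)
  qed
  then show ?thesis by blast
qed

text \<open>\<open>rcoset_mult\<close> is a union over all pairs of representatives. The relation
  ideal absorbs their differences, so all cosets in the union coincide.\<close>

lemma coset_mult:
  assumes "a \<in> free_nonunital E" "b \<in> free_nonunital E"
  shows "rcoset_mult (free_algebra E) (relation_ideal E) (coset a) (coset b) = coset (a * b)"
proof -
  have "coset (x * y) = coset (a * b)" if "x \<in> coset a" "y \<in> coset b" for x y
  proof -
    have "x - a \<in> relation_ideal E" "y - b \<in> relation_ideal E" using that by (simp_all add: coset_iff)
    \<comment> \<open>The closure clauses of the relation ideal admit only multipliers from the free
      nonunital algebra, so y must be placed there.\<close>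
    moreover from this have "y \<in> free_nonunital E"
      using carrier_add[OF relation_ideal_carrier assms(2), of "y - b"] by simp
    ultimately have "(x - a) * y + a * (y - b) \<in> relation_ideal E"
      using assms by (intro relation_ideal.add relation_ideal.left relation_ideal.right)
    then show ?thesis by (simp add: coset_eq_iff algebra_simps)
  qed
  then have "(\<Union>x\<in>coset a. \<Union>y\<in>coset b. coset (x * y)) = (\<Union>x\<in>coset a. \<Union>y\<in>coset b. coset (a * b))"
    by (intro SUP_cong refl)
  moreover have "a \<in> coset a" "b \<in> coset b" by (simp_all add: coset_iff relation_ideal.zero)
  ultimately show ?thesis unfolding rcoset_mult_def free_algebra_mult by auto
qed

lemma carrier_lpa: "carrier (leavitt_path_algebra E) = coset ` free_nonunital E"
  by (auto simp: leavitt_path_algebra_def A_RCOSETS_def')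

text \<open>By \<open>factor_eq_iff\<close> the value does not depend on the chosen representative,
  for cosets of elements of the free nonunital algebra.\<close>

definition coset_rep :: "('v, 'e, 'k::field) lpa_elem \<Rightarrow> ('v, 'e, 'k) lpa_product" where
  "coset_rep X = factor E (SOME a. a \<in> X)"

lemma coset_rep_coset:
  assumes "a \<in> free_nonunital E"
  shows "coset_rep (coset a) = factor E a"
proof -
  have "(SOME b. b \<in> coset a) \<in> coset a"
    by (rule someI[of _ a]) (simp add: coset_iff relation_ideal.zero)
  then have *: "(SOME b. b \<in> coset a) - a \<in> relation_ideal E" by (simp add: coset_iff)
  then have "(SOME b. b \<in> coset a) \<in> free_nonunital E"
    using carrier_add[OF relation_ideal_carrier assms] by fastforce
  then show ?thesis unfolding coset_rep_def
    using * assms wf by (simp add: factor_eq_iff carrier_free_unital rel_ideal_def)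
qed

lemma subring_model_lpa:
  "subring_model (factor E ` free_nonunital E :: ('v, 'e, 'k::field) lpa_product set)
    (leavitt_path_algebra E :: ('k, ('v, 'e, 'k) lpa_elem) module) coset_rep"
proof -
  interpret leavitt_family E "scalar :: 'k \<Rightarrow> ('v, 'e, 'k) lpa_product"
    "\<lambda>v. factor E (gen (Vertex v))" "\<lambda>e. factor E (gen (Edge e))" "\<lambda>e. factor E (gen (Ghost e))"
    by (rule leavitt_family_factor[OF wf])
  have *: "nonunital_subring (factor E ` free_nonunital E :: ('v, 'e, 'k) lpa_product set)"
    using nonunital_subring_axioms unfolding span_eq_factor[OF wf] .
  note fu = carrier_free_unital carrier_mult carrier_add
  have zero: "\<zero>\<^bsub>leavitt_path_algebra E\<^esub> = coset (0 :: ('v, 'e, 'k) free_alg)"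
    by (auto simp: leavitt_path_algebra_def coset_iff)
  have add: "coset a \<oplus>\<^bsub>leavitt_path_algebra E\<^esub> coset b = coset (a + b)" for a b :: "('v, 'e, 'k) free_alg"
    by (simp add: leavitt_path_algebra_def coset_add)
  have mult: "coset a \<otimes>\<^bsub>leavitt_path_algebra E\<^esub> coset b = coset (a * b)"
    if "a \<in> free_nonunital E" "b \<in> free_nonunital E" for a b :: "('v, 'e, 'k) free_alg"
    using that by (simp add: leavitt_path_algebra_def coset_mult)
  show ?thesis
  proof (intro subring_model.intro[OF *] subring_model_axioms.intro)
    show "bij_betw coset_rep (carrier (leavitt_path_algebra E)) (factor E ` free_nonunital E :: ('v, 'e, 'k) lpa_product set)"
      unfolding bij_betw_def
    proof
      show "inj_on coset_rep (carrier (leavitt_path_algebra E) :: ('v, 'e, 'k) lpa_elem set)"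
        using wf by (auto simp: inj_on_def carrier_lpa coset_rep_coset factor_eq_iff fu rel_ideal_def coset_eq_iff)
      show "coset_rep ` carrier (leavitt_path_algebra E) = (factor E ` free_nonunital E :: ('v, 'e, 'k) lpa_product set)"
        by (simp add: carrier_lpa image_image coset_rep_coset)
    qed
    show "\<zero>\<^bsub>leavitt_path_algebra E\<^esub> \<in> (carrier (leavitt_path_algebra E) :: ('v, 'e, 'k) lpa_elem set)"
      by (simp add: zero carrier_lpa carrier_zero)
    show "coset_rep \<zero>\<^bsub>leavitt_path_algebra E\<^esub> = (0 :: ('v, 'e, 'k) lpa_product)"
      by (simp add: zero coset_rep_coset carrier_zero factor_zero)
  next
    fix x y :: "('v, 'e, 'k) lpa_elem"
    assume "x \<in> carrier (leavitt_path_algebra E)" "y \<in> carrier (leavitt_path_algebra E)"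
    then obtain a b where ab: "a \<in> free_nonunital E" "b \<in> free_nonunital E" "x = coset a" "y = coset b"
      by (auto simp: carrier_lpa)
    then show "x \<oplus>\<^bsub>leavitt_path_algebra E\<^esub> y \<in> carrier (leavitt_path_algebra E)"
      "coset_rep (x \<oplus>\<^bsub>leavitt_path_algebra E\<^esub> y) = coset_rep x + coset_rep y"
      "x \<otimes>\<^bsub>leavitt_path_algebra E\<^esub> y \<in> carrier (leavitt_path_algebra E)"
      "coset_rep (x \<otimes>\<^bsub>leavitt_path_algebra E\<^esub> y) = coset_rep x * coset_rep y"
      by (simp_all add: add mult carrier_lpa coset_rep_coset factor_add factor_mult fu)
  qed
qed

end

theorem proposition4p3:
  fixes E :: "('v, 'e) pre_digraph"
    and P :: "nat \<Rightarrow> ('v, 'e, 'k::field) lpa_elem set"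
    and r :: "nat \<Rightarrow> nat"
    and m :: nat
  defines "L \<equiv> (leavitt_path_algebra E :: ('k, ('v, 'e, 'k) lpa_elem) module)"
  assumes "lpa_graph E"
    and "m > 0"
    and "\<forall>i\<in>{1..m}. r i > 0"
    and "\<forall>i\<in>{1..m}. prime_ideal (P i) L"
    and "inj_on P {1..m}"
  shows "ideal_list_prod L (map (\<lambda>i. ideal_power L (P i) (r i)) [1..<Suc m])
    = (\<Inter>i\<in>{1..m}. ideal_power L (P i) (r i))"
proof -
  have wf: "wf_digraph E" using assms(2) by (simp add: lpa_graph_def)
  let ?\<phi> = "coset_rep E :: ('v, 'e, 'k) lpa_elem \<Rightarrow> ('v, 'e, 'k) lpa_product"
  let ?A = "\<lambda>i. ideal_power L (P i) (r i)"
  interpret model: subring_model "factor E ` free_nonunital E :: ('v, 'e, 'k) lpa_product set" L ?\<phi>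
    unfolding L_def by (rule subring_model_lpa[OF wf])
  have PI: "P i \<subseteq> carrier L" "model.prime_idl (?\<phi> ` P i)" if "i \<in> {1..m}" for i
    using that assms(5) model.two_sided_ideal_image(1) model.prime_ideal_image
    by (auto simp: prime_ideal_def)
  have inj: "inj_on ?\<phi> (carrier L)" using model.bij by (simp add: bij_betw_def)
  have "inj_on (\<lambda>i. ?\<phi> ` P i) {1..m}"
  proof (rule inj_onI)
    fix i j assume ij: "i \<in> {1..m}" "j \<in> {1..m}" "?\<phi> ` P i = ?\<phi> ` P j"
    then have "P i = P j" using inj_on_image_eq_iff[OF inj PI(1) PI(1)] by blast
    then show "i = j" using inj_onD[OF assms(6)] ij by blast
  qed
  then have *: "iprod_list (map (\<lambda>i. ipower (?\<phi> ` P i) (r i)) [1..<Suc m])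
      = (\<Inter>i\<in>{1..m}. ipower (?\<phi> ` P i) (r i))"
    using assms(3,4) PI(2)
    by (intro leavitt_family.iprod_list_prime_powers[OF leavitt_family_factor[OF wf]])
      (simp_all add: span_eq_factor[OF wf])
  have A: "?A i \<subseteq> carrier L" "?\<phi> ` ?A i = ipower (?\<phi> ` P i) (r i)" if "i \<in> {1..m}" for i
    using that model.ideal_power_image[OF PI(1)[OF that]] assms(4) by auto
  have prod: "ideal_list_prod L (map ?A [1..<Suc m]) \<subseteq> carrier L \<and>
      ?\<phi> ` ideal_list_prod L (map ?A [1..<Suc m]) = iprod_list (map ((`) ?\<phi>) (map ?A [1..<Suc m]))"
  proof (rule model.ideal_list_prod_image)
    fix I assume "I \<in> set (map ?A [1..<Suc m])"
    then obtain i where "i \<in> {1..m}" "I = ?A i"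
      unfolding set_map set_upt atLeastLessThanSuc_atLeastAtMost by blast
    then show "I \<subseteq> carrier L" using A(1) by blast
  qed (use assms(3) in simp)
  have map_eq: "map ((`) ?\<phi>) (map ?A [1..<Suc m]) = map (\<lambda>i. ipower (?\<phi> ` P i) (r i)) [1..<Suc m]"
    unfolding map_map
  proof (rule map_cong[OF refl])
    fix i assume "i \<in> set [1..<Suc m]"
    then have "i \<in> {1..m}" unfolding set_upt atLeastLessThanSuc_atLeastAtMost .
    then show "((`) ?\<phi> \<circ> ?A) i = ipower (?\<phi> ` P i) (r i)" using A(2) by simp
  qed
  have "?\<phi> ` ideal_list_prod L (map ?A [1..<Suc m]) = (\<Inter>i\<in>{1..m}. ipower (?\<phi> ` P i) (r i))"
    using conjunct2[OF prod] unfolding map_eq * .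
  also have "\<dots> = (\<Inter>i\<in>{1..m}. ?\<phi> ` ?A i)"
    by (rule INF_cong[OF refl]) (rule A(2)[symmetric])
  \<comment> \<open>The map is injective on the carrier, which contains all the powers, and the
    index set is nonempty, so image and intersection may be exchanged.\<close>
  also have "\<dots> = ?\<phi> ` (\<Inter>i\<in>{1..m}. ?A i)"
  proof (rule image_INT[symmetric, OF inj])
    show "\<forall>i\<in>{1..m}. ?A i \<subseteq> carrier L" using A(1) by blast
    show "1 \<in> {1..m}" using assms(3) by simp
  qed
  finally have eq: "?\<phi> ` ideal_list_prod L (map ?A [1..<Suc m]) = ?\<phi> ` (\<Inter>i\<in>{1..m}. ?A i)" .
  have sub: "(\<Inter>i\<in>{1..m}. ?A i) \<subseteq> carrier L"
  proof (rule INF_lower2)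
    show "1 \<in> {1..m}" using assms(3) by simp
    then show "?A 1 \<subseteq> carrier L" by (rule A(1))
  qed
  show ?thesis by (rule iffD1[OF inj_on_image_eq_iff[OF inj conjunct1[OF prod] sub] eq])
qed

end
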